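(* Let $(M,\tau)$ be a monoid equipped with a topology, and let $\mathcal{C}_s$ be the category of continuous principal $(M,\tau)$-sets. Then there is an equivalence $\mathrm{Cont}(M,\tau)\simeq \mathrm{Sh}(\mathcal{C}_s,J_r)$. In particular, topological monoids $(M,\tau)$ and $(M',\tau')$ are Morita equivalent, which is to say that $\mathrm{Cont}(M,\tau)\simeq\mathrm{Cont}(M',\tau')$, if and only if they have equivalent categories of continuous principal $(M,\tau)$-sets and $(M',\tau')$-sets respectively.
   Context: An $(M,\tau)$-set is a right $M$-set $X$ whose action $X\times M\to X$ is continuous when $X$ is given the discrete topology; $\mathrm{Cont}(M,\tau)$ is the category of $(M,\tau)$-sets and $M$-equivariant maps. An $(M,\tau)$-set is principal if it is generated by a single element, i.e. is a quotient of $M$ (acting on itself by right multiplication) as a right $M$-set; $\mathcal{C}_s$ is the (essentially small) full subcategory of $\mathrm{Cont}(M,\tau)$ on these. A strict epimorphism is a morphism which is the universal joint coequalizer of all the parallel pairs it coequalizes. The reductive topology $J_r$ on $\mathcal{C}_s$ is the Grothendieck topology whose covering sieves are those containing a strict epimorphism (on this category strict epimorphisms are stable, so this is a Grothendieck topology). *)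

theory Defs
  imports "HOL-Algebra.Group" "HOL-Analysis.Product_Topology" "HOL-Library.Equipollence"
begin

section \<open>Categories\<close>

text \<open>
  Categories are given by a set of objects and a family of hom-sets. The hom-sets for
  different pairs of objects need not be disjoint, so composition takes the three objects
  as arguments: \<open>Cmp C X Y Z g f\<close> is the composite of \<open>f : X \<rightarrow> Y\<close> and \<open>g : Y \<rightarrow> Z\<close>.
\<close>

record ('o, 'a) cat =
  Obj :: "'o set"
  Hom :: "'o \<Rightarrow> 'o \<Rightarrow> 'a set"
  Idt :: "'o \<Rightarrow> 'a"
  Cmp :: "'o \<Rightarrow> 'o \<Rightarrow> 'o \<Rightarrow> 'a \<Rightarrow> 'a \<Rightarrow> 'a"

locale category =
  fixes C :: "('o, 'a) cat"
  assumes idt_in_hom: "X \<in> Obj C \<Longrightarrow> Idt C X \<in> Hom C X X"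
    and cmp_in_hom:
      "\<lbrakk>X \<in> Obj C; Y \<in> Obj C; Z \<in> Obj C; f \<in> Hom C X Y; g \<in> Hom C Y Z\<rbrakk>
        \<Longrightarrow> Cmp C X Y Z g f \<in> Hom C X Z"
    and cmp_idt_left:
      "\<lbrakk>X \<in> Obj C; Y \<in> Obj C; f \<in> Hom C X Y\<rbrakk> \<Longrightarrow> Cmp C X Y Y (Idt C Y) f = f"
    and cmp_idt_right:
      "\<lbrakk>X \<in> Obj C; Y \<in> Obj C; f \<in> Hom C X Y\<rbrakk> \<Longrightarrow> Cmp C X X Y f (Idt C X) = f"
    and cmp_assoc:
      "\<lbrakk>W \<in> Obj C; X \<in> Obj C; Y \<in> Obj C; Z \<in> Obj C;
        f \<in> Hom C W X; g \<in> Hom C X Y; h \<in> Hom C Y Z\<rbrakk>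
        \<Longrightarrow> Cmp C W Y Z h (Cmp C W X Y g f) = Cmp C W X Z (Cmp C X Y Z h g) f"

definition op_cat :: "('o, 'a) cat \<Rightarrow> ('o, 'a) cat" where
  "op_cat C = \<lparr>Obj = Obj C, Hom = (\<lambda>X Y. Hom C Y X), Idt = Idt C,
    Cmp = (\<lambda>X Y Z g f. Cmp C Z Y X f g)\<rparr>"

definition full_subcat :: "('o, 'a) cat \<Rightarrow> ('o \<Rightarrow> bool) \<Rightarrow> ('o, 'a) cat" where
  "full_subcat C P = C\<lparr>Obj := {X \<in> Obj C. P X}\<rparr>"

definition iso_in :: "('o, 'a) cat \<Rightarrow> 'o \<Rightarrow> 'o \<Rightarrow> 'a \<Rightarrow> bool" where
  "iso_in C X Y f \<longleftrightarrow> f \<in> Hom C X Y \<and>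
    (\<exists>g\<in>Hom C Y X. Cmp C X Y X g f = Idt C X \<and> Cmp C Y X Y f g = Idt C Y)"

record ('o, 'a, 'p, 'b) func =
  on_obj :: "'o \<Rightarrow> 'p"
  on_hom :: "'o \<Rightarrow> 'o \<Rightarrow> 'a \<Rightarrow> 'b"

locale cat_functor = dom: category C + cod: category D
  for C :: "('o, 'a) cat" and D :: "('p, 'b) cat" +
  fixes F :: "('o, 'a, 'p, 'b) func"
  assumes on_obj_in: "X \<in> Obj C \<Longrightarrow> on_obj F X \<in> Obj D"
    and on_hom_in:
      "\<lbrakk>X \<in> Obj C; Y \<in> Obj C; f \<in> Hom C X Y\<rbrakk>
        \<Longrightarrow> on_hom F X Y f \<in> Hom D (on_obj F X) (on_obj F Y)"
    and on_hom_idt: "X \<in> Obj C \<Longrightarrow> on_hom F X X (Idt C X) = Idt D (on_obj F X)"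
    and on_hom_cmp:
      "\<lbrakk>X \<in> Obj C; Y \<in> Obj C; Z \<in> Obj C; f \<in> Hom C X Y; g \<in> Hom C Y Z\<rbrakk>
        \<Longrightarrow> on_hom F X Z (Cmp C X Y Z g f) =
          Cmp D (on_obj F X) (on_obj F Y) (on_obj F Z) (on_hom F Y Z g) (on_hom F X Y f)"

definition id_func :: "('o, 'a, 'o, 'a) func" where
  "id_func = \<lparr>on_obj = (\<lambda>X. X), on_hom = (\<lambda>X Y f. f)\<rparr>"

definition comp_func ::
  "('p, 'b, 'q, 'c) func \<Rightarrow> ('o, 'a, 'p, 'b) func \<Rightarrow> ('o, 'a, 'q, 'c) func" where
  "comp_func G F = \<lparr>on_obj = (\<lambda>X. on_obj G (on_obj F X)),
    on_hom = (\<lambda>X Y f. on_hom G (on_obj F X) (on_obj F Y) (on_hom F X Y f))\<rparr>"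

definition nat_trans ::
  "('o, 'a) cat \<Rightarrow> ('p, 'b) cat \<Rightarrow> ('o, 'a, 'p, 'b) func \<Rightarrow> ('o, 'a, 'p, 'b) func
    \<Rightarrow> ('o \<Rightarrow> 'b) \<Rightarrow> bool" where
  "nat_trans C D F G \<alpha> \<longleftrightarrow>
    (\<forall>X\<in>Obj C. \<alpha> X \<in> Hom D (on_obj F X) (on_obj G X)) \<and>
    (\<forall>X\<in>Obj C. \<forall>Y\<in>Obj C. \<forall>f\<in>Hom C X Y.
      Cmp D (on_obj F X) (on_obj F Y) (on_obj G Y) (\<alpha> Y) (on_hom F X Y f) =
      Cmp D (on_obj F X) (on_obj G X) (on_obj G Y) (on_hom G X Y f) (\<alpha> X))"

definition nat_iso ::
  "('o, 'a) cat \<Rightarrow> ('p, 'b) cat \<Rightarrow> ('o, 'a, 'p, 'b) func \<Rightarrow> ('o, 'a, 'p, 'b) func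
    \<Rightarrow> ('o \<Rightarrow> 'b) \<Rightarrow> bool" where
  "nat_iso C D F G \<alpha> \<longleftrightarrow> nat_trans C D F G \<alpha> \<and>
    (\<forall>X\<in>Obj C. iso_in D (on_obj F X) (on_obj G X) (\<alpha> X))"

definition equivalent_categories :: "('o, 'a) cat \<Rightarrow> ('p, 'b) cat \<Rightarrow> bool" where
  "equivalent_categories C D \<longleftrightarrow>
    (\<exists>F G \<eta> \<epsilon>. cat_functor C D F \<and> cat_functor D C G \<and>
      nat_iso C C id_func (comp_func G F) \<eta> \<and> nat_iso D D (comp_func F G) id_func \<epsilon>)"

section \<open>Presheaves and sheaves\<close>

text \<open>
  The type \<open>'u\<close> plays the role of the universe: the sets are the subsets of \<open>'u\<close>.
\<close>

definition set_cat :: "('u set, 'u \<Rightarrow> 'u) cat" where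
  "set_cat = \<lparr>Obj = UNIV, Hom = (\<lambda>A B. A \<rightarrow>\<^sub>E B), Idt = (\<lambda>A. \<lambda>x\<in>A. x),
    Cmp = (\<lambda>A B C g f. compose A g f)\<rparr>"

text \<open>
  Functors and natural transformations, as objects and arrows of a functor category, are
  required to be undefined outside their domain, so that HOL equality is equality of
  functors and of natural transformations.
\<close>

definition extensional_func :: "('o, 'a) cat \<Rightarrow> ('o, 'a, 'p, 'b) func \<Rightarrow> bool" where
  "extensional_func C F \<longleftrightarrow> on_obj F \<in> extensional (Obj C) \<and>
    (\<forall>X Y f. \<not> (X \<in> Obj C \<and> Y \<in> Obj C \<and> f \<in> Hom C X Y) \<longrightarrow> on_hom F X Y f = undefined)"

definition functor_cat ::
  "('o, 'a) cat \<Rightarrow> ('p, 'b) cat \<Rightarrow> (('o, 'a, 'p, 'b) func, 'o \<Rightarrow> 'b) cat" where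
  "functor_cat C D = \<lparr>
    Obj = {F. cat_functor C D F \<and> extensional_func C F},
    Hom = (\<lambda>F G. {\<alpha> \<in> extensional (Obj C). nat_trans C D F G \<alpha>}),
    Idt = (\<lambda>F. \<lambda>X\<in>Obj C. Idt D (on_obj F X)),
    Cmp = (\<lambda>F G H \<beta> \<alpha>. \<lambda>X\<in>Obj C. Cmp D (on_obj F X) (on_obj G X) (on_obj H X) (\<beta> X) (\<alpha> X))\<rparr>"

definition presheaf_cat ::
  "('o, 'a) cat \<Rightarrow> (('o, 'a, 'u set, 'u \<Rightarrow> 'u) func, 'o \<Rightarrow> 'u \<Rightarrow> 'u) cat" where
  "presheaf_cat C = functor_cat (op_cat C) set_cat"

text \<open>A sieve on \<open>X\<close> is a set of pairs \<open>(Y, f)\<close> with \<open>f : Y \<rightarrow> X\<close>.\<close>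

definition sieve :: "('o, 'a) cat \<Rightarrow> 'o \<Rightarrow> ('o \<times> 'a) set \<Rightarrow> bool" where
  "sieve C X S \<longleftrightarrow> S \<subseteq> (SIGMA Y:Obj C. Hom C Y X) \<and>
    (\<forall>(Y, f)\<in>S. \<forall>Z\<in>Obj C. \<forall>g\<in>Hom C Z Y. (Z, Cmp C Z Y X f g) \<in> S)"

definition matching_family ::
  "('o, 'a) cat \<Rightarrow> ('o, 'a, 'u set, 'u \<Rightarrow> 'u) func \<Rightarrow> 'o \<Rightarrow> ('o \<times> 'a) set
    \<Rightarrow> ('o \<Rightarrow> 'a \<Rightarrow> 'u) \<Rightarrow> bool" where
  "matching_family C F X S x \<longleftrightarrow>
    (\<forall>(Y, f)\<in>S. x Y f \<in> on_obj F Y \<and>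
      (\<forall>Z\<in>Obj C. \<forall>g\<in>Hom C Z Y. on_hom F Y Z g (x Y f) = x Z (Cmp C Z Y X f g)))"

definition is_sheaf ::
  "('o, 'a) cat \<Rightarrow> ('o \<Rightarrow> ('o \<times> 'a) set set) \<Rightarrow> ('o, 'a, 'u set, 'u \<Rightarrow> 'u) func \<Rightarrow> bool" where
  "is_sheaf C J F \<longleftrightarrow>
    (\<forall>X\<in>Obj C. \<forall>S\<in>J X. \<forall>x. matching_family C F X S x \<longrightarrow>
      (\<exists>!a. a \<in> on_obj F X \<and> (\<forall>(Y, f)\<in>S. on_hom F X Y f a = x Y f)))"

definition Sh ::
  "('o, 'a) cat \<Rightarrow> ('o \<Rightarrow> ('o \<times> 'a) set set)
    \<Rightarrow> (('o, 'a, 'u set, 'u \<Rightarrow> 'u) func, 'o \<Rightarrow> 'u \<Rightarrow> 'u) cat" where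
  "Sh C J = full_subcat (presheaf_cat C) (is_sheaf C J)"

section \<open>The reductive topology\<close>

definition strict_epi :: "('o, 'a) cat \<Rightarrow> 'o \<Rightarrow> 'o \<Rightarrow> 'a \<Rightarrow> bool" where
  "strict_epi C A B f \<longleftrightarrow> f \<in> Hom C A B \<and>
    (\<forall>T\<in>Obj C. \<forall>k\<in>Hom C A T.
      (\<forall>Z\<in>Obj C. \<forall>g\<in>Hom C Z A. \<forall>h\<in>Hom C Z A.
        Cmp C Z A B f g = Cmp C Z A B f h \<longrightarrow> Cmp C Z A T k g = Cmp C Z A T k h) \<longrightarrow>
      (\<exists>!l. l \<in> Hom C B T \<and> Cmp C A B T l f = k))"

definition reductive_topology :: "('o, 'a) cat \<Rightarrow> 'o \<Rightarrow> ('o \<times> 'a) set set" where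
  "reductive_topology C X = {S. sieve C X S \<and> (\<exists>(Y, f)\<in>S. strict_epi C Y X f)}"

section \<open>Continuous actions of a monoid with a topology\<close>

definition monoid_with_topology :: "'m monoid \<Rightarrow> 'm topology \<Rightarrow> bool" where
  "monoid_with_topology M \<tau> \<longleftrightarrow> monoid M \<and> topspace \<tau> = carrier M"

record ('u, 'm) mset =
  points :: "'u set"
  act :: "'u \<times> 'm \<Rightarrow> 'u"

definition right_mset :: "'m monoid \<Rightarrow> ('u, 'm) mset \<Rightarrow> bool" where
  "right_mset M X \<longleftrightarrow> act X \<in> points X \<times> carrier M \<rightarrow>\<^sub>E points X \<and>
    (\<forall>x\<in>points X. act X (x, \<one>\<^bsub>M\<^esub>) = x) \<and>
    (\<forall>x\<in>points X. \<forall>m\<in>carrier M. \<forall>n\<in>carrier M.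
      act X (act X (x, m), n) = act X (x, m \<otimes>\<^bsub>M\<^esub> n))"

definition continuous_mset :: "'m monoid \<Rightarrow> 'm topology \<Rightarrow> ('u, 'm) mset \<Rightarrow> bool" where
  "continuous_mset M \<tau> X \<longleftrightarrow> right_mset M X \<and>
    continuous_map (prod_topology (discrete_topology (points X)) \<tau>)
      (discrete_topology (points X)) (act X)"

definition equivariant_maps ::
  "'m monoid \<Rightarrow> ('u, 'm) mset \<Rightarrow> ('u, 'm) mset \<Rightarrow> ('u \<Rightarrow> 'u) set" where
  "equivariant_maps M X Y = {f \<in> points X \<rightarrow>\<^sub>E points Y.
    \<forall>x\<in>points X. \<forall>m\<in>carrier M. f (act X (x, m)) = act Y (f x, m)}"

definition Cont :: "'m monoid \<Rightarrow> 'm topology \<Rightarrow> (('u, 'm) mset, 'u \<Rightarrow> 'u) cat" where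
  "Cont M \<tau> = \<lparr>
    Obj = {X. continuous_mset M \<tau> X},
    Hom = equivariant_maps M,
    Idt = (\<lambda>X. \<lambda>x\<in>points X. x),
    Cmp = (\<lambda>X Y Z g f. compose (points X) g f)\<rparr>"

definition principal :: "'m monoid \<Rightarrow> ('u, 'm) mset \<Rightarrow> bool" where
  "principal M X \<longleftrightarrow> (\<exists>x\<in>points X. points X = {act X (x, m) |m. m \<in> carrier M})"

definition C_s :: "'m monoid \<Rightarrow> 'm topology \<Rightarrow> (('u, 'm) mset, 'u \<Rightarrow> 'u) cat" where
  "C_s M \<tau> = full_subcat (Cont M \<tau>) (principal M)"

text \<open>
  The smallness condition on the monoid relative to the universe \<open>'u\<close>. It makes the subsets
  of \<open>'u\<close> include, up to bijection, all quotients of \<open>M\<close>, and makes them closed under unions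
  indexed by the right congruences on \<open>M\<close>.
\<close>

definition small_monoid :: "'u itself \<Rightarrow> 'm monoid \<Rightarrow> bool" where
  "small_monoid _ M \<longleftrightarrow>
    infinite (UNIV :: 'u set) \<and> Pow (carrier M) \<lesssim> (UNIV :: 'u set)"

end

theory Submission
  imports Defs
begin

text \<open>
  Let \<open>K : C \<rightarrow> Cont(M, \<tau>)\<close> be a fully faithful functor whose essential image consists of the
  principal objects. Any two points of objects of \<open>C\<close> are images of one generator of a third
  object (the orbit of the pair in the product). Hence the strict epimorphisms of \<open>C\<close> are the
  surjections, \<open>X \<mapsto> Hom(K -, X)\<close> is a fully faithful functor into \<open>Sh(C, J_r)\<close>, and a sheaf \<open>F\<close>
  is isomorphic to the image of the coend of \<open>K c \<times> F c\<close>. Taking \<open>C = C_s(M, \<tau>)\<close> gives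
  the equivalence with sheaves. Applied to an equivalence \<open>C_s(M, \<tau>) \<rightarrow> C_s(M', \<tau>')\<close> followed by the inclusion, it gives
  \<open>Cont(M', \<tau>') \<simeq> Sh(C_s(M, \<tau>), J_r)\<close>, so that \<open>Cont\<close> is determined by \<open>C_s\<close>. Conversely, an
  object of \<open>Cont(M, \<tau>)\<close> is principal if and only if it has a largest proper subobject (the
  points that do not generate), which is invariant under equivalences.
\<close>

section \<open>Equivalences of categories\<close>

text \<open>The abstract \<open>K\<close> replaces an invariance theorem for sites:
  \<open>reductive_topology C\<close> is built from \<open>C\<close> alone, so two functors out of
  one \<open>C\<close> present two categories \<open>Cont\<close> by the same sheaves. Products of
  principal sets need not be principal, so pullbacks cannot be formed inside \<open>C\<close>; spans
  through prescribed points, found with the help of products in \<open>Cont\<close>, take their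
  place, and equality of arrows is tested at a generator. The other obstacle is size, since every
  set must be a subset of \<open>'u\<close>. Pairs are coded by an injection from
  \<open>'u * 'u\<close> to \<open>'u\<close>, which is why \<open>'u\<close> is infinite; maps out
  of \<open>K c\<close> are coded by their value at a generator; and the coend, which runs over a
  \<open>C\<close> that may have more objects than \<open>'u\<close> has elements, is cut down to
  one representative object per right congruence on \<open>M\<close>. Right congruences are subsets
  of \<open>carrier M * carrier M\<close>, and the bound on \<open>Pow (carrier M)\<close> lets them
  be coded in \<open>'u\<close>.\<close>

definition fully_faithful where
  "fully_faithful C D F \<longleftrightarrow> (\<forall>X\<in>Obj C. \<forall>Y\<in>Obj C.
    bij_betw (on_hom F X Y) (Hom C X Y) (Hom D (on_obj F X) (on_obj F Y)))"

definition ess_surj where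
  "ess_surj C D F \<longleftrightarrow> (\<forall>Y\<in>Obj D. \<exists>X\<in>Obj C. \<exists>f. iso_in D (on_obj F X) Y f)"

definition weak_equivalence where
  "weak_equivalence C D F \<longleftrightarrow> cat_functor C D F \<and> fully_faithful C D F \<and> ess_surj C D F"

lemmas (in category) cat_simps = idt_in_hom cmp_in_hom cmp_idt_left cmp_idt_right cmp_assoc

lemma (in cat_functor) faithfulD:
  assumes "fully_faithful C D F" "X \<in> Obj C" "Y \<in> Obj C" "f \<in> Hom C X Y" "g \<in> Hom C X Y"
    and "on_hom F X Y f = on_hom F X Y g"
  shows "f = g"
  using assms unfolding fully_faithful_def bij_betw_def by (meson inj_onD)

lemma (in cat_functor) fullE:
  assumes "fully_faithful C D F" "X \<in> Obj C" "Y \<in> Obj C"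
    and "h \<in> Hom D (on_obj F X) (on_obj F Y)"
  obtains f where "f \<in> Hom C X Y" "on_hom F X Y f = h"
proof -
  have "h \<in> on_hom F X Y ` Hom C X Y"
    using assms unfolding fully_faithful_def bij_betw_def by simp
  then show ?thesis
    using that by blast
qed

lemma iso_inE:
  assumes "iso_in C X Y f"
  obtains g where "f \<in> Hom C X Y" "g \<in> Hom C Y X" "Cmp C X Y X g f = Idt C X"
    "Cmp C Y X Y f g = Idt C Y"
  using assms unfolding iso_in_def by blast

lemma iso_in_sym:
  assumes "iso_in C X Y f"
  obtains g where "iso_in C Y X g" "Cmp C X Y X g f = Idt C X" "Cmp C Y X Y f g = Idt C Y"
  using assms unfolding iso_in_def by blast

context category
begin

lemma iso_in_idt:
  "X \<in> Obj C \<Longrightarrow> iso_in C X X (Idt C X)"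
  unfolding iso_in_def using cat_simps by blast

lemma iso_in_cmp:
  assumes X: "X \<in> Obj C" "Y \<in> Obj C" "Z \<in> Obj C"
    and f: "iso_in C X Y f" and g: "iso_in C Y Z g"
  shows "iso_in C X Z (Cmp C X Y Z g f)"
proof -
  obtain f' where f': "f \<in> Hom C X Y" "f' \<in> Hom C Y X" "Cmp C X Y X f' f = Idt C X"
    "Cmp C Y X Y f f' = Idt C Y"
    using f by (rule iso_inE)
  obtain g' where g': "g \<in> Hom C Y Z" "g' \<in> Hom C Z Y" "Cmp C Y Z Y g' g = Idt C Y"
    "Cmp C Z Y Z g g' = Idt C Z"
    using g by (rule iso_inE)
  have "Cmp C X Z X (Cmp C Z Y X f' g') (Cmp C X Y Z g f)
      = Cmp C X Y X f' (Cmp C X Y Y (Cmp C Y Z Y g' g) f)"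
    using X f'(1,2) g'(1,2) by (simp add: cat_simps)
  moreover have "Cmp C Z X Z (Cmp C X Y Z g f) (Cmp C Z Y X f' g')
      = Cmp C Z Y Z g (Cmp C Z Y Y (Cmp C Y X Y f f') g')"
    using X f'(1,2) g'(1,2) by (simp add: cat_simps)
  ultimately show ?thesis
    unfolding iso_in_def using X f' g'
    by (intro conjI bexI[of _ "Cmp C Z Y X f' g'"]) (simp_all add: cat_simps)
qed

lemma iso_cancel_right:
  assumes "X \<in> Obj C" "Y \<in> Obj C" "Z \<in> Obj C" "iso_in C X Y f"
    and "g \<in> Hom C Y Z" "h \<in> Hom C Y Z" "Cmp C X Y Z g f = Cmp C X Y Z h f"
  shows "g = h"
proof -
  obtain f' where f': "f \<in> Hom C X Y" "f' \<in> Hom C Y X" "Cmp C Y X Y f f' = Idt C Y"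
    using assms by (auto elim: iso_inE)
  have *: "Cmp C Y Y Z k (Cmp C Y X Y f f') = Cmp C Y X Z (Cmp C X Y Z k f) f'"
    if "k \<in> Hom C Y Z" for k
    using that assms f'(1,2) by (simp add: cat_simps)
  show ?thesis
    using *[of g] *[of h] assms f' by (simp add: cmp_idt_right)
qed

lemma iso_cancel_left:
  assumes "X \<in> Obj C" "Y \<in> Obj C" "Z \<in> Obj C" "iso_in C Y Z f"
    and "g \<in> Hom C X Y" "h \<in> Hom C X Y" "Cmp C X Y Z f g = Cmp C X Y Z f h"
  shows "g = h"
proof -
  obtain f' where f': "f \<in> Hom C Y Z" "f' \<in> Hom C Z Y" "Cmp C Y Z Y f' f = Idt C Y"
    using assms by (auto elim: iso_inE)
  have *: "Cmp C X Y Y (Cmp C Y Z Y f' f) k = Cmp C X Z Y f' (Cmp C X Y Z f k)"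
    if "k \<in> Hom C X Y" for k
    using that assms f'(1,2) by (simp add: cat_simps)
  show ?thesis
    using *[of g] *[of h] assms f' by (simp add: cmp_idt_left)
qed

lemma full_subcat: "category (full_subcat C P)"
  by unfold_locales (auto simp: full_subcat_def cat_simps)

lemma iso_in_full_subcat [simp]: "iso_in (full_subcat C P) = iso_in C"
  by (intro ext) (simp add: iso_in_def full_subcat_def)

end

lemma (in cat_functor) on_hom_iso:
  assumes "X \<in> Obj C" "Y \<in> Obj C" "iso_in C X Y f"
  shows "iso_in D (on_obj F X) (on_obj F Y) (on_hom F X Y f)"
proof -
  obtain g where "f \<in> Hom C X Y" "g \<in> Hom C Y X" "Cmp C X Y X g f = Idt C X"
    "Cmp C Y X Y f g = Idt C Y"
    using assms(3) by (rule iso_inE)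
  then show ?thesis
    using assms(1,2) on_hom_cmp[of X Y X f g] on_hom_cmp[of Y X Y g f]
    unfolding iso_in_def by (intro conjI bexI[of _ "on_hom F Y X g"])
      (simp_all add: on_hom_in on_hom_idt)
qed

text \<open>Fullness lifts the inverse; faithfulness lifts the two equations that make it an
  inverse.\<close>

lemma (in cat_functor) on_hom_iso_reflect:
  assumes ff: "fully_faithful C D F"
    and X: "X \<in> Obj C" "Y \<in> Obj C" and f: "f \<in> Hom C X Y"
    and iso: "iso_in D (on_obj F X) (on_obj F Y) (on_hom F X Y f)"
  shows "iso_in C X Y f"
proof -
  obtain h where h: "h \<in> Hom D (on_obj F Y) (on_obj F X)"
    "Cmp D (on_obj F X) (on_obj F Y) (on_obj F X) h (on_hom F X Y f) = Idt D (on_obj F X)"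
    "Cmp D (on_obj F Y) (on_obj F X) (on_obj F Y) (on_hom F X Y f) h = Idt D (on_obj F Y)"
    using iso by (rule iso_inE)
  obtain g where g: "g \<in> Hom C Y X" "on_hom F Y X g = h"
    using fullE[OF ff X(2,1) h(1)] by blast
  have "Cmp C X Y X g f = Idt C X"
    by (rule faithfulD[OF ff X(1) X(1)])
      (use X f g h in \<open>simp_all add: dom.cat_simps on_hom_cmp on_hom_idt\<close>)
  moreover have "Cmp C Y X Y f g = Idt C Y"
    by (rule faithfulD[OF ff X(2) X(2)])
      (use X f g h in \<open>simp_all add: dom.cat_simps on_hom_cmp on_hom_idt\<close>)
  ultimately show ?thesis
    using f g(1) unfolding iso_in_def by blast
qed

text \<open>The pointwise inverses are natural because both composites around the square become
  \<open>on_hom F X Y f\<close> after precomposition with the invertible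
  \<open>\<alpha> X\<close>.\<close>

lemma nat_iso_sym:
  assumes F: "cat_functor C D F" and G: "cat_functor C D G" and \<alpha>: "nat_iso C D F G \<alpha>"
  obtains \<beta> where "nat_iso C D G F \<beta>"
proof -
  interpret F: cat_functor C D F by fact
  interpret G: cat_functor C D G by fact
  have "\<exists>g. g \<in> Hom D (on_obj G X) (on_obj F X) \<and>
      Cmp D (on_obj F X) (on_obj G X) (on_obj F X) g (\<alpha> X) = Idt D (on_obj F X) \<and>
      Cmp D (on_obj G X) (on_obj F X) (on_obj G X) (\<alpha> X) g = Idt D (on_obj G X)"
    if "X \<in> Obj C" for X
    using \<alpha> that unfolding nat_iso_def iso_in_def by blast
  then obtain \<beta> where \<beta>: "\<And>X. X \<in> Obj C \<Longrightarrow> \<beta> X \<in> Hom D (on_obj G X) (on_obj F X)"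
    "\<And>X. X \<in> Obj C \<Longrightarrow> Cmp D (on_obj F X) (on_obj G X) (on_obj F X) (\<beta> X) (\<alpha> X) = Idt D (on_obj F X)"
    "\<And>X. X \<in> Obj C \<Longrightarrow> Cmp D (on_obj G X) (on_obj F X) (on_obj G X) (\<alpha> X) (\<beta> X) = Idt D (on_obj G X)"
    by metis
  have \<alpha>': "\<And>X. X \<in> Obj C \<Longrightarrow> \<alpha> X \<in> Hom D (on_obj F X) (on_obj G X)"
    "\<And>X. X \<in> Obj C \<Longrightarrow> iso_in D (on_obj F X) (on_obj G X) (\<alpha> X)"
    "\<And>X Y f. X \<in> Obj C \<Longrightarrow> Y \<in> Obj C \<Longrightarrow> f \<in> Hom C X Y \<Longrightarrow>
      Cmp D (on_obj F X) (on_obj F Y) (on_obj G Y) (\<alpha> Y) (on_hom F X Y f) =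
      Cmp D (on_obj F X) (on_obj G X) (on_obj G Y) (on_hom G X Y f) (\<alpha> X)"
    using \<alpha> unfolding nat_iso_def nat_trans_def by blast+
  have "nat_iso C D G F \<beta>"
    unfolding nat_iso_def nat_trans_def
  proof (intro conjI ballI)
    fix X Y f assume X: "X \<in> Obj C" and Y: "Y \<in> Obj C" and f: "f \<in> Hom C X Y"
    have ty: "\<alpha> X \<in> Hom D (on_obj F X) (on_obj G X)" "\<alpha> Y \<in> Hom D (on_obj F Y) (on_obj G Y)"
      "on_hom F X Y f \<in> Hom D (on_obj F X) (on_obj F Y)"
      "on_hom G X Y f \<in> Hom D (on_obj G X) (on_obj G Y)"
      "on_obj F X \<in> Obj D" "on_obj F Y \<in> Obj D" "on_obj G X \<in> Obj D" "on_obj G Y \<in> Obj D"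
      "\<beta> X \<in> Hom D (on_obj G X) (on_obj F X)" "\<beta> Y \<in> Hom D (on_obj G Y) (on_obj F Y)"
      using X Y f \<alpha>' \<beta> by (simp_all add: F.on_hom_in G.on_hom_in F.on_obj_in G.on_obj_in)
    let ?c = "Cmp D"
    let ?L = "?c (on_obj G X) (on_obj G Y) (on_obj F Y) (\<beta> Y) (on_hom G X Y f)"
    let ?R = "?c (on_obj G X) (on_obj F X) (on_obj F Y) (on_hom F X Y f) (\<beta> X)"
    have "?c (on_obj F X) (on_obj G X) (on_obj F Y) ?L (\<alpha> X)
        = ?c (on_obj F X) (on_obj G Y) (on_obj F Y) (\<beta> Y)
            (?c (on_obj F X) (on_obj F Y) (on_obj G Y) (\<alpha> Y) (on_hom F X Y f))"
      using ty by (simp add: \<alpha>'(3)[OF X Y f] F.cod.cat_simps)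
    also have "\<dots> = ?c (on_obj F X) (on_obj F Y) (on_obj F Y)
        (?c (on_obj F Y) (on_obj G Y) (on_obj F Y) (\<beta> Y) (\<alpha> Y)) (on_hom F X Y f)"
      using ty by (simp add: F.cod.cat_simps)
    also have "\<dots> = on_hom F X Y f"
      using ty \<beta>(2)[OF Y] by (simp add: F.cod.cat_simps)
    also have "\<dots> = ?c (on_obj F X) (on_obj F X) (on_obj F Y) (on_hom F X Y f)
        (?c (on_obj F X) (on_obj G X) (on_obj F X) (\<beta> X) (\<alpha> X))"
      using ty \<beta>(2)[OF X] by (simp add: F.cod.cmp_idt_right)
    also have "\<dots> = ?c (on_obj F X) (on_obj G X) (on_obj F Y) ?R (\<alpha> X)"
      using ty by (simp add: F.cod.cat_simps)
    finally show "?L = ?R"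
      using ty \<alpha>'(2)[OF X] by (intro F.cod.iso_cancel_right[of _ _ _ "\<alpha> X" ?L ?R])
        (auto simp: F.cod.cmp_in_hom)
  next
    fix X assume "X \<in> Obj C"
    then show "\<beta> X \<in> Hom D (on_obj G X) (on_obj F X)" "iso_in D (on_obj G X) (on_obj F X) (\<beta> X)"
      unfolding iso_in_def using \<alpha>' \<beta> by blast+
  qed
  then show ?thesis
    by (rule that)
qed

lemma cat_functor_comp:
  assumes "cat_functor C D F" "cat_functor D E G"
  shows "cat_functor C E (comp_func G F)"
proof -
  interpret F: cat_functor C D F by fact
  interpret G: cat_functor D E G by fact
  show ?thesis
    by unfold_locales (simp_all add: comp_func_def F.on_obj_in G.on_obj_in F.on_hom_in G.on_hom_in
        F.on_hom_idt G.on_hom_idt F.on_hom_cmp G.on_hom_cmp)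
qed

lemma cat_functor_id: "category C \<Longrightarrow> cat_functor C C id_func"
  by (simp add: cat_functor_def cat_functor_axioms_def id_func_def)

lemma equivalent_categories_sym:
  assumes "equivalent_categories C D"
  shows "equivalent_categories D C"
proof -
  obtain F G \<eta> \<epsilon> where FG: "cat_functor C D F" "cat_functor D C G"
    and "nat_iso C C id_func (comp_func G F) \<eta>" "nat_iso D D (comp_func F G) id_func \<epsilon>"
    using assms unfolding equivalent_categories_def by blast
  moreover have "category C" "category D"
    using FG unfolding cat_functor_def by simp_all
  ultimately show ?thesis
    unfolding equivalent_categories_def
    by (metis nat_iso_sym cat_functor_id cat_functor_comp)
qed

text \<open>Naturality of \<open>\<eta>\<close> shows that \<open>on_hom F X Y f\<close> determines
  the composite of \<open>f\<close> with the invertible \<open>\<eta> Y\<close>. Only the unit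
  enters, so the same lemma yields faithfulness of \<open>G\<close> from the inverse of the
  counit.\<close>

lemma faithful_of_nat_iso:
  assumes F: "cat_functor C D F" and G: "cat_functor D C G"
    and \<eta>: "nat_iso C C id_func (comp_func G F) \<eta>"
    and X: "X \<in> Obj C" and Y: "Y \<in> Obj C"
  shows "inj_on (on_hom F X Y) (Hom C X Y)"
proof (rule inj_onI)
  interpret F: cat_functor C D F by fact
  interpret G: cat_functor D C G by fact
  fix f g assume f: "f \<in> Hom C X Y" and g: "g \<in> Hom C X Y"
    and eq: "on_hom F X Y f = on_hom F X Y g"
  have "Cmp C X Y (on_obj G (on_obj F Y)) (\<eta> Y) f = Cmp C X Y (on_obj G (on_obj F Y)) (\<eta> Y) g"
    using \<eta> X Y f g eq unfolding nat_iso_def nat_trans_def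
    by (simp add: id_func_def comp_func_def)
  moreover have "iso_in C Y (on_obj G (on_obj F Y)) (\<eta> Y)"
    using \<eta> Y unfolding nat_iso_def by (simp add: id_func_def comp_func_def)
  ultimately show "f = g"
    using F.dom.iso_cancel_left[OF X Y _ _ f g] Y by (meson F.on_obj_in G.on_obj_in)
qed

lemma equivalence_imp_weak_equivalence:
  assumes F: "cat_functor C D F" and G: "cat_functor D C G"
    and \<eta>: "nat_iso C C id_func (comp_func G F) \<eta>"
    and \<epsilon>: "nat_iso D D (comp_func F G) id_func \<epsilon>"
  shows "weak_equivalence C D F"
proof -
  interpret F: cat_functor C D F by fact
  interpret G: cat_functor D C G by fact
  obtain \<epsilon>' where \<epsilon>': "nat_iso D D id_func (comp_func F G) \<epsilon>'"
    using nat_iso_sym[OF _ _ \<epsilon>] cat_functor_comp[OF G F] cat_functor_id[of D] F.cod.category_axioms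
    by blast
  have "bij_betw (on_hom F X Y) (Hom C X Y) (Hom D (on_obj F X) (on_obj F Y))"
    if X: "X \<in> Obj C" and Y: "Y \<in> Obj C" for X Y
    unfolding bij_betw_def
  proof (intro conjI equalityI subsetI)
    show "inj_on (on_hom F X Y) (Hom C X Y)"
      using faithful_of_nat_iso[OF F G \<eta> X Y] .
    fix h assume h: "h \<in> Hom D (on_obj F X) (on_obj F Y)"
    let ?X = "on_obj G (on_obj F X)" and ?Y = "on_obj G (on_obj F Y)"
    let ?Gh = "on_hom G (on_obj F X) (on_obj F Y) h"
    have ob: "?X \<in> Obj C" "?Y \<in> Obj C"
      using X Y by (simp_all add: F.on_obj_in G.on_obj_in)
    have Gh: "?Gh \<in> Hom C ?X ?Y"
      using X Y h by (simp add: F.on_obj_in G.on_hom_in)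
    have iso: "iso_in C X ?X (\<eta> X)" "iso_in C Y ?Y (\<eta> Y)"
      using \<eta> X Y unfolding nat_iso_def by (simp_all add: id_func_def comp_func_def)
    have \<eta>X: "\<eta> X \<in> Hom C X ?X"
      using iso by (auto elim: iso_inE)
    obtain k where k: "\<eta> Y \<in> Hom C Y ?Y" "k \<in> Hom C ?Y Y" "Cmp C ?Y Y ?Y (\<eta> Y) k = Idt C ?Y"
      using iso(2) by (auto elim: iso_inE)
    \<comment> \<open>The choice is forced by naturality: a preimage of \<open>h\<close> has to
      satisfy \<open>\<eta> Y f = G h \<eta> X\<close>, and \<open>k\<close> inverts
      \<open>\<eta> Y\<close>. It follows that \<open>G F f = G h\<close>, and faithfulness of
      \<open>G\<close> gives \<open>F f = h\<close>.\<close>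
    define f where "f = Cmp C X ?Y Y k (Cmp C X ?X ?Y ?Gh (\<eta> X))"
    have f: "f \<in> Hom C X Y"
      unfolding f_def using X Y ob Gh \<eta>X k by (simp add: F.dom.cat_simps)
    have Ff: "on_hom F X Y f \<in> Hom D (on_obj F X) (on_obj F Y)"
      using f X Y by (simp add: F.on_hom_in)
    have "Cmp C X ?X ?Y (on_hom G (on_obj F X) (on_obj F Y) (on_hom F X Y f)) (\<eta> X)
        = Cmp C X Y ?Y (\<eta> Y) f"
      using \<eta> X Y f unfolding nat_iso_def nat_trans_def by (simp add: id_func_def comp_func_def)
    also have "\<dots> = Cmp C X ?Y ?Y (Cmp C ?Y Y ?Y (\<eta> Y) k) (Cmp C X ?X ?Y ?Gh (\<eta> X))"
      unfolding f_def using X Y ob Gh \<eta>X k(1,2) by (simp add: F.dom.cat_simps)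
    also have "\<dots> = Cmp C X ?X ?Y ?Gh (\<eta> X)"
      using X Y ob Gh \<eta>X k by (simp add: F.dom.cmp_idt_left F.dom.cmp_in_hom)
    finally have "on_hom G (on_obj F X) (on_obj F Y) (on_hom F X Y f) = ?Gh"
      using F.dom.iso_cancel_right[OF X ob iso(1)] Ff X Y Gh by (simp add: F.on_obj_in G.on_hom_in)
    then have "on_hom F X Y f = h"
      using faithful_of_nat_iso[OF G F \<epsilon>', of "on_obj F X" "on_obj F Y"] Ff h X Y
      by (simp add: inj_on_eq_iff F.on_obj_in)
    then show "h \<in> on_hom F X Y ` Hom C X Y"
      using f by blast
  qed (use X Y F.on_hom_in in auto)
  moreover have "\<exists>X\<in>Obj C. \<exists>f. iso_in D (on_obj F X) Y f" if "Y \<in> Obj D" for Y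
    using \<epsilon> that unfolding nat_iso_def
    by (intro bexI[of _ "on_obj G Y"] exI[of _ "\<epsilon> Y"])
      (simp_all add: G.on_obj_in id_func_def comp_func_def)
  ultimately show ?thesis
    using F by (simp add: weak_equivalence_def fully_faithful_def ess_surj_def)
qed

text \<open>The quasi-inverse sends \<open>Y\<close> to a chosen object whose image is isomorphic to
  \<open>Y\<close>. All identities between lifted arrows are checked after applying the faithful
  \<open>F\<close>.\<close>

lemma weak_equivalence_imp_equivalent:
  assumes "weak_equivalence C D F"
  shows "equivalent_categories C D"
proof -
  have F: "cat_functor C D F" and ff: "fully_faithful C D F" and es: "ess_surj C D F"
    using assms unfolding weak_equivalence_def by auto
  interpret F: cat_functor C D F by fact
  let ?c = "Cmp D"
  have "\<exists>X e e'. X \<in> Obj C \<and> e \<in> Hom D (on_obj F X) Y \<and> e' \<in> Hom D Y (on_obj F X) \<and>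
     ?c (on_obj F X) Y (on_obj F X) e' e = Idt D (on_obj F X) \<and> ?c Y (on_obj F X) Y e e' = Idt D Y"
    if "Y \<in> Obj D" for Y
    using es that unfolding ess_surj_def iso_in_def by blast
  then obtain G e e' where
    G [simp]: "\<And>Y. Y \<in> Obj D \<Longrightarrow> G Y \<in> Obj C"
    and e [simp]: "\<And>Y. Y \<in> Obj D \<Longrightarrow> e Y \<in> Hom D (on_obj F (G Y)) Y"
    and e' [simp]: "\<And>Y. Y \<in> Obj D \<Longrightarrow> e' Y \<in> Hom D Y (on_obj F (G Y))"
    and e'e: "\<And>Y. Y \<in> Obj D \<Longrightarrow> ?c (on_obj F (G Y)) Y (on_obj F (G Y)) (e' Y) (e Y) = Idt D (on_obj F (G Y))"
    and ee': "\<And>Y. Y \<in> Obj D \<Longrightarrow> ?c Y (on_obj F (G Y)) Y (e Y) (e' Y) = Idt D Y"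
    by metis
  have [simp]: "X \<in> Obj C \<Longrightarrow> on_obj F X \<in> Obj D" for X
    by (rule F.on_obj_in)
  \<comment> \<open>Conjugation by the chosen isomorphisms turns \<open>g\<close> into an arrow
    between objects in the image of \<open>F\<close>, where fullness can lift it. It also makes
    \<open>e\<close> natural by construction, and functoriality of \<open>H\<close> follows by
    cancelling \<open>e Z\<close>.\<close>
  define H where "H Y Z g = ?c (on_obj F (G Y)) Z (on_obj F (G Z)) (e' Z)
      (?c (on_obj F (G Y)) Y Z g (e Y))" for Y Z g
  have H [simp]: "H Y Z g \<in> Hom D (on_obj F (G Y)) (on_obj F (G Z))"
    if "Y \<in> Obj D" "Z \<in> Obj D" "g \<in> Hom D Y Z" for Y Z g
    using that by (simp add: H_def F.cod.cmp_in_hom)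
  define L where "L X Y = inv_into (Hom C X Y) (on_hom F X Y)" for X Y
  have L: "L X Y h \<in> Hom C X Y" "on_hom F X Y (L X Y h) = h"
    if "X \<in> Obj C" "Y \<in> Obj C" "h \<in> Hom D (on_obj F X) (on_obj F Y)" for X Y h
  proof -
    have "h \<in> on_hom F X Y ` Hom C X Y"
      using that ff unfolding fully_faithful_def bij_betw_def by simp
    then show "L X Y h \<in> Hom C X Y" "on_hom F X Y (L X Y h) = h"
      unfolding L_def by (simp_all add: inv_into_into f_inv_into_f)
  qed
  have L_on_hom: "L X Y (on_hom F X Y f) = f" if "X \<in> Obj C" "Y \<in> Obj C" "f \<in> Hom C X Y" for X Y f
    using that ff unfolding L_def fully_faithful_def bij_betw_def by simp
  define GG where "GG = \<lparr>on_obj = G, on_hom = (\<lambda>Y Z g. L (G Y) (G Z) (H Y Z g))\<rparr>"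
  have GG [simp]: "on_obj GG = G" "on_hom GG Y Z g = L (G Y) (G Z) (H Y Z g)" for Y Z g
    by (simp_all add: GG_def)
  have e_nat: "?c (on_obj F (G Y)) (on_obj F (G Z)) Z (e Z) (H Y Z g)
      = ?c (on_obj F (G Y)) Y Z g (e Y)"
    if "Y \<in> Obj D" "Z \<in> Obj D" "g \<in> Hom D Y Z" for Y Z g
  proof -
    have "?c (on_obj F (G Y)) (on_obj F (G Z)) Z (e Z) (H Y Z g)
      = ?c (on_obj F (G Y)) Z Z (?c Z (on_obj F (G Z)) Z (e Z) (e' Z))
          (?c (on_obj F (G Y)) Y Z g (e Y))"
      using that unfolding H_def by (simp add: F.cod.cat_simps)
    then show ?thesis
      using that by (simp add: ee' F.cod.cmp_idt_left F.cod.cmp_in_hom)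
  qed
  have e_iso: "iso_in D (on_obj F (G Y)) Y (e Y)" if "Y \<in> Obj D" for Y
    unfolding iso_in_def using that e'e ee' by (intro conjI bexI[of _ "e' Y"]) simp_all
  have e'_iso: "iso_in D Y (on_obj F (G Y)) (e' Y)" if "Y \<in> Obj D" for Y
    unfolding iso_in_def using that e'e ee' by (intro conjI bexI[of _ "e Y"]) simp_all
  have G_fun: "cat_functor D C GG"
  proof unfold_locales
    fix Y assume Y: "Y \<in> Obj D"
    have "H Y Y (Idt D Y) = Idt D (on_obj F (G Y))"
      using Y unfolding H_def by (simp add: F.cod.cat_simps e'e)
    then show "on_hom GG Y Y (Idt D Y) = Idt C (on_obj GG Y)"
      using Y L_on_hom[of "G Y" "G Y" "Idt C (G Y)"] by (simp add: F.on_hom_idt F.dom.idt_in_hom)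
  next
    fix X Y Z f g
    assume X: "X \<in> Obj D" and Y: "Y \<in> Obj D" and Z: "Z \<in> Obj D"
      and f: "f \<in> Hom D X Y" and g: "g \<in> Hom D Y Z"
    let ?X = "on_obj F (G X)" and ?Y = "on_obj F (G Y)" and ?Z = "on_obj F (G Z)"
    have "?c ?X ?Z Z (e Z) (?c ?X ?Y ?Z (H Y Z g) (H X Y f))
        = ?c ?X ?Y Z (?c ?Y ?Z Z (e Z) (H Y Z g)) (H X Y f)"
      using X Y Z f g by (simp add: F.cod.cat_simps)
    also have "\<dots> = ?c ?X ?Y Z (?c ?Y Y Z g (e Y)) (H X Y f)"
      using Y Z g by (simp add: e_nat)
    also have "\<dots> = ?c ?X Y Z g (?c ?X ?Y Y (e Y) (H X Y f))"
      using X Y Z f g by (simp add: F.cod.cmp_assoc)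
    also have "\<dots> = ?c ?X Y Z g (?c ?X X Y f (e X))"
      using X Y f by (simp add: e_nat)
    also have "\<dots> = ?c ?X X Z (?c X Y Z g f) (e X)"
      using X Y Z f g by (simp add: F.cod.cmp_assoc)
    also have "\<dots> = ?c ?X ?Z Z (e Z) (H X Z (?c X Y Z g f))"
      using X Y Z f g by (simp add: e_nat F.cod.cmp_in_hom)
    finally have eq: "?c ?X ?Z Z (e Z) (?c ?X ?Y ?Z (H Y Z g) (H X Y f))
      = ?c ?X ?Z Z (e Z) (H X Z (?c X Y Z g f))" .
    have "?c ?X ?Y ?Z (H Y Z g) (H X Y f) = H X Z (?c X Y Z g f)"
      by (rule F.cod.iso_cancel_left[OF _ _ Z e_iso[OF Z] _ _ eq])
        (use X Y Z f g in \<open>simp_all add: F.cod.cmp_in_hom\<close>)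
    then show "on_hom GG X Z (Cmp D X Y Z g f)
        = Cmp C (on_obj GG X) (on_obj GG Y) (on_obj GG Z) (on_hom GG Y Z g) (on_hom GG X Y f)"
      using X Y Z f g
        L_on_hom[of "G X" "G Z" "Cmp C (G X) (G Y) (G Z) (L (G Y) (G Z) (H Y Z g)) (L (G X) (G Y) (H X Y f))"]
      by (simp add: L F.on_hom_cmp F.dom.cmp_in_hom)
  qed (simp_all add: L)
  have \<epsilon>: "nat_iso D D (comp_func F GG) id_func e"
    unfolding nat_iso_def nat_trans_def comp_func_def id_func_def
    by (auto simp: L e_nat e_iso)
  \<comment> \<open>The unit at \<open>X\<close> is the preimage under \<open>F\<close> of the
    inverse counit at \<open>F X\<close>; it is invertible because a fully faithful functor reflects
    isomorphisms.\<close>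
  define \<eta> where "\<eta> X = L X (G (on_obj F X)) (e' (on_obj F X))" for X
  have \<eta>: "\<eta> X \<in> Hom C X (G (on_obj F X))" "on_hom F X (G (on_obj F X)) (\<eta> X) = e' (on_obj F X)"
    if "X \<in> Obj C" for X
    unfolding \<eta>_def using that by (simp_all add: L)
  have "nat_iso C C id_func (comp_func GG F) \<eta>"
    unfolding nat_iso_def nat_trans_def comp_func_def id_func_def
  proof (simp add: \<eta>, intro conjI ballI)
    fix X assume X: "X \<in> Obj C"
    show "iso_in C X (G (on_obj F X)) (\<eta> X)"
      by (rule F.on_hom_iso_reflect[OF ff]) (use X in \<open>simp_all add: \<eta> e'_iso\<close>)
  next
    fix X Y f assume X: "X \<in> Obj C" and Y: "Y \<in> Obj C" and f: "f \<in> Hom C X Y"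
    let ?FX = "on_obj F X" and ?FY = "on_obj F Y"
    let ?X = "on_obj F (G ?FX)" and ?Y = "on_obj F (G ?FY)"
    let ?f = "on_hom F X Y f"
    have f': "?f \<in> Hom D ?FX ?FY"
      using X Y f by (simp add: F.on_hom_in)
    have "?c ?FX ?X ?Y (H ?FX ?FY ?f) (e' ?FX)
        = ?c ?FX ?FY ?Y (e' ?FY) (?c ?FX ?FX ?FY ?f (?c ?FX ?X ?FX (e ?FX) (e' ?FX)))"
      unfolding H_def using X Y f' by (simp add: F.cod.cat_simps)
    also have "\<dots> = ?c ?FX ?FY ?Y (e' ?FY) ?f"
      using X Y f' by (simp add: ee' F.cod.cmp_idt_right)
    finally have eq: "on_hom F X (G ?FY) (Cmp C X Y (G ?FY) (\<eta> Y) f) = on_hom F X (G ?FY)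
        (Cmp C X (G ?FX) (G ?FY) (L (G ?FX) (G ?FY) (H ?FX ?FY ?f)) (\<eta> X))"
      using X Y f f' by (simp add: F.on_hom_cmp \<eta> L)
    have "G ?FY \<in> Obj C" "Cmp C X Y (G ?FY) (\<eta> Y) f \<in> Hom C X (G ?FY)"
      "Cmp C X (G ?FX) (G ?FY) (L (G ?FX) (G ?FY) (H ?FX ?FY ?f)) (\<eta> X) \<in> Hom C X (G ?FY)"
      using X Y f f' by (simp_all add: F.dom.cmp_in_hom \<eta> L)
    then show "Cmp C X Y (G ?FY) (\<eta> Y) f =
        Cmp C X (G ?FX) (G ?FY) (L (G ?FX) (G ?FY) (H ?FX ?FY ?f)) (\<eta> X)"
      using F.faithfulD[OF ff X _ _ _ eq] by blast
  qed
  then show ?thesis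
    unfolding equivalent_categories_def using F G_fun \<epsilon> by blast
qed

lemma weak_equivalence_comp:
  assumes F: "weak_equivalence C D F" and G: "weak_equivalence D E G"
  shows "weak_equivalence C E (comp_func G F)"
proof -
  interpret F: cat_functor C D F using F by (simp add: weak_equivalence_def)
  interpret G: cat_functor D E G using G by (simp add: weak_equivalence_def)
  have "bij_betw (\<lambda>f. on_hom G (on_obj F X) (on_obj F Y) (on_hom F X Y f)) (Hom C X Y)
      (Hom E (on_obj G (on_obj F X)) (on_obj G (on_obj F Y)))"
    if "X \<in> Obj C" "Y \<in> Obj C" for X Y
    using bij_betw_trans[of "on_hom F X Y" "Hom C X Y" "Hom D (on_obj F X) (on_obj F Y)"
        "on_hom G (on_obj F X) (on_obj F Y)"] F G that
    unfolding weak_equivalence_def fully_faithful_def by (simp add: F.on_obj_in comp_def)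
  moreover have "\<exists>X\<in>Obj C. \<exists>f. iso_in E (on_obj G (on_obj F X)) Z f" if Z: "Z \<in> Obj E" for Z
  proof -
    obtain Y g where Y: "Y \<in> Obj D" "iso_in E (on_obj G Y) Z g"
      using G Z unfolding weak_equivalence_def ess_surj_def by blast
    obtain X f where X: "X \<in> Obj C" "iso_in D (on_obj F X) Y f"
      using F Y unfolding weak_equivalence_def ess_surj_def by blast
    have "iso_in E (on_obj G (on_obj F X)) (on_obj G Y) (on_hom G (on_obj F X) Y f)"
      using X Y by (intro G.on_hom_iso) (simp_all add: F.on_obj_in)
    then show ?thesis
      using G.cod.iso_in_cmp[OF _ _ Z _ Y(2)] X Y by (meson F.on_obj_in G.on_obj_in)
  qed
  ultimately show ?thesis
    using cat_functor_comp[OF F.cat_functor_axioms G.cat_functor_axioms]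
    by (simp add: weak_equivalence_def fully_faithful_def ess_surj_def comp_func_def)
qed

lemma equivalent_categories_iff: "equivalent_categories C D \<longleftrightarrow> (\<exists>F. weak_equivalence C D F)"
  by (meson equivalence_imp_weak_equivalence weak_equivalence_imp_equivalent
      equivalent_categories_def)

lemma equivalent_categories_trans:
  "equivalent_categories C D \<Longrightarrow> equivalent_categories D E \<Longrightarrow> equivalent_categories C E"
  unfolding equivalent_categories_iff using weak_equivalence_comp by blast

section \<open>Largest proper subobjects\<close>

definition mono_in where
  "mono_in C X Y f \<longleftrightarrow> f \<in> Hom C X Y \<and> (\<forall>Z\<in>Obj C. \<forall>g\<in>Hom C Z X. \<forall>h\<in>Hom C Z X.
    Cmp C Z X Y f g = Cmp C Z X Y f h \<longrightarrow> g = h)"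

text \<open>Subobjects are represented by monomorphisms, and proper means not invertible. Speaking
  of arrows only, the property can be carried across an equivalence.\<close>

definition has_largest_proper_subobject where
  "has_largest_proper_subobject C X \<longleftrightarrow>
    (\<exists>N\<in>Obj C. \<exists>n. mono_in C N X n \<and> \<not> iso_in C N X n \<and>
      (\<forall>A\<in>Obj C. \<forall>m. mono_in C A X m \<and> \<not> iso_in C A X m \<longrightarrow> (\<exists>k\<in>Hom C A N. Cmp C A N X n k = m)))"

text \<open>A test object \<open>Z\<close> of \<open>D\<close> is replaced by an isomorphic one in
  the image of \<open>F\<close>, where fullness brings the two test arrows back to
  \<open>C\<close>.\<close>

lemma (in cat_functor) mono_in_preserve:
  assumes F: "weak_equivalence C D F" and X: "X \<in> Obj C" "Y \<in> Obj C"
    and f: "mono_in C X Y f"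
  shows "mono_in D (on_obj F X) (on_obj F Y) (on_hom F X Y f)"
  unfolding mono_in_def
proof (intro conjI ballI impI)
  have ff: "fully_faithful C D F" and es: "ess_surj C D F"
    using F by (simp_all add: weak_equivalence_def)
  have fh: "f \<in> Hom C X Y"
    using f by (simp add: mono_in_def)
  then show Ff: "on_hom F X Y f \<in> Hom D (on_obj F X) (on_obj F Y)"
    using X by (simp add: on_hom_in)
  fix Z g h assume Z: "Z \<in> Obj D" and g: "g \<in> Hom D Z (on_obj F X)" and h: "h \<in> Hom D Z (on_obj F X)"
    and eq: "Cmp D Z (on_obj F X) (on_obj F Y) (on_hom F X Y f) g =
       Cmp D Z (on_obj F X) (on_obj F Y) (on_hom F X Y f) h"
  obtain W i where W: "W \<in> Obj C" "iso_in D (on_obj F W) Z i"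
    using es Z unfolding ess_surj_def by blast
  then have i: "i \<in> Hom D (on_obj F W) Z"
    by (simp add: iso_in_def)
  have ob: "on_obj F W \<in> Obj D" "on_obj F X \<in> Obj D" "on_obj F Y \<in> Obj D"
    using W X by (simp_all add: on_obj_in)
  obtain g' where g': "g' \<in> Hom C W X" "on_hom F W X g' = Cmp D (on_obj F W) Z (on_obj F X) g i"
    using fullE[OF ff W(1) X(1)] ob g i Z by (metis cod.cmp_in_hom)
  obtain h' where h': "h' \<in> Hom C W X" "on_hom F W X h' = Cmp D (on_obj F W) Z (on_obj F X) h i"
    using fullE[OF ff W(1) X(1)] ob h i Z by (metis cod.cmp_in_hom)
  have "on_hom F W Y (Cmp C W X Y f g') = on_hom F W Y (Cmp C W X Y f h')"
    using g' h' W X fh ob i g h Ff Z eq by (simp add: on_hom_cmp cod.cmp_assoc)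
  then have "Cmp C W X Y f g' = Cmp C W X Y f h'"
    using faithfulD[OF ff W(1) X(2)] g' h' W X fh by (simp add: dom.cmp_in_hom)
  then have "g' = h'"
    using f W g' h' unfolding mono_in_def by blast
  then show "g = h"
    using g' h' ob Z g h W(2) cod.iso_cancel_right by metis
qed

lemma (in cat_functor) mono_in_reflect:
  assumes ff: "fully_faithful C D F" and X: "X \<in> Obj C" "Y \<in> Obj C" "f \<in> Hom C X Y"
    and f: "mono_in D (on_obj F X) (on_obj F Y) (on_hom F X Y f)"
  shows "mono_in C X Y f"
  unfolding mono_in_def
proof (intro conjI ballI impI)
  fix Z g h assume Z: "Z \<in> Obj C" and g: "g \<in> Hom C Z X" and h: "h \<in> Hom C Z X"
    and eq: "Cmp C Z X Y f g = Cmp C Z X Y f h"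
  then have "Cmp D (on_obj F Z) (on_obj F X) (on_obj F Y) (on_hom F X Y f) (on_hom F Z X g)
      = Cmp D (on_obj F Z) (on_obj F X) (on_obj F Y) (on_hom F X Y f) (on_hom F Z X h)"
    using X on_hom_cmp[of Z X Y g f] on_hom_cmp[of Z X Y h f] by simp
  then have "on_hom F Z X g = on_hom F Z X h"
    using f X Z g h unfolding mono_in_def by (blast intro: on_obj_in on_hom_in)
  then show "g = h"
    using faithfulD[OF ff Z X(1) g h] by simp
qed (fact X(3))

lemma (in category) mono_in_cmp_iso:
  assumes X: "X \<in> Obj C" "Y \<in> Obj C" "Z \<in> Obj C"
    and f: "iso_in C X Y f" and g: "mono_in C Y Z g"
  shows "mono_in C X Z (Cmp C X Y Z g f)"
  unfolding mono_in_def
proof (intro conjI ballI impI)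
  have fg: "f \<in> Hom C X Y" "g \<in> Hom C Y Z"
    using f g by (simp_all add: iso_in_def mono_in_def)
  then show "Cmp C X Y Z g f \<in> Hom C X Z"
    using X by (simp add: cmp_in_hom)
  fix W h k assume W: "W \<in> Obj C" and h: "h \<in> Hom C W X" and k: "k \<in> Hom C W X"
    and "Cmp C W X Z (Cmp C X Y Z g f) h = Cmp C W X Z (Cmp C X Y Z g f) k"
  then have "Cmp C W Y Z g (Cmp C W X Y f h) = Cmp C W Y Z g (Cmp C W X Y f k)"
    using X fg by (simp add: cmp_assoc)
  then have "Cmp C W X Y f h = Cmp C W X Y f k"
    using g W X fg h k unfolding mono_in_def by (simp add: cmp_in_hom)
  then show "h = k"
    using iso_cancel_left[OF W X(1,2) f h k] by simp
qed

text \<open>The image of the largest proper subobject is again the largest one: a proper mono into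
  \<open>F X\<close> is, up to an isomorphism of its domain, the image of a proper mono into
  \<open>X\<close>, and the factorization found in \<open>C\<close> is carried back.\<close>

lemma (in cat_functor) largest_proper_subobject_preserve:
  assumes F: "weak_equivalence C D F" and X: "X \<in> Obj C"
    and lp: "has_largest_proper_subobject C X"
  shows "has_largest_proper_subobject D (on_obj F X)"
proof -
  have ff: "fully_faithful C D F" and es: "ess_surj C D F"
    using F by (simp_all add: weak_equivalence_def)
  obtain N n where N: "N \<in> Obj C" "mono_in C N X n" "\<not> iso_in C N X n"
    and max: "\<And>A m. A \<in> Obj C \<Longrightarrow> mono_in C A X m \<Longrightarrow> \<not> iso_in C A X m \<Longrightarrow>
      \<exists>k\<in>Hom C A N. Cmp C A N X n k = m"
    using lp unfolding has_largest_proper_subobject_def by blast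
  have n: "n \<in> Hom C N X"
    using N by (simp add: mono_in_def)
  show ?thesis
    unfolding has_largest_proper_subobject_def
  proof (intro bexI[of _ "on_obj F N"] exI[of _ "on_hom F N X n"] conjI ballI allI impI)
    show "mono_in D (on_obj F N) (on_obj F X) (on_hom F N X n)"
      using mono_in_preserve[OF F N(1) X N(2)] .
    show "\<not> iso_in D (on_obj F N) (on_obj F X) (on_hom F N X n)"
      using on_hom_iso_reflect[OF ff N(1) X n] N(3) by blast
    show "on_obj F N \<in> Obj D"
      using N by (simp add: on_obj_in)
    fix A m assume A: "A \<in> Obj D"
      and "mono_in D A (on_obj F X) m \<and> \<not> iso_in D A (on_obj F X) m"
    then have m: "mono_in D A (on_obj F X) m" "\<not> iso_in D A (on_obj F X) m"
      by auto
    then have mh: "m \<in> Hom D A (on_obj F X)"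
      by (simp add: mono_in_def)
    obtain B i where B: "B \<in> Obj C" "iso_in D (on_obj F B) A i"
      using es A unfolding ess_surj_def by blast
    obtain j where j: "iso_in D A (on_obj F B) j" "Cmp D A (on_obj F B) A i j = Idt D A"
      using iso_in_sym[OF B(2)] by metis
    have ij: "i \<in> Hom D (on_obj F B) A" "j \<in> Hom D A (on_obj F B)"
      using B(2) j(1) by (simp_all add: iso_in_def)
    have ob: "on_obj F B \<in> Obj D" "on_obj F X \<in> Obj D" "on_obj F N \<in> Obj D"
      using B X N by (simp_all add: on_obj_in)
    let ?mi = "Cmp D (on_obj F B) A (on_obj F X) m i"
    have mij: "Cmp D A (on_obj F B) (on_obj F X) ?mi j = m"
    proof -
      have "Cmp D A (on_obj F B) (on_obj F X) ?mi j
          = Cmp D A A (on_obj F X) m (Cmp D A (on_obj F B) A i j)"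
        using ob A ij mh by (simp add: cod.cmp_assoc)
      then show ?thesis
        using A mh ob j(2) by (simp add: cod.cmp_idt_right)
    qed
    obtain m' where m': "m' \<in> Hom C B X" "on_hom F B X m' = ?mi"
      using fullE[OF ff B(1) X] ob A ij mh by (metis cod.cmp_in_hom)
    have "mono_in C B X m'"
      using mono_in_reflect[OF ff B(1) X m'(1)] m'(2) cod.mono_in_cmp_iso[OF ob(1) A ob(2) B(2) m(1)]
      by simp
    moreover have "\<not> iso_in C B X m'"
    proof
      assume "iso_in C B X m'"
      then have "iso_in D (on_obj F B) (on_obj F X) ?mi"
        using on_hom_iso[OF B(1) X] m'(2) by metis
      then have "iso_in D A (on_obj F X) m"
        using cod.iso_in_cmp[OF A ob(1,2) j(1)] mij by metis
      then show False using m(2) by simp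
    qed
    ultimately obtain k where k: "k \<in> Hom C B N" "Cmp C B N X n k = m'"
      using max B(1) by blast
    show "\<exists>k\<in>Hom D A (on_obj F N). Cmp D A (on_obj F N) (on_obj F X) (on_hom F N X n) k = m"
    proof (intro bexI)
      let ?k = "Cmp D A (on_obj F B) (on_obj F N) (on_hom F B N k) j"
      show "?k \<in> Hom D A (on_obj F N)"
        using A ob k B N ij by (simp add: cod.cmp_in_hom on_hom_in)
      have "?mi = Cmp D (on_obj F B) (on_obj F N) (on_obj F X) (on_hom F N X n) (on_hom F B N k)"
        using m'(2) k n B N X by (simp add: on_hom_cmp[symmetric])
      then have "Cmp D A (on_obj F N) (on_obj F X) (on_hom F N X n) ?k
          = Cmp D A (on_obj F B) (on_obj F X) ?mi j"
        using A ob k n B X N ij by (simp add: cod.cmp_assoc on_hom_in)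
      then show "Cmp D A (on_obj F N) (on_obj F X) (on_hom F N X n) ?k = m"
        using mij by simp
    qed
  qed
qed

text \<open>The same functors and natural isomorphisms restrict to the full subcategories, once both
  functors are known to preserve the predicates.\<close>

lemma equivalent_full_subcat:
  assumes eq: "equivalent_categories C D"
    and P: "\<And>X. X \<in> Obj C \<Longrightarrow> P X \<longleftrightarrow> has_largest_proper_subobject C X"
    and Q: "\<And>X. X \<in> Obj D \<Longrightarrow> Q X \<longleftrightarrow> has_largest_proper_subobject D X"
  shows "equivalent_categories (full_subcat C P) (full_subcat D Q)"
proof -
  obtain F G \<eta> \<epsilon> where F: "cat_functor C D F" and G: "cat_functor D C G"
    and \<eta>: "nat_iso C C id_func (comp_func G F) \<eta>"
    and \<epsilon>: "nat_iso D D (comp_func F G) id_func \<epsilon>"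
    using eq unfolding equivalent_categories_def by blast
  interpret F: cat_functor C D F by fact
  interpret G: cat_functor D C G by fact
  have wF: "weak_equivalence C D F"
    using equivalence_imp_weak_equivalence[OF F G \<eta> \<epsilon>] .
  have wG: "weak_equivalence D C G"
  proof -
    obtain \<eta>' where "nat_iso C C (comp_func G F) id_func \<eta>'"
      using nat_iso_sym[OF _ _ \<eta>] cat_functor_comp[OF F G] cat_functor_id[of C]
        F.dom.category_axioms by blast
    moreover obtain \<epsilon>' where "nat_iso D D id_func (comp_func F G) \<epsilon>'"
      using nat_iso_sym[OF _ _ \<epsilon>] cat_functor_comp[OF G F] cat_functor_id[of D]
        F.cod.category_axioms by blast
    ultimately show ?thesis
      using equivalence_imp_weak_equivalence[OF G F] by blast
  qed
  let ?C = "full_subcat C P" and ?D = "full_subcat D Q"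
  have QF: "Q (on_obj F X)" if "X \<in> Obj C" "P X" for X
    using F.largest_proper_subobject_preserve[OF wF that(1)] P[OF that(1)] Q that
    by (simp add: F.on_obj_in)
  have PG: "P (on_obj G X)" if "X \<in> Obj D" "Q X" for X
    using G.largest_proper_subobject_preserve[OF wG that(1)] Q[OF that(1)] P that
    by (simp add: G.on_obj_in)
  have "cat_functor ?C ?D F"
    unfolding cat_functor_def cat_functor_axioms_def
    using F.dom.full_subcat F.cod.full_subcat
    by (auto simp: full_subcat_def QF F.on_obj_in F.on_hom_in F.on_hom_idt F.on_hom_cmp)
  moreover have "cat_functor ?D ?C G"
    unfolding cat_functor_def cat_functor_axioms_def
    using F.dom.full_subcat F.cod.full_subcat
    by (auto simp: full_subcat_def PG G.on_obj_in G.on_hom_in G.on_hom_idt G.on_hom_cmp)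
  moreover have "nat_iso ?C ?C id_func (comp_func G F) \<eta>" "nat_iso ?D ?D (comp_func F G) id_func \<epsilon>"
    using \<eta> \<epsilon> unfolding nat_iso_def nat_trans_def
    by (auto simp: full_subcat_def iso_in_def)
  ultimately show ?thesis
    unfolding equivalent_categories_def by blast
qed

section \<open>Continuous actions\<close>

text \<open>Makes room inside \<open>'u\<close> for the product of two actions.\<close>

lemma inj_pairing:
  assumes "infinite (UNIV :: 'u set)"
  obtains p :: "'u \<times> 'u \<Rightarrow> 'u" where "inj p"
proof -
  have "\<exists>p :: 'u \<times> 'u \<Rightarrow> 'u. inj_on p (UNIV \<times> UNIV) \<and> p ` (UNIV \<times> UNIV) \<subseteq> UNIV"
    unfolding card_of_ordLeq using card_of_Times_same_infinite[OF assms] by (rule ordIso_imp_ordLeq)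
  then show ?thesis
    using that by auto
qed

definition generates :: "'m monoid \<Rightarrow> ('u, 'm) mset \<Rightarrow> 'u \<Rightarrow> bool" where
  "generates M X k \<longleftrightarrow> k \<in> points X \<and> points X = {act X (k, m) |m. m \<in> carrier M}"

lemma generatesD:
  assumes "generates M X k"
  shows "k \<in> points X" "x \<in> points X \<Longrightarrow> \<exists>m\<in>carrier M. x = act X (k, m)"
  using assms unfolding generates_def by blast+

lemma principal_iff: "principal M X \<longleftrightarrow> (\<exists>k. generates M X k)"
  unfolding principal_def generates_def by blast

text \<open>The restriction is there because \<open>right_mset\<close> asks for an extensional
  action.\<close>

definition make_mset :: "'m monoid \<Rightarrow> 'u set \<Rightarrow> ('u \<Rightarrow> 'm \<Rightarrow> 'u) \<Rightarrow> ('u, 'm) mset" where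
  "make_mset M A f = \<lparr>points = A, act = restrict (\<lambda>(x, m). f x m) (A \<times> carrier M)\<rparr>"

lemma make_mset_simps [simp]:
  "points (make_mset M A f) = A"
  "x \<in> A \<Longrightarrow> m \<in> carrier M \<Longrightarrow> act (make_mset M A f) (x, m) = f x m"
  by (simp_all add: make_mset_def)

locale topological_monoid = monoid M for M :: "'m monoid" (structure) +
  fixes \<tau> :: "'m topology"
  assumes topspace: "topspace \<tau> = carrier M"
begin

text \<open>As the points are discrete, the preimage of a set \<open>U\<close> is the union, over
  points \<open>x\<close> and \<open>y\<close> in \<open>U\<close>, of \<open>{x}\<close> times the
  set of \<open>m\<close> carrying \<open>x\<close> to \<open>y\<close>. Continuity thus becomes a
  condition on single pairs of points.\<close>

lemma continuous_mset_iff: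
  "continuous_mset M \<tau> X \<longleftrightarrow> right_mset M X \<and>
    (\<forall>x\<in>points X. \<forall>y\<in>points X. openin \<tau> {m \<in> carrier M. act X (x, m) = y})"
proof -
  let ?T = "prod_topology (discrete_topology (points X)) \<tau>"
  have "continuous_map ?T (discrete_topology (points X)) (act X) \<longleftrightarrow>
    (\<forall>x\<in>points X. \<forall>y\<in>points X. openin \<tau> {m \<in> carrier M. act X (x, m) = y})"
    (is "?L \<longleftrightarrow> ?R") if X: "right_mset M X"
  proof
    assume L: ?L
    show ?R
    proof (intro ballI)
      fix x y assume x: "x \<in> points X" and y: "y \<in> points X"
      have "continuous_map \<tau> ?T (\<lambda>m. (x, m))"
        using x by (intro continuous_map_pairedI) (simp_all add: continuous_map_const)
      then have "continuous_map \<tau> (discrete_topology (points X)) (act X \<circ> (\<lambda>m. (x, m)))"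
        using L by (rule continuous_map_compose)
      then have "openin \<tau> {m \<in> topspace \<tau>. (act X \<circ> (\<lambda>m. (x, m))) m \<in> {y}}"
        using y unfolding continuous_map_def by (metis openin_discrete_topology empty_subsetI insert_subset)
      then show "openin \<tau> {m \<in> carrier M. act X (x, m) = y}"
        by (simp add: topspace)
    qed
  next
    assume R: ?R
    show ?L
      unfolding continuous_map_def
    proof (intro conjI allI impI)
      show "act X \<in> topspace ?T \<rightarrow> topspace (discrete_topology (points X))"
        using X by (auto simp: topspace right_mset_def)
      fix U assume "openin (discrete_topology (points X)) U"
      then have U: "U \<subseteq> points X"
        by (simp add: openin_discrete_topology)
      have "{z \<in> topspace ?T. act X z \<in> U}
          = (\<Union>x\<in>points X. \<Union>y\<in>U. {x} \<times> {m \<in> carrier M. act X (x, m) = y})"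
        by (auto simp: topspace)
      moreover have "openin ?T ({x} \<times> {m \<in> carrier M. act X (x, m) = y})"
        if "x \<in> points X" "y \<in> U" for x y
        using R that U by (auto simp: openin_prod_Times_iff)
      ultimately show "openin ?T {z \<in> topspace ?T. act X z \<in> U}"
        by (auto intro!: openin_Union)
    qed
  qed
  then show ?thesis
    unfolding continuous_mset_def by blast
qed

lemma msetD:
  assumes "continuous_mset M \<tau> X" "x \<in> points X"
  shows "m \<in> carrier M \<Longrightarrow> act X (x, m) \<in> points X"
    and "act X (x, \<one>) = x"
    and "m \<in> carrier M \<Longrightarrow> n \<in> carrier M \<Longrightarrow> act X (act X (x, m), n) = act X (x, m \<otimes> n)"
    and "y \<in> points X \<Longrightarrow> openin \<tau> {m \<in> carrier M. act X (x, m) = y}"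
  using assms unfolding continuous_mset_iff right_mset_def by (auto simp: PiE_mem)

lemma continuous_make_mset:
  assumes "\<And>x m. x \<in> A \<Longrightarrow> m \<in> carrier M \<Longrightarrow> f x m \<in> A"
    and "\<And>x. x \<in> A \<Longrightarrow> f x \<one> = x"
    and "\<And>x m n. x \<in> A \<Longrightarrow> m \<in> carrier M \<Longrightarrow> n \<in> carrier M \<Longrightarrow> f (f x m) n = f x (m \<otimes> n)"
    and "\<And>x y. x \<in> A \<Longrightarrow> y \<in> A \<Longrightarrow> openin \<tau> {m \<in> carrier M. f x m = y}"
  shows "continuous_mset M \<tau> (make_mset M A f)"
  unfolding continuous_mset_iff
proof (intro conjI ballI)
  show "right_mset M (make_mset M A f)"
    unfolding right_mset_def using assms(1-3) by (auto simp: make_mset_def)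
  fix x y assume xy: "x \<in> points (make_mset M A f)" "y \<in> points (make_mset M A f)"
  then have "{m \<in> carrier M. act (make_mset M A f) (x, m) = y} = {m \<in> carrier M. f x m = y}"
    by auto
  then show "openin \<tau> {m \<in> carrier M. act (make_mset M A f) (x, m) = y}"
    using assms(4) xy by simp
qed

lemma continuous_sub_mset:
  assumes X: "continuous_mset M \<tau> X" and A: "A \<subseteq> points X"
    and cl: "\<And>x m. x \<in> A \<Longrightarrow> m \<in> carrier M \<Longrightarrow> act X (x, m) \<in> A"
  shows "continuous_mset M \<tau> (make_mset M A (\<lambda>x m. act X (x, m)))"
  using A by (intro continuous_make_mset cl) (auto simp: subset_iff msetD[OF X])

definition orbit_mset :: "('u, 'm) mset \<Rightarrow> 'u \<Rightarrow> ('u, 'm) mset" where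
  "orbit_mset X x = make_mset M {act X (x, m) |m. m \<in> carrier M} (\<lambda>x m. act X (x, m))"

lemma orbit_mset:
  assumes X: "continuous_mset M \<tau> X" and x: "x \<in> points X"
  shows "continuous_mset M \<tau> (orbit_mset X x)" "points (orbit_mset X x) \<subseteq> points X"
    "y \<in> points (orbit_mset X x) \<Longrightarrow> m \<in> carrier M \<Longrightarrow> act (orbit_mset X x) (y, m) = act X (y, m)"
    "generates M (orbit_mset X x) x"
proof -
  let ?A = "{act X (x, m) |m. m \<in> carrier M}"
  have cl: "act X (y, m) \<in> ?A" if "y \<in> ?A" "m \<in> carrier M" for y m
    using that msetD[OF X x] by auto
  have sub: "?A \<subseteq> points X"
    using msetD[OF X x] by auto
  show "continuous_mset M \<tau> (orbit_mset X x)"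
    unfolding orbit_mset_def by (rule continuous_sub_mset[OF X sub cl])
  show "points (orbit_mset X x) \<subseteq> points X"
    using sub by (simp add: orbit_mset_def)
  show "y \<in> points (orbit_mset X x) \<Longrightarrow> m \<in> carrier M \<Longrightarrow> act (orbit_mset X x) (y, m) = act X (y, m)"
    by (simp add: orbit_mset_def)
  have x': "x \<in> ?A"
    using msetD(2)[OF X x] by force
  then have "{act (orbit_mset X x) (x, m) |m. m \<in> carrier M} = ?A"
    unfolding orbit_mset_def by (metis (no_types, lifting) make_mset_simps(2))
  then show "generates M (orbit_mset X x) x"
    using x' by (simp add: generates_def orbit_mset_def)
qed

lemma equivariant_maps_iff:
  "f \<in> equivariant_maps M X Y \<longleftrightarrow> f \<in> extensional (points X) \<and> f \<in> points X \<rightarrow> points Y \<and>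
    (\<forall>x\<in>points X. \<forall>m\<in>carrier M. f (act X (x, m)) = act Y (f x, m))"
  by (auto simp: equivariant_maps_def PiE_def)

lemma equivariantD:
  assumes "f \<in> equivariant_maps M X Y" "x \<in> points X"
  shows "f x \<in> points Y"
    "m \<in> carrier M \<Longrightarrow> f (act X (x, m)) = act Y (f x, m)"
  using assms by (auto simp: equivariant_maps_iff)

lemma restrict_equivariantI:
  assumes "\<And>x. x \<in> points X \<Longrightarrow> f x \<in> points Y"
    and "\<And>x m. x \<in> points X \<Longrightarrow> m \<in> carrier M \<Longrightarrow> act X (x, m) \<in> points X"
    and "\<And>x m. x \<in> points X \<Longrightarrow> m \<in> carrier M \<Longrightarrow> f (act X (x, m)) = act Y (f x, m)"
  shows "restrict f (points X) \<in> equivariant_maps M X Y"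
  using assms by (simp add: equivariant_maps_iff)

lemma inclusion_equivariant:
  assumes "points A \<subseteq> points X"
    and "\<And>x m. x \<in> points A \<Longrightarrow> m \<in> carrier M \<Longrightarrow> act A (x, m) \<in> points A"
    and "\<And>x m. x \<in> points A \<Longrightarrow> m \<in> carrier M \<Longrightarrow> act A (x, m) = act X (x, m)"
  shows "restrict (\<lambda>x. x) (points A) \<in> equivariant_maps M A X"
  using assms by (intro restrict_equivariantI) auto

lemma equivariant_eqI:
  assumes "f \<in> equivariant_maps M X Y" "g \<in> equivariant_maps M X Y"
    and "\<And>x. x \<in> points X \<Longrightarrow> f x = g x"
  shows "f = g"
  using assms by (auto simp: equivariant_maps_iff intro: extensionalityI)

lemma equivariant_eq_of_generator:
  assumes k: "generates M X k"
    and f: "f \<in> equivariant_maps M X Y" and g: "g \<in> equivariant_maps M X Y"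
    and eq: "f k = g k"
  shows "f = g"
proof (rule equivariant_eqI[OF f g])
  fix x assume "x \<in> points X"
  then obtain m where "m \<in> carrier M" "x = act X (k, m)"
    using k unfolding generates_def by blast
  moreover have "k \<in> points X"
    using k unfolding generates_def by blast
  ultimately show "f x = g x"
    using eq f g by (simp add: equivariantD)
qed

lemma equivariant_compose:
  assumes "f \<in> equivariant_maps M X Y" "g \<in> equivariant_maps M Y Z"
    and "\<And>x m. x \<in> points X \<Longrightarrow> m \<in> carrier M \<Longrightarrow> act X (x, m) \<in> points X"
  shows "compose (points X) g f \<in> equivariant_maps M X Z"
  using assms by (auto simp: equivariant_maps_iff compose_eq Pi_iff)

text \<open>A principal action is the quotient of \<open>M\<close> by the kernel of its generator,
  so \<open>k\<close> may be sent to any \<open>y\<close> whose kernel contains that of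
  \<open>k\<close>.\<close>

lemma equivariant_extend:
  assumes X: "continuous_mset M \<tau> X" and Y: "continuous_mset M \<tau> Y"
    and k: "generates M X k" and y: "y \<in> points Y"
    and ker: "\<And>m n. m \<in> carrier M \<Longrightarrow> n \<in> carrier M \<Longrightarrow> act X (k, m) = act X (k, n) \<Longrightarrow>
      act Y (y, m) = act Y (y, n)"
  obtains f where "f \<in> equivariant_maps M X Y" "f k = y"
proof
  have kX: "k \<in> points X" and gen: "\<And>x. x \<in> points X \<Longrightarrow> \<exists>m\<in>carrier M. x = act X (k, m)"
    using k unfolding generates_def by blast+
  \<comment> \<open>Some way of writing \<open>x\<close> as a translate of the generator;
    \<open>ker\<close> makes the result independent of the choice.\<close>
  define e where "e x = (SOME m. m \<in> carrier M \<and> x = act X (k, m))" for x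
  have e: "e x \<in> carrier M" "act X (k, e x) = x" if "x \<in> points X" for x
    using someI_ex[of "\<lambda>m. m \<in> carrier M \<and> x = act X (k, m)"] gen[OF that]
    unfolding e_def by (metis (lifting))+
  define f where "f = restrict (\<lambda>x. act Y (y, e x)) (points X)"
  have f: "f (act X (k, m)) = act Y (y, m)" if "m \<in> carrier M" for m
  proof -
    have "act X (k, m) \<in> points X"
      using msetD(1)[OF X kX that] .
    then show ?thesis
      unfolding f_def using ker[of "e (act X (k, m))" m] e that by simp
  qed
  show "f \<in> equivariant_maps M X Y"
    unfolding equivariant_maps_iff
  proof (intro conjI ballI)
    fix x m assume x: "x \<in> points X" and m: "m \<in> carrier M"
    then obtain n where n: "n \<in> carrier M" "x = act X (k, n)"
      using gen by blast
    then show "f (act X (x, m)) = act Y (f x, m)"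
      using m f[of n] f[of "n \<otimes> m"] by (simp add: msetD[OF X kX] msetD[OF Y y])
  qed (auto simp: f_def e msetD[OF Y y])
  show "f k = y"
    using f[of \<one>] msetD(2)[OF X kX] msetD(2)[OF Y y] by simp
qed

text \<open>The product action, moved into \<open>'u\<close> along the pairing \<open>p\<close>;
  \<open>inv_into UNIV p\<close> decodes a pair.\<close>

definition prod_mset where
  "prod_mset p X Y = make_mset M (p ` (points X \<times> points Y))
    (\<lambda>z m. p (act X (fst (inv_into UNIV p z), m), act Y (snd (inv_into UNIV p z), m)))"

lemma prod_mset:
  assumes p: "inj p" and X: "continuous_mset M \<tau> X" and Y: "continuous_mset M \<tau> Y"
  shows "continuous_mset M \<tau> (prod_mset p X Y)"
    "points (prod_mset p X Y) = p ` (points X \<times> points Y)"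
    "x \<in> points X \<Longrightarrow> y \<in> points Y \<Longrightarrow> m \<in> carrier M \<Longrightarrow>
      act (prod_mset p X Y) (p (x, y), m) = p (act X (x, m), act Y (y, m))"
    "restrict (\<lambda>z. fst (inv_into UNIV p z)) (points (prod_mset p X Y)) \<in> equivariant_maps M (prod_mset p X Y) X"
    "restrict (\<lambda>z. snd (inv_into UNIV p z)) (points (prod_mset p X Y)) \<in> equivariant_maps M (prod_mset p X Y) Y"
proof -
  have ip [simp]: "inv_into UNIV p (p z) = z" for z
    using p by simp
  show "continuous_mset M \<tau> (prod_mset p X Y)"
    unfolding prod_mset_def
  proof (rule continuous_make_mset)
    fix z w assume "z \<in> p ` (points X \<times> points Y)" "w \<in> p ` (points X \<times> points Y)"
    then obtain x y x' y' where z: "z = p (x, y)" "x \<in> points X" "y \<in> points Y"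
      and w: "w = p (x', y')" "x' \<in> points X" "y' \<in> points Y"
      by auto
    have "{m \<in> carrier M. p (act X (fst (inv_into UNIV p z), m), act Y (snd (inv_into UNIV p z), m)) = w}
        = {m \<in> carrier M. act X (x, m) = x'} \<inter> {m \<in> carrier M. act Y (y, m) = y'}"
      using p z w by (auto simp: inj_eq)
    then show "openin \<tau> {m \<in> carrier M. p (act X (fst (inv_into UNIV p z), m), act Y (snd (inv_into UNIV p z), m)) = w}"
      using msetD(4)[OF X z(2) w(2)] msetD(4)[OF Y z(3) w(3)] by auto
  qed (auto simp: msetD[OF X] msetD[OF Y])
  show pt: "points (prod_mset p X Y) = p ` (points X \<times> points Y)"
    by (simp add: prod_mset_def)
  show "act (prod_mset p X Y) (p (x, y), m) = p (act X (x, m), act Y (y, m))"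
    if "x \<in> points X" "y \<in> points Y" "m \<in> carrier M" for x y m
    using that by (simp add: prod_mset_def)
  then show "restrict (\<lambda>z. fst (inv_into UNIV p z)) (points (prod_mset p X Y)) \<in> equivariant_maps M (prod_mset p X Y) X"
    "restrict (\<lambda>z. snd (inv_into UNIV p z)) (points (prod_mset p X Y)) \<in> equivariant_maps M (prod_mset p X Y) Y"
    unfolding equivariant_maps_iff pt by (auto simp: msetD[OF X] msetD[OF Y])
qed

section \<open>Isomorphisms, monomorphisms and principal objects of \<open>Cont\<close>\<close>

lemma Cont_simps [simp]:
  "Obj (Cont M \<tau>) = {X. continuous_mset M \<tau> X}" "Hom (Cont M \<tau>) = equivariant_maps M"
  "Idt (Cont M \<tau>) X = restrict (\<lambda>x. x) (points X)"
  "Cmp (Cont M \<tau>) X Y Z g f = compose (points X) g f"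
  by (simp_all add: Cont_def)

lemma category_Cont: "category (Cont M \<tau>)"
proof unfold_locales
  fix X assume X: "X \<in> Obj (Cont M \<tau>)"
  then show "Idt (Cont M \<tau>) X \<in> Hom (Cont M \<tau>) X X"
    by (auto simp: equivariant_maps_iff msetD)
next
  fix X Y Z f g assume "X \<in> Obj (Cont M \<tau>)" "f \<in> Hom (Cont M \<tau>) X Y" "g \<in> Hom (Cont M \<tau>) Y Z"
  then show "Cmp (Cont M \<tau>) X Y Z g f \<in> Hom (Cont M \<tau>) X Z"
    by (simp add: equivariant_compose msetD)
qed (auto simp: compose_def equivariant_maps_iff msetD fun_eq_iff restrict_def extensional_def)

lemma iso_in_Cont:
  assumes X: "continuous_mset M \<tau> X" and Y: "continuous_mset M \<tau> Y"
  shows "iso_in (Cont M \<tau>) X Y f \<longleftrightarrow> f \<in> equivariant_maps M X Y \<and> bij_betw f (points X) (points Y)"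
proof
  assume "iso_in (Cont M \<tau>) X Y f"
  then obtain g where f: "f \<in> equivariant_maps M X Y" and g: "g \<in> equivariant_maps M Y X"
    and gf: "compose (points X) g f = restrict (\<lambda>x. x) (points X)"
    and fg: "compose (points Y) f g = restrict (\<lambda>x. x) (points Y)"
    unfolding iso_in_def by auto
  have "g (f x) = x" if "x \<in> points X" for x
    using fun_cong[OF gf, of x] that by (simp add: compose_eq)
  moreover have "f (g y) = y" if "y \<in> points Y" for y
    using fun_cong[OF fg, of y] that by (simp add: compose_eq)
  ultimately have "bij_betw f (points X) (points Y)"
    using f g by (intro bij_betwI[of f _ _ g]) (auto simp: equivariant_maps_iff)
  then show "f \<in> equivariant_maps M X Y \<and> bij_betw f (points X) (points Y)"
    using f by simp
next
  assume "f \<in> equivariant_maps M X Y \<and> bij_betw f (points X) (points Y)"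
  then have f: "f \<in> equivariant_maps M X Y" and bij: "bij_betw f (points X) (points Y)"
    by auto
  define g where "g = restrict (inv_into (points X) f) (points Y)"
  have gf: "g (f x) = x" if "x \<in> points X" for x
    using that bij f by (simp add: g_def equivariantD bij_betw_inv_into_left)
  have fg: "f (g y) = y" "g y \<in> points X" if "y \<in> points Y" for y
    using that bij by (simp_all add: g_def bij_betw_inv_into_right bij_betwE[OF bij_betw_inv_into[OF bij]])
  have "g \<in> equivariant_maps M Y X"
    unfolding equivariant_maps_iff
  proof (intro conjI ballI)
    fix y m assume y: "y \<in> points Y" and m: "m \<in> carrier M"
    have "act Y (y, m) = f (act X (g y, m))"
      using y m f by (simp add: equivariantD fg)
    then show "g (act Y (y, m)) = act X (g y, m)"
      using gf y m by (simp add: fg msetD[OF X])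
  next
    show "g \<in> extensional (points Y)"
      by (simp add: g_def)
  qed (use fg(2) in auto)
  moreover have "compose (points X) g f = restrict (\<lambda>x. x) (points X)"
    "compose (points Y) f g = restrict (\<lambda>x. x) (points Y)"
    by (auto simp: compose_def fun_eq_iff gf fg)
  ultimately show "iso_in (Cont M \<tau>) X Y f"
    unfolding iso_in_def using f by auto
qed

text \<open>The free action of \<open>M\<close> on itself need not be continuous and cannot serve as
  test object. The orbit of \<open>(a, b)\<close> in the product of \<open>X\<close> with itself
  does: its two projections agree after \<open>f\<close> at the generator, hence everywhere, hence
  already before \<open>f\<close>.\<close>

lemma mono_in_Cont_inj:
  assumes inf: "infinite (UNIV :: 'u set)"
    and X: "continuous_mset M \<tau> (X :: ('u, 'm) mset)"
    and f: "mono_in (Cont M \<tau>) X Y f"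
  shows "inj_on f (points X)"
proof (rule inj_onI)
  obtain p :: "'u \<times> 'u \<Rightarrow> 'u" where p: "inj p"
    using inj_pairing[OF inf] by blast
  fix a b assume a: "a \<in> points X" and b: "b \<in> points X" and eq: "f a = f b"
  have fh: "f \<in> equivariant_maps M X Y"
    using f by (simp add: mono_in_def)
  let ?P = "prod_mset p X X"
  let ?Z = "orbit_mset ?P (p (a, b))"
  have P: "continuous_mset M \<tau> ?P" and ab: "p (a, b) \<in> points ?P"
    using prod_mset[OF p X X] a b by auto
  note Z = orbit_mset[OF P ab]
  have cl: "\<And>x m. x \<in> points ?Z \<Longrightarrow> m \<in> carrier M \<Longrightarrow> act ?Z (x, m) \<in> points ?Z"
    using msetD(1)[OF Z(1)] .
  have ext: "restrict h (points ?Z) \<in> equivariant_maps M ?Z X"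
    if h: "restrict h (points ?P) \<in> equivariant_maps M ?P X" for h
  proof (rule restrict_equivariantI)
    fix z assume z: "z \<in> points ?Z"
    then show "h z \<in> points X"
      using equivariantD(1)[OF h] Z(2) by auto
    fix m assume m: "m \<in> carrier M"
    then show "act ?Z (z, m) \<in> points ?Z"
      using cl z by blast
    then show "h (act ?Z (z, m)) = act X (h z, m)"
      using equivariantD(2)[OF h, of z m] subsetD[OF Z(2)] Z(3) z m by (simp add: subset_iff)
  qed
  let ?g = "restrict (\<lambda>z. fst (inv_into UNIV p z)) (points ?Z)" and ?h = "restrict (\<lambda>z. snd (inv_into UNIV p z)) (points ?Z)"
  have g: "?g \<in> equivariant_maps M ?Z X" and h: "?h \<in> equivariant_maps M ?Z X"
    using ext prod_mset(4,5)[OF p X X] by blast+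
  have mem: "p (a, b) \<in> points ?Z"
    using generatesD(1)[OF Z(4)] .
  have "compose (points ?Z) f ?g = compose (points ?Z) f ?h"
    by (rule equivariant_eq_of_generator[OF Z(4) equivariant_compose[OF g fh cl] equivariant_compose[OF h fh cl]])
      (use mem eq p in \<open>simp_all add: compose_eq\<close>)
  then have "?g = ?h"
    using f g h Z(1) unfolding mono_in_def by simp
  then have "?g (p (a, b)) = ?h (p (a, b))"
    by simp
  then show "a = b"
    using mem p by simp
qed

lemma inj_mono_in_Cont:
  assumes f: "f \<in> equivariant_maps M X Y" and inj: "inj_on f (points X)"
  shows "mono_in (Cont M \<tau>) X Y f"
  unfolding mono_in_def
proof (intro conjI ballI impI)
  fix Z g h assume g: "g \<in> Hom (Cont M \<tau>) Z X" and h: "h \<in> Hom (Cont M \<tau>) Z X"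
    and eq: "Cmp (Cont M \<tau>) Z X Y f g = Cmp (Cont M \<tau>) Z X Y f h"
  have "g z = h z" if z: "z \<in> points Z" for z
  proof -
    have "f (g z) = f (h z)"
      using fun_cong[OF eq, of z] z by (simp add: compose_eq)
    then show ?thesis
      using inj g h z by (simp add: inj_on_eq_iff equivariantD)
  qed
  then show "g = h"
    using g h by (auto intro: equivariant_eqI)
qed (simp add: f)

text \<open>Monos are injections here, so subobjects are invariant subsets up to isomorphism. A
  subset meeting the generators is everything; conversely a point outside the largest proper subset
  has an orbit that cannot be proper.\<close>

lemma principal_iff_largest_proper_subobject:
  assumes inf: "infinite (UNIV :: 'u set)"
    and X: "continuous_mset M \<tau> (X :: ('u, 'm) mset)"
  shows "principal M X \<longleftrightarrow> has_largest_proper_subobject (Cont M \<tau>) X"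
proof
  assume "principal M X"
  then obtain k where k: "generates M X k"
    unfolding principal_iff by blast
  let ?A = "{x \<in> points X. \<not> generates M X x}"
  let ?N = "make_mset M ?A (\<lambda>x m. act X (x, m))" and ?n = "restrict (\<lambda>x. x) ?A"
  \<comment> \<open>If a translate of \<open>x\<close> generates, then so does \<open>x\<close>;
    hence the non-generators are closed under the action.\<close>
  have cl: "act X (x, m) \<in> ?A" if x: "x \<in> ?A" and m: "m \<in> carrier M" for x m
  proof (rule ccontr)
    assume "act X (x, m) \<notin> ?A"
    then have "generates M X (act X (x, m))"
      using x m msetD(1)[OF X] by auto
    have "y \<in> {act X (x, n) |n. n \<in> carrier M}" if y: "y \<in> points X" for y
    proof -
      obtain n where "n \<in> carrier M" "y = act X (act X (x, m), n)"
        using y \<open>generates M X (act X (x, m))\<close> unfolding generates_def by blast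
      then have "y = act X (x, m \<otimes> n)" "m \<otimes> n \<in> carrier M"
        using x m msetD(3)[OF X] by simp_all
      then show ?thesis by blast
    qed
    moreover have "act X (x, n) \<in> points X" if "n \<in> carrier M" for n
      using msetD(1)[OF X] x that by simp
    ultimately have "generates M X x"
      using x unfolding generates_def by blast
    then show False
      using x by simp
  qed
  have N: "continuous_mset M \<tau> ?N"
    by (rule continuous_sub_mset[OF X _ cl]) auto
  have n: "?n \<in> equivariant_maps M ?N X"
    using inclusion_equivariant[of ?N X] cl by simp
  show "has_largest_proper_subobject (Cont M \<tau>) X"
    unfolding has_largest_proper_subobject_def
  proof (intro bexI[of _ ?N] exI[of _ ?n] conjI ballI allI impI)
    show "mono_in (Cont M \<tau>) ?N X ?n"
      by (rule inj_mono_in_Cont[OF n]) (simp add: inj_on_def)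
    show "\<not> iso_in (Cont M \<tau>) ?N X ?n"
      unfolding iso_in_Cont[OF N X] bij_betw_def using k by (auto simp: generates_def)
    show "?N \<in> Obj (Cont M \<tau>)"
      using N by simp
    fix B f assume B: "B \<in> Obj (Cont M \<tau>)"
      and "mono_in (Cont M \<tau>) B X f \<and> \<not> iso_in (Cont M \<tau>) B X f"
    then have f: "f \<in> equivariant_maps M B X" "inj_on f (points B)" "\<not> bij_betw f (points B) (points X)"
      using mono_in_Cont_inj[OF inf, of B X f] iso_in_Cont[of B X f] X by (auto simp: mono_in_def)
    \<comment> \<open>A generator in the image would make the injective \<open>f\<close> surjective,
      hence an isomorphism.\<close>
    have not_gen: "\<not> generates M X (f b)" if b: "b \<in> points B" for b
    proof
      assume g: "generates M X (f b)"
      have "points X \<subseteq> f ` points B"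
      proof
        fix y assume "y \<in> points X"
        then obtain m where "m \<in> carrier M" "y = act X (f b, m)"
          using g unfolding generates_def by blast
        then have "y = f (act B (b, m))" "act B (b, m) \<in> points B"
          using f(1) b B by (simp_all add: equivariantD msetD)
        then show "y \<in> f ` points B" by blast
      qed
      then show False
        using f b by (auto simp: bij_betw_def equivariantD)
    qed
    have "f \<in> equivariant_maps M B ?N"
      using f(1) not_gen B unfolding equivariant_maps_iff by (auto simp: Pi_iff)
    moreover have "compose (points B) ?n f = f"
      using calculation f(1) by (intro extensionalityI[of _ "points B"])
        (auto simp: compose_eq equivariant_maps_iff compose_extensional)
    ultimately show "\<exists>h\<in>Hom (Cont M \<tau>) B ?N. Cmp (Cont M \<tau>) B ?N X ?n h = f"
      by auto
  qed
next
  assume "has_largest_proper_subobject (Cont M \<tau>) X"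
  then obtain N n where N: "continuous_mset M \<tau> N"
    and n: "mono_in (Cont M \<tau>) N X n" "\<not> iso_in (Cont M \<tau>) N X n"
    and max: "\<And>A m. continuous_mset M \<tau> A \<Longrightarrow> mono_in (Cont M \<tau>) A X m \<Longrightarrow>
      \<not> iso_in (Cont M \<tau>) A X m \<Longrightarrow> \<exists>k\<in>equivariant_maps M A N. compose (points A) n k = m"
    unfolding has_largest_proper_subobject_def by auto
  have nh: "n \<in> equivariant_maps M N X"
    using n by (simp add: mono_in_def)
  have "n ` points N \<noteq> points X"
    using n nh mono_in_Cont_inj[OF inf N n(1)] iso_in_Cont[OF N X] by (auto simp: bij_betw_def)
  then obtain x where x: "x \<in> points X" "x \<notin> n ` points N"
    using nh by (auto simp: equivariantD)
  let ?O = "orbit_mset X x"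
  note O = orbit_mset[OF X x(1)]
  let ?i = "restrict (\<lambda>x. x) (points ?O)"
  have i: "?i \<in> equivariant_maps M ?O X"
    using inclusion_equivariant[OF O(2) msetD(1)[OF O(1)] O(3)] by blast
  have xO: "x \<in> points ?O"
    using generatesD(1)[OF O(4)] .
  \<comment> \<open>Otherwise the inclusion of the orbit would factor through \<open>n\<close>, and
    \<open>x\<close> would lie in the image of \<open>n\<close>.\<close>
  have "iso_in (Cont M \<tau>) ?O X ?i"
  proof (rule ccontr)
    assume "\<not> iso_in (Cont M \<tau>) ?O X ?i"
    moreover have "mono_in (Cont M \<tau>) ?O X ?i"
      by (rule inj_mono_in_Cont[OF i]) (simp add: inj_on_def)
    ultimately obtain k where k: "k \<in> equivariant_maps M ?O N" "compose (points ?O) n k = ?i"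
      using max[OF O(1)] by blast
    have "n (k x) = x"
      using fun_cong[OF k(2), of x] xO by (simp add: compose_eq)
    then show False
      using x(2) equivariantD(1)[OF k(1) xO] by force
  qed
  then have "points ?O = points X"
    unfolding iso_in_Cont[OF O(1) X] bij_betw_def by simp
  then have "generates M X x"
    using x(1) unfolding generates_def orbit_mset_def by simp
  then show "principal M X"
    unfolding principal_iff by blast
qed

end

lemma topological_monoid_iff: "topological_monoid M \<tau> \<longleftrightarrow> monoid_with_topology M \<tau>"
  by (simp add: topological_monoid_def topological_monoid_axioms_def monoid_with_topology_def)

section \<open>Categories of sheaves\<close>

lemma op_cat_simps [simp]:
  "Obj (op_cat C) = Obj C" "Hom (op_cat C) X Y = Hom C Y X" "Idt (op_cat C) = Idt C"
  "Cmp (op_cat C) X Y Z g f = Cmp C Z Y X f g"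
  by (simp_all add: op_cat_def)

lemma set_cat_simps [simp]:
  "Obj set_cat = UNIV" "Hom set_cat X Y = (X \<rightarrow>\<^sub>E Y)" "Idt set_cat X = restrict (\<lambda>x. x) X"
  "Cmp set_cat X Y Z g f = compose X g f"
  by (simp_all add: set_cat_def)

lemma category_set_cat: "category set_cat"
  by unfold_locales
    (auto simp: compose_def fun_eq_iff restrict_def PiE_iff extensional_def)

lemma (in category) category_op_cat: "category (op_cat C)"
  by unfold_locales (simp_all add: cat_simps)

lemma category_functor_cat:
  assumes "category C" "category D"
  shows "category (functor_cat C D)"
proof -
  interpret C: category C by fact
  interpret D: category D by fact
  have ob: "on_obj F X \<in> Obj D" if "F \<in> Obj (functor_cat C D)" "X \<in> Obj C" for F X
    using that cat_functor.on_obj_in[of C D F X] by (simp add: functor_cat_def)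
  have hom: "on_hom F X Y f \<in> Hom D (on_obj F X) (on_obj F Y)"
    if "F \<in> Obj (functor_cat C D)" "X \<in> Obj C" "Y \<in> Obj C" "f \<in> Hom C X Y" for F X Y f
    using that cat_functor.on_hom_in[of C D F X Y f] by (simp add: functor_cat_def)
  have \<alpha>: "\<alpha> \<in> extensional (Obj C)"
    "\<And>X. X \<in> Obj C \<Longrightarrow> \<alpha> X \<in> Hom D (on_obj F X) (on_obj G X)"
    "\<And>X Y f. X \<in> Obj C \<Longrightarrow> Y \<in> Obj C \<Longrightarrow> f \<in> Hom C X Y \<Longrightarrow>
      Cmp D (on_obj F X) (on_obj F Y) (on_obj G Y) (\<alpha> Y) (on_hom F X Y f) =
      Cmp D (on_obj F X) (on_obj G X) (on_obj G Y) (on_hom G X Y f) (\<alpha> X)"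
    if "\<alpha> \<in> Hom (functor_cat C D) F G" for \<alpha> F G
    using that by (auto simp: functor_cat_def nat_trans_def)
  have cmp: "Cmp (functor_cat C D) F G H \<beta> \<alpha> =
      (\<lambda>X\<in>Obj C. Cmp D (on_obj F X) (on_obj G X) (on_obj H X) (\<beta> X) (\<alpha> X))" for F G H \<alpha> \<beta>
    by (simp add: functor_cat_def)
  have idt: "Idt (functor_cat C D) F = (\<lambda>X\<in>Obj C. Idt D (on_obj F X))" for F
    by (simp add: functor_cat_def)
  show ?thesis
  proof unfold_locales
    fix F assume F: "F \<in> Obj (functor_cat C D)"
    show "Idt (functor_cat C D) F \<in> Hom (functor_cat C D) F F"
      using ob[OF F] hom[OF F] by (simp add: functor_cat_def nat_trans_def D.cat_simps)
  next
    fix F G H \<alpha> \<beta>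
    assume F: "F \<in> Obj (functor_cat C D)" and G: "G \<in> Obj (functor_cat C D)"
      and H: "H \<in> Obj (functor_cat C D)"
      and a: "\<alpha> \<in> Hom (functor_cat C D) F G" and b: "\<beta> \<in> Hom (functor_cat C D) G H"
    let ?c = "Cmp D"
    have "?c (on_obj F X) (on_obj F Y) (on_obj H Y)
         (?c (on_obj F Y) (on_obj G Y) (on_obj H Y) (\<beta> Y) (\<alpha> Y)) (on_hom F X Y f) =
       ?c (on_obj F X) (on_obj H X) (on_obj H Y) (on_hom H X Y f)
         (?c (on_obj F X) (on_obj G X) (on_obj H X) (\<beta> X) (\<alpha> X))" (is "?L = ?R")
      if X: "X \<in> Obj C" and Y: "Y \<in> Obj C" and f: "f \<in> Hom C X Y" for X Y f
    proof -
      note ty = ob[OF F X] ob[OF F Y] ob[OF G X] ob[OF G Y] ob[OF H X] ob[OF H Y]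
        hom[OF F X Y f] hom[OF G X Y f] hom[OF H X Y f] \<alpha>(2)[OF a X] \<alpha>(2)[OF a Y]
        \<alpha>(2)[OF b X] \<alpha>(2)[OF b Y]
      have "?L = ?c (on_obj F X) (on_obj G Y) (on_obj H Y) (\<beta> Y)
          (?c (on_obj F X) (on_obj F Y) (on_obj G Y) (\<alpha> Y) (on_hom F X Y f))"
        using ty by (simp add: D.cmp_assoc)
      also have "\<dots> = ?c (on_obj F X) (on_obj G X) (on_obj H Y)
          (?c (on_obj G X) (on_obj G Y) (on_obj H Y) (\<beta> Y) (on_hom G X Y f)) (\<alpha> X)"
        unfolding \<alpha>(3)[OF a X Y f] using ty by (simp add: D.cmp_assoc)
      also have "\<dots> = ?R"
        unfolding \<alpha>(3)[OF b X Y f] using ty by (simp add: D.cmp_assoc)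
      finally show ?thesis .
    qed
    then show "Cmp (functor_cat C D) F G H \<beta> \<alpha> \<in> Hom (functor_cat C D) F H"
      using \<alpha>[OF a] \<alpha>[OF b] ob[OF F] ob[OF G] ob[OF H]
      by (simp add: functor_cat_def nat_trans_def D.cmp_in_hom)
  next
    fix F G \<alpha>
    assume F: "F \<in> Obj (functor_cat C D)" and G: "G \<in> Obj (functor_cat C D)"
      and a: "\<alpha> \<in> Hom (functor_cat C D) F G"
    show "Cmp (functor_cat C D) F G G (Idt (functor_cat C D) G) \<alpha> = \<alpha>"
      "Cmp (functor_cat C D) F F G \<alpha> (Idt (functor_cat C D) F) = \<alpha>"
      unfolding cmp idt
      by (intro extensionalityI[OF restrict_extensional \<alpha>(1)[OF a]],
          simp add: \<alpha>(2)[OF a] ob[OF F] ob[OF G] D.cat_simps)+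
  next
    fix E F G H \<alpha> \<beta> \<gamma>
    assume E: "E \<in> Obj (functor_cat C D)" and F: "F \<in> Obj (functor_cat C D)"
      and G: "G \<in> Obj (functor_cat C D)" and H: "H \<in> Obj (functor_cat C D)"
      and a: "\<alpha> \<in> Hom (functor_cat C D) E F" and b: "\<beta> \<in> Hom (functor_cat C D) F G"
      and c: "\<gamma> \<in> Hom (functor_cat C D) G H"
    show "Cmp (functor_cat C D) E G H \<gamma> (Cmp (functor_cat C D) E F G \<beta> \<alpha>) =
      Cmp (functor_cat C D) E F H (Cmp (functor_cat C D) F G H \<gamma> \<beta>) \<alpha>"
      unfolding cmp
      by (intro restrict_ext)
        (simp add: \<alpha>(2)[OF a] \<alpha>(2)[OF b] \<alpha>(2)[OF c] ob[OF E] ob[OF F] ob[OF G] ob[OF H] D.cmp_assoc)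
  qed
qed

lemma Sh_Obj:
  "F \<in> Obj (Sh C J) \<longleftrightarrow>
    cat_functor (op_cat C) set_cat F \<and> extensional_func (op_cat C) F \<and> is_sheaf C J F"
  by (auto simp: Sh_def full_subcat_def presheaf_cat_def functor_cat_def)

lemma Sh_simps:
  "Hom (Sh C J) F G = {\<alpha> \<in> extensional (Obj C). nat_trans (op_cat C) set_cat F G \<alpha>}"
  "Idt (Sh C J) F = (\<lambda>X\<in>Obj C. restrict (\<lambda>x. x) (on_obj F X))"
  "Cmp (Sh C J) F G H \<beta> \<alpha> = (\<lambda>X\<in>Obj C. compose (on_obj F X) (\<beta> X) (\<alpha> X))"
  by (simp_all add: Sh_def full_subcat_def presheaf_cat_def functor_cat_def)

context category
begin

lemma category_Sh: "category (Sh C J)"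
  unfolding Sh_def presheaf_cat_def
  by (intro category.full_subcat category_functor_cat category_op_cat category_set_cat)

lemma presheafI:
  assumes "\<And>c d f x. c \<in> Obj C \<Longrightarrow> d \<in> Obj C \<Longrightarrow> f \<in> Hom C d c \<Longrightarrow>
      on_hom F c d f \<in> on_obj F c \<rightarrow>\<^sub>E on_obj F d"
    and "\<And>c x. c \<in> Obj C \<Longrightarrow> x \<in> on_obj F c \<Longrightarrow> on_hom F c c (Idt C c) x = x"
    and "\<And>c d e f g x. c \<in> Obj C \<Longrightarrow> d \<in> Obj C \<Longrightarrow> e \<in> Obj C \<Longrightarrow> f \<in> Hom C d c \<Longrightarrow> g \<in> Hom C e d \<Longrightarrow>
      x \<in> on_obj F c \<Longrightarrow> on_hom F c e (Cmp C e d c f g) x = on_hom F d e g (on_hom F c d f x)"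
  shows "cat_functor (op_cat C) set_cat F"
proof -
  have "on_hom F c c (Idt C c) = restrict (\<lambda>x. x) (on_obj F c)" if "c \<in> Obj C" for c
    using assms(1)[OF that that idt_in_hom[OF that]] assms(2)[OF that]
    by (intro extensionalityI[of _ "on_obj F c"]) (auto simp: PiE_iff)
  moreover have "on_hom F c e (Cmp C e d c f g) = compose (on_obj F c) (on_hom F d e g) (on_hom F c d f)"
    if "c \<in> Obj C" "d \<in> Obj C" "e \<in> Obj C" "f \<in> Hom C d c" "g \<in> Hom C e d" for c d e f g
    using assms(1)[OF that(1,3), of "Cmp C e d c f g"] assms(3)[OF that] that
    by (intro extensionalityI[of _ "on_obj F c"]) (auto simp: PiE_iff cmp_in_hom compose_eq)
  ultimately show ?thesis
    using assms(1) category_op_cat category_set_cat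
    by (simp add: cat_functor_def cat_functor_axioms_def)
qed

lemma presheafD:
  assumes F: "cat_functor (op_cat C) set_cat F" and c: "c \<in> Obj C" "d \<in> Obj C" "f \<in> Hom C d c"
  shows "on_hom F c d f \<in> on_obj F c \<rightarrow>\<^sub>E on_obj F d"
    "x \<in> on_obj F c \<Longrightarrow> on_hom F c d f x \<in> on_obj F d"
    "x \<in> on_obj F c \<Longrightarrow> on_hom F c c (Idt C c) x = x"
    "e \<in> Obj C \<Longrightarrow> g \<in> Hom C e d \<Longrightarrow> x \<in> on_obj F c \<Longrightarrow>
      on_hom F c e (Cmp C e d c f g) x = on_hom F d e g (on_hom F c d f x)"
proof -
  interpret F: cat_functor "op_cat C" set_cat F by fact
  show ty: "on_hom F c d f \<in> on_obj F c \<rightarrow>\<^sub>E on_obj F d"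
    using F.on_hom_in[of c d f] c by simp
  then show "x \<in> on_obj F c \<Longrightarrow> on_hom F c d f x \<in> on_obj F d"
    by (rule PiE_mem)
  show "x \<in> on_obj F c \<Longrightarrow> on_hom F c c (Idt C c) x = x"
    using F.on_hom_idt[of c] c by simp
  show "e \<in> Obj C \<Longrightarrow> g \<in> Hom C e d \<Longrightarrow> x \<in> on_obj F c \<Longrightarrow>
      on_hom F c e (Cmp C e d c f g) x = on_hom F d e g (on_hom F c d f x)"
    using F.on_hom_cmp[of c d e f g] c by (simp add: compose_eq)
qed

lemma nat_trans_presheaf_iff:
  assumes F: "cat_functor (op_cat C) set_cat F" and G: "cat_functor (op_cat C) set_cat G"
  shows "nat_trans (op_cat C) set_cat F G \<alpha> \<longleftrightarrow>
    (\<forall>c\<in>Obj C. \<alpha> c \<in> on_obj F c \<rightarrow>\<^sub>E on_obj G c) \<and>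
    (\<forall>c\<in>Obj C. \<forall>d\<in>Obj C. \<forall>f\<in>Hom C d c. \<forall>x\<in>on_obj F c.
      \<alpha> d (on_hom F c d f x) = on_hom G c d f (\<alpha> c x))"
  unfolding nat_trans_def op_cat_simps set_cat_simps
  by (auto simp: compose_def fun_eq_iff restrict_def split: if_splits)

lemma iso_in_Sh:
  assumes F: "F \<in> Obj (Sh C J)" and G: "G \<in> Obj (Sh C J)"
    and \<alpha>: "\<alpha> \<in> Hom (Sh C J) F G"
    and bij: "\<And>c. c \<in> Obj C \<Longrightarrow> bij_betw (\<alpha> c) (on_obj F c) (on_obj G c)"
  shows "iso_in (Sh C J) F G \<alpha>"
proof -
  have F': "cat_functor (op_cat C) set_cat F" and G': "cat_functor (op_cat C) set_cat G"
    using F G by (simp_all add: Sh_Obj)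
  have \<alpha>E: "\<And>c. c \<in> Obj C \<Longrightarrow> \<alpha> c \<in> on_obj F c \<rightarrow>\<^sub>E on_obj G c"
    and \<alpha>n: "\<And>c d f x. c \<in> Obj C \<Longrightarrow> d \<in> Obj C \<Longrightarrow> f \<in> Hom C d c \<Longrightarrow> x \<in> on_obj F c \<Longrightarrow>
      \<alpha> d (on_hom F c d f x) = on_hom G c d f (\<alpha> c x)"
    using \<alpha> nat_trans_presheaf_iff[OF F' G'] by (simp_all add: Sh_simps)
  define \<beta> where "\<beta> = (\<lambda>c\<in>Obj C. restrict (inv_into (on_obj F c) (\<alpha> c)) (on_obj G c))"
  have \<alpha>\<beta>: "\<alpha> c (\<beta> c y) = y" "\<beta> c y \<in> on_obj F c" if "c \<in> Obj C" "y \<in> on_obj G c" for c y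
    using that bij[OF that(1)]
    by (simp_all add: \<beta>_def bij_betw_inv_into_right bij_betwE[OF bij_betw_inv_into])
  have \<beta>\<alpha>: "\<beta> c (\<alpha> c x) = x" if "c \<in> Obj C" "x \<in> on_obj F c" for c x
    using that bij[OF that(1)] PiE_mem[OF \<alpha>E]
    by (simp add: \<beta>_def bij_betw_inv_into_left)
  have "nat_trans (op_cat C) set_cat G F \<beta>"
    unfolding nat_trans_presheaf_iff[OF G' F']
  proof (intro conjI ballI)
    show "\<beta> c \<in> on_obj G c \<rightarrow>\<^sub>E on_obj F c" if "c \<in> Obj C" for c
      using that \<alpha>\<beta>(2)[OF that] by (auto simp: \<beta>_def split: if_splits)
    fix c d f y assume *: "c \<in> Obj C" "d \<in> Obj C" "f \<in> Hom C d c" "y \<in> on_obj G c"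
    have "on_hom G c d f y = \<alpha> d (on_hom F c d f (\<beta> c y))"
      using * by (simp add: \<alpha>n \<alpha>\<beta>)
    then show "\<beta> d (on_hom G c d f y) = on_hom F c d f (\<beta> c y)"
      using * by (simp add: \<beta>\<alpha> \<alpha>\<beta> presheafD[OF F'])
  qed
  then have "\<beta> \<in> Hom (Sh C J) G F"
    by (simp add: Sh_simps \<beta>_def)
  moreover have "Cmp (Sh C J) F G F \<beta> \<alpha> = Idt (Sh C J) F" "Cmp (Sh C J) G F G \<alpha> \<beta> = Idt (Sh C J) G"
    unfolding Sh_simps compose_def by (auto intro!: restrict_ext simp: \<alpha>\<beta> \<beta>\<alpha>)
  ultimately show ?thesis
    unfolding iso_in_def using \<alpha> by blast
qed

end

section \<open>The nerve of a dense functor\<close>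

locale principal_dense = topological_monoid M \<tau> + K: cat_functor C "Cont M \<tau>" K
  for C :: "('o, 'a) cat" and M :: "'m monoid" (structure) and \<tau> :: "'m topology"
    and K :: "('o, 'a, ('u, 'm) mset, 'u \<Rightarrow> 'u) func" +
  assumes small: "small_monoid TYPE('u) M"
    and ff: "fully_faithful C (Cont M \<tau>) K"
    and principal: "c \<in> Obj C \<Longrightarrow> principal M (on_obj K c)"
    and dense: "continuous_mset M \<tau> P \<Longrightarrow> principal M P \<Longrightarrow>
      \<exists>c\<in>Obj C. \<exists>f. iso_in (Cont M \<tau>) (on_obj K c) P f"
begin

section \<open>Points, spans and strict epimorphisms of \<open>C\<close>\<close>

abbreviation "pt c \<equiv> points (on_obj K c)"

text \<open>One generator is fixed per object, so that evaluation at it can serve as a coding of the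
  maps out of \<open>K c\<close>.\<close>

definition "gen c = (SOME k. generates M (on_obj K c) k)"

lemma gen: "generates M (on_obj K c) (gen c)" if "c \<in> Obj C"
  using principal[OF that] unfolding principal_iff gen_def by (rule someI_ex)

lemma gen_in: "c \<in> Obj C \<Longrightarrow> gen c \<in> pt c"
  using generatesD(1)[OF gen] .

lemma K_obj: "c \<in> Obj C \<Longrightarrow> continuous_mset M \<tau> (on_obj K c)"
  using K.on_obj_in[of c] by simp

lemma K_hom: "c \<in> Obj C \<Longrightarrow> d \<in> Obj C \<Longrightarrow> f \<in> Hom C c d \<Longrightarrow>
    on_hom K c d f \<in> equivariant_maps M (on_obj K c) (on_obj K d)"
  using K.on_hom_in[of c d f] by simp

lemma K_hom_in: "c \<in> Obj C \<Longrightarrow> d \<in> Obj C \<Longrightarrow> f \<in> Hom C c d \<Longrightarrow> q \<in> pt c \<Longrightarrow> on_hom K c d f q \<in> pt d"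
  by (rule equivariantD(1)[OF K_hom])

lemma K_cmp: "c \<in> Obj C \<Longrightarrow> d \<in> Obj C \<Longrightarrow> e \<in> Obj C \<Longrightarrow> f \<in> Hom C c d \<Longrightarrow> g \<in> Hom C d e \<Longrightarrow> q \<in> pt c \<Longrightarrow>
    on_hom K c e (Cmp C c d e g f) q = on_hom K d e g (on_hom K c d f q)"
  using K.on_hom_cmp[of c d e f g] by (simp add: compose_eq)

lemma K_idt: "c \<in> Obj C \<Longrightarrow> q \<in> pt c \<Longrightarrow> on_hom K c c (Idt C c) q = q"
  using K.on_hom_idt[of c] by simp

text \<open>Faithfulness of \<open>K\<close> combined with generation: arrows of \<open>C\<close>
  are compared at a single point. Together with \<open>spanE\<close> this replaces diagram chases in
  pullbacks.\<close>

lemma hom_eqI: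
  assumes "c \<in> Obj C" "d \<in> Obj C" "f \<in> Hom C c d" "g \<in> Hom C c d" "generates M (on_obj K c) k"
    and "on_hom K c d f k = on_hom K c d g k"
  shows "f = g"
  using assms K.faithfulD[OF ff] equivariant_eq_of_generator K_hom by metis

lemma homE:
  assumes "c \<in> Obj C" "d \<in> Obj C" "h \<in> equivariant_maps M (on_obj K c) (on_obj K d)"
  obtains f where "f \<in> Hom C c d" "on_hom K c d f = h"
  using K.fullE[OF ff, of c d h] assms by auto

lemma infinite_universe: "infinite (UNIV :: 'u set)"
  using small by (simp add: small_monoid_def)

text \<open>The orbit of \<open>x\<close> is principal, so density provides an isomorphic
  \<open>K c\<close>. Injectivity of \<open>i\<close> records that \<open>k\<close> and
  \<open>x\<close> have the same kernel.\<close>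

lemma coverE:
  assumes X: "continuous_mset M \<tau> X" and x: "x \<in> points X"
  obtains c k i where "c \<in> Obj C" "generates M (on_obj K c) k"
    "i \<in> equivariant_maps M (on_obj K c) X" "inj_on i (pt c)" "i k = x"
proof -
  let ?O = "orbit_mset X x"
  note O = orbit_mset[OF X x]
  obtain c f where c: "c \<in> Obj C" and iso: "iso_in (Cont M \<tau>) (on_obj K c) ?O f"
    using dense[OF O(1)] O(4) unfolding principal_iff by blast
  have f: "f \<in> equivariant_maps M (on_obj K c) ?O" "bij_betw f (pt c) (points ?O)"
    using iso iso_in_Cont[OF K_obj[OF c] O(1)] by auto
  obtain k where k: "k \<in> pt c" "f k = x"
    using f(2) generatesD(1)[OF O(4)] unfolding bij_betw_def by (metis imageE)
  have "generates M (on_obj K c) k"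
    unfolding generates_def
  proof (intro conjI equalityI subsetI)
    fix q assume q: "q \<in> pt c"
    then obtain m where m: "m \<in> carrier M" "f q = act ?O (x, m)"
      using generatesD(2)[OF O(4)] equivariantD(1)[OF f(1)] by blast
    then have "f q = f (act (on_obj K c) (k, m))"
      using k f(1) by (simp add: equivariantD)
    then have "q = act (on_obj K c) (k, m)"
      using f(2) q msetD(1)[OF K_obj[OF c] k(1) m(1)] unfolding bij_betw_def by (meson inj_onD)
    then show "q \<in> {act (on_obj K c) (k, m) |m. m \<in> carrier M}"
      using m(1) by blast
  qed (use k msetD(1)[OF K_obj[OF c] k(1)] in auto)
  moreover have "f \<in> equivariant_maps M (on_obj K c) X"
    using f(1) O(2,3) unfolding equivariant_maps_iff by (auto simp: Pi_iff)
  moreover have "inj_on f (pt c)"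
    using f(2) by (simp add: bij_betw_def)
  ultimately show ?thesis
    using that c k by blast
qed

text \<open>The substitute for pullbacks: \<open>coverE\<close> is applied to the pair
  \<open>(r, t)\<close> in the product, and the two projections come back to \<open>C\<close> by
  fullness.\<close>

lemma spanE:
  assumes R: "R \<in> Obj C" and T: "T \<in> Obj C" and r: "r \<in> pt R" and t: "t \<in> pt T"
  obtains c k u v where "c \<in> Obj C" "generates M (on_obj K c) k" "u \<in> Hom C c R" "v \<in> Hom C c T"
    "on_hom K c R u k = r" "on_hom K c T v k = t"
proof -
  obtain p :: "'u \<times> 'u \<Rightarrow> 'u" where p: "inj p"
    using inj_pairing[OF infinite_universe] by blast
  let ?P = "prod_mset p (on_obj K R) (on_obj K T)"
  note P = prod_mset[OF p K_obj[OF R] K_obj[OF T]]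
  have rt: "p (r, t) \<in> points ?P"
    using P(2) r t by simp
  obtain c k i where c: "c \<in> Obj C" "generates M (on_obj K c) k"
    "i \<in> equivariant_maps M (on_obj K c) ?P" "i k = p (r, t)"
    using coverE[OF P(1) rt] by metis
  note cl = msetD(1)[OF K_obj[OF c(1)]]
  obtain u where u: "u \<in> Hom C c R" "on_hom K c R u = compose (pt c)
      (restrict (\<lambda>z. fst (inv_into UNIV p z)) (points ?P)) i"
    using homE[OF c(1) R equivariant_compose[OF c(3) P(4) cl]] by metis
  obtain v where v: "v \<in> Hom C c T" "on_hom K c T v = compose (pt c)
      (restrict (\<lambda>z. snd (inv_into UNIV p z)) (points ?P)) i"
    using homE[OF c(1) T equivariant_compose[OF c(3) P(5) cl]] by metis
  show ?thesis
    using that[OF c(1,2) u(1) v(1)] u(2) v(2) generatesD(1)[OF c(2)] c(4) rt p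
    by (simp add: compose_eq)
qed

text \<open>A surjective equivariant map is a quotient map, so a map constant on its fibres factors
  through it. The target \<open>X\<close> need not be principal, as gluing in the nerve
  requires.\<close>

lemma descendE:
  assumes A: "A \<in> Obj C" and B: "B \<in> Obj C" and e: "e \<in> Hom C A B"
    and surj: "on_hom K A B e ` pt A = pt B"
    and X: "continuous_mset M \<tau> X" and h: "h \<in> equivariant_maps M (on_obj K A) X"
    and ker: "\<And>a b. a \<in> pt A \<Longrightarrow> b \<in> pt A \<Longrightarrow> on_hom K A B e a = on_hom K A B e b \<Longrightarrow> h a = h b"
  obtains l where "l \<in> equivariant_maps M (on_obj K B) X"
    "\<And>a. a \<in> pt A \<Longrightarrow> l (on_hom K A B e a) = h a"
proof
  let ?e = "on_hom K A B e"
  note e' = K_hom[OF A B e]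
  define l where "l = restrict (\<lambda>b. h (inv_into (pt A) ?e b)) (pt B)"
  show l: "l (?e a) = h a" if a: "a \<in> pt A" for a
  proof -
    have "?e a \<in> ?e ` pt A"
      using a by simp
    then have "inv_into (pt A) ?e (?e a) \<in> pt A" "?e (inv_into (pt A) ?e (?e a)) = ?e a"
      by (rule inv_into_into, rule f_inv_into_f)
    then show ?thesis
      using ker[of "inv_into (pt A) ?e (?e a)" a] a equivariantD(1)[OF e' a] by (simp add: l_def)
  qed
  have lift: "\<exists>a\<in>pt A. b = ?e a" if "b \<in> pt B" for b
    using surj that by blast
  have "restrict l (pt B) \<in> equivariant_maps M (on_obj K B) X"
  proof (rule restrict_equivariantI)
    fix b assume "b \<in> pt B"
    then obtain a where a: "a \<in> pt A" "b = ?e a"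
      using lift by blast
    then show "l b \<in> points X"
      using l h by (simp add: equivariantD)
    fix m assume m: "m \<in> carrier M"
    show "act (on_obj K B) (b, m) \<in> pt B"
      using msetD(1)[OF K_obj[OF B] \<open>b \<in> pt B\<close> m] .
    have "act (on_obj K B) (b, m) = ?e (act (on_obj K A) (a, m))"
      using a m e' by (simp add: equivariantD)
    then show "l (act (on_obj K B) (b, m)) = act X (l b, m)"
      using a m l h msetD(1)[OF K_obj[OF A] a(1) m] by (simp add: equivariantD)
  qed
  then show "l \<in> equivariant_maps M (on_obj K B) X"
    by (simp add: l_def)
qed

lemma surj_of_generator:
  assumes "A \<in> Obj C" "B \<in> Obj C" "e \<in> Hom C A B" "a \<in> pt A"
    and "generates M (on_obj K B) (on_hom K A B e a)"
  shows "on_hom K A B e ` pt A = pt B"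
proof (intro equalityI subsetI)
  fix b assume "b \<in> pt B"
  then obtain m where m: "m \<in> carrier M" "b = act (on_obj K B) (on_hom K A B e a, m)"
    using generatesD(2)[OF assms(5)] by blast
  then have "b = on_hom K A B e (act (on_obj K A) (a, m))"
    using equivariantD(2)[OF K_hom[OF assms(1-3)] assms(4)] by simp
  then show "b \<in> on_hom K A B e ` pt A"
    using msetD(1)[OF K_obj[OF assms(1)] assms(4) m(1)] by blast
qed (use assms K_hom_in in auto)

text \<open>For necessity, \<open>e\<close> is factored as \<open>j s\<close> through the orbit of
  the image of \<open>gen A\<close>; strictness makes the inclusion \<open>j\<close> split epi, so
  this orbit is all of \<open>B\<close>. For sufficiency, points in one fibre of \<open>e\<close>
  are joined by a span, which turns coequalizing parallel pairs into constancy on fibres.\<close>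

lemma strict_epi_iff:
  assumes A: "A \<in> Obj C" and B: "B \<in> Obj C" and e: "e \<in> Hom C A B"
  shows "strict_epi C A B e \<longleftrightarrow> on_hom K A B e ` pt A = pt B"
proof
  assume se: "strict_epi C A B e"
  let ?x = "on_hom K A B e (gen A)"
  have x: "?x \<in> pt B"
    using K_hom_in[OF A B e gen_in[OF A]] .
  obtain c k i where c: "c \<in> Obj C" "generates M (on_obj K c) k"
    "i \<in> equivariant_maps M (on_obj K c) (on_obj K B)" "inj_on i (pt c)" "i k = ?x"
    using coverE[OF K_obj[OF B] x] by blast
  obtain j where j: "j \<in> Hom C c B" "on_hom K c B j = i"
    using homE[OF c(1) B c(3)] by blast
  have kc: "k \<in> pt c"
    using generatesD(1)[OF c(2)] .
  \<comment> \<open>The kernel of \<open>k\<close> equals that of \<open>?x\<close>, which contains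
    the kernel of \<open>gen A\<close>. Hence \<open>gen A\<close> may be sent to \<open>k\<close>,
    giving the corestriction \<open>s\<close> of \<open>e\<close>.\<close>
  have "act (on_obj K c) (k, m) = act (on_obj K c) (k, n)"
    if m: "m \<in> carrier M" and n: "n \<in> carrier M"
      and eq: "act (on_obj K A) (gen A, m) = act (on_obj K A) (gen A, n)" for m n
  proof -
    have "i (act (on_obj K c) (k, m)) = on_hom K A B e (act (on_obj K A) (gen A, m))"
      "i (act (on_obj K c) (k, n)) = on_hom K A B e (act (on_obj K A) (gen A, n))"
      using m n c(3,5) kc K_hom[OF A B e] gen_in[OF A] by (simp_all add: equivariantD)
    then have "i (act (on_obj K c) (k, m)) = i (act (on_obj K c) (k, n))"
      using eq by simp
    then show ?thesis
      using c(4) msetD(1)[OF K_obj[OF c(1)] kc] m n by (meson inj_onD)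
  qed
  then obtain q where "q \<in> equivariant_maps M (on_obj K A) (on_obj K c)" "q (gen A) = k"
    using equivariant_extend[OF K_obj[OF A] K_obj[OF c(1)] gen[OF A] kc] by blast
  then obtain s where s: "s \<in> Hom C A c" "on_hom K A c s (gen A) = k"
    using homE[OF A c(1)] by metis
  have js: "Cmp C A c B j s = e"
    by (rule hom_eqI[OF A B _ e gen[OF A]])
      (use A B c s j gen_in[OF A] in \<open>simp_all add: K.dom.cmp_in_hom K_cmp\<close>)
  \<comment> \<open>Whatever \<open>e\<close> coequalizes, \<open>s\<close> coequalizes too, because
    \<open>j\<close> is injective on points; so strictness applies to \<open>s\<close>.\<close>
  have "Cmp C Z A c s g = Cmp C Z A c s h"
    if Z: "Z \<in> Obj C" "g \<in> Hom C Z A" "h \<in> Hom C Z A" "Cmp C Z A B e g = Cmp C Z A B e h" for Z g h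
  proof (rule hom_eqI[OF Z(1) c(1) _ _ gen[OF Z(1)]])
    let ?sg = "on_hom K Z c (Cmp C Z A c s g) (gen Z)" and ?sh = "on_hom K Z c (Cmp C Z A c s h) (gen Z)"
    have "i ?sg = on_hom K Z B (Cmp C Z A B (Cmp C A c B j s) g) (gen Z)"
      "i ?sh = on_hom K Z B (Cmp C Z A B (Cmp C A c B j s) h) (gen Z)"
      using Z A B c(1) s j gen_in[OF Z(1)] by (simp_all add: K_cmp K_hom_in K.dom.cmp_in_hom)
    then have "i ?sg = i ?sh"
      using Z(4) js by simp
    moreover have "?sg \<in> pt c" "?sh \<in> pt c"
      using Z A c(1) s gen_in[OF Z(1)] by (simp_all add: K_hom_in K.dom.cmp_in_hom)
    ultimately show "?sg = ?sh"
      using c(4) by (meson inj_onD)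
  qed (use Z A c s in \<open>simp_all add: K.dom.cmp_in_hom\<close>)
  then obtain l where l: "l \<in> Hom C B c" "Cmp C A B c l e = s"
    using se c(1) s(1) unfolding strict_epi_def by blast
  \<comment> \<open>Strictness with \<open>e\<close> itself as test arrow: both \<open>j l\<close>
    and the identity fix \<open>e\<close>, so they coincide.\<close>
  have "\<exists>!l. l \<in> Hom C B B \<and> Cmp C A B B l e = e"
    using se B e unfolding strict_epi_def by blast
  moreover have "Cmp C A B B (Cmp C B c B j l) e = e"
    using A B c(1) j(1) l e js by (simp flip: K.dom.cmp_assoc)
  moreover have "Cmp C A B B (Idt C B) e = e"
    using A B e by (simp add: K.dom.cmp_idt_left)
  ultimately have jl: "Cmp C B c B j l = Idt C B"
    using A B c(1) j(1) l(1) by (metis K.dom.idt_in_hom K.dom.cmp_in_hom)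
  have "b \<in> on_hom K A B e ` pt A" if b: "b \<in> pt B" for b
  proof -
    have lb: "on_hom K B c l b \<in> pt c" "on_hom K c B j (on_hom K B c l b) = b"
      using K_hom_in[OF B c(1) l(1) b] K_cmp[OF B c(1) B l(1) j(1) b] jl K_idt[OF B b] by simp_all
    then obtain m where m: "m \<in> carrier M" "on_hom K B c l b = act (on_obj K c) (k, m)"
      using generatesD(2)[OF c(2)] by blast
    then have "b = on_hom K A B e (act (on_obj K A) (gen A, m))"
      using lb(2) j(2) c(3,5) kc K_hom[OF A B e] gen_in[OF A] by (simp add: equivariantD)
    then show ?thesis
      using msetD(1)[OF K_obj[OF A] gen_in[OF A] m(1)] by blast
  qed
  then show "on_hom K A B e ` pt A = pt B"
    using K_hom_in[OF A B e] by blast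
next
  assume surj: "on_hom K A B e ` pt A = pt B"
  show "strict_epi C A B e"
    unfolding strict_epi_def
  proof (intro conjI ballI impI)
    fix T k assume T: "T \<in> Obj C" and k: "k \<in> Hom C A T"
      and co: "\<forall>Z\<in>Obj C. \<forall>g\<in>Hom C Z A. \<forall>h\<in>Hom C Z A.
        Cmp C Z A B e g = Cmp C Z A B e h \<longrightarrow> Cmp C Z A T k g = Cmp C Z A T k h"
    \<comment> \<open>The legs \<open>u\<close> and \<open>v\<close> of a span through
      \<open>a\<close> and \<open>b\<close> are identified by \<open>e\<close>, since they are at
      the generator; so \<open>k\<close> identifies them as well.\<close>
    have ker: "on_hom K A T k a = on_hom K A T k b"
      if a: "a \<in> pt A" and b: "b \<in> pt A" and eq: "on_hom K A B e a = on_hom K A B e b" for a b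
    proof -
      obtain c q u v where c: "c \<in> Obj C" "generates M (on_obj K c) q" "u \<in> Hom C c A" "v \<in> Hom C c A"
        "on_hom K c A u q = a" "on_hom K c A v q = b"
        using spanE[OF A A a b] by metis
      have q: "q \<in> pt c"
        using generatesD(1)[OF c(2)] .
      have "Cmp C c A B e u = Cmp C c A B e v"
        by (rule hom_eqI[OF c(1) B _ _ c(2)])
          (use A B c e eq q in \<open>simp_all add: K.dom.cmp_in_hom K_cmp\<close>)
      then have "Cmp C c A T k u = Cmp C c A T k v"
        using co c by blast
      then show ?thesis
        using K_cmp[OF c(1) A T c(3) k q] K_cmp[OF c(1) A T c(4) k q] c(5,6) by simp
    qed
    obtain h where h: "h \<in> equivariant_maps M (on_obj K B) (on_obj K T)"
      "\<And>a. a \<in> pt A \<Longrightarrow> h (on_hom K A B e a) = on_hom K A T k a"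
      using descendE[OF A B e surj K_obj[OF T] K_hom[OF A T k] ker] by metis
    obtain l where l: "l \<in> Hom C B T" "on_hom K B T l = h"
      using homE[OF B T h(1)] by blast
    show "\<exists>!l. l \<in> Hom C B T \<and> Cmp C A B T l e = k"
    proof (intro ex1I[of _ l] conjI l(1))
      show "Cmp C A B T l e = k"
        by (rule hom_eqI[OF A T _ k gen[OF A]])
          (use A B T l e h(2) gen_in[OF A] in \<open>simp_all add: K.dom.cmp_in_hom K_cmp\<close>)
      fix l' assume l': "l' \<in> Hom C B T \<and> Cmp C A B T l' e = k"
      obtain a where a: "a \<in> pt A" "on_hom K A B e a = gen B"
        using surj gen_in[OF B] by (metis imageE)
      have "on_hom K B T l' (gen B) = on_hom K A T k a"
        using K_cmp[OF A B T e _ a(1), of l'] l' a(2) by simp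
      then show "l' = l"
        using hom_eqI[OF B T _ l(1) gen[OF B], of l'] l' l(2) h(2)[OF a(1)] a(2) by simp
    qed
  qed (fact e)
qed

section \<open>The nerve of an action and its sheaf property\<close>

definition "elts X c = (\<lambda>f. f (gen c)) ` equivariant_maps M (on_obj K c) X"

definition "elt_map X c = inv_into (equivariant_maps M (on_obj K c) X) (\<lambda>f. f (gen c))"

lemma elt_map:
  assumes "x \<in> elts X c"
  shows "elt_map X c x \<in> equivariant_maps M (on_obj K c) X" "elt_map X c x (gen c) = x"
  using inv_into_into[OF assms[unfolded elts_def]] f_inv_into_f[OF assms[unfolded elts_def]]
  unfolding elt_map_def by auto

lemma elt_eqI:
  assumes "x \<in> elts X c" "y \<in> elts X c" and eq: "elt_map X c x = elt_map X c y"
  shows "x = y"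
proof -
  have "x = elt_map X c x (gen c)"
    using elt_map(2)[OF assms(1)] by (rule sym)
  also have "\<dots> = elt_map X c y (gen c)"
    unfolding eq ..
  also have "\<dots> = y"
    using elt_map(2)[OF assms(2)] .
  finally show ?thesis .
qed

lemma elts_of_map:
  assumes c: "c \<in> Obj C" and f: "f \<in> equivariant_maps M (on_obj K c) X"
  shows "f (gen c) \<in> elts X c" "elt_map X c (f (gen c)) = f"
proof -
  show e: "f (gen c) \<in> elts X c"
    using f by (simp add: elts_def)
  show "elt_map X c (f (gen c)) = f"
    using equivariant_eq_of_generator[OF gen[OF c] elt_map(1)[OF e] f] elt_map(2)[OF e] by simp
qed

text \<open>
  A map \<open>K c \<rightarrow> X\<close> is determined by the image of the generator, so that the sets
  \<open>Hom (K c, X)\<close> are represented inside the universe by subsets of \<open>X\<close>.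
\<close>

definition nerve where
  "nerve X = \<lparr>on_obj = restrict (elts X) (Obj C),
    on_hom = (\<lambda>c d f. if c \<in> Obj C \<and> d \<in> Obj C \<and> f \<in> Hom C d c
      then restrict (\<lambda>x. elt_map X c x (on_hom K d c f (gen d))) (elts X c) else undefined)\<rparr>"

text \<open>Postcomposition with \<open>\<phi>\<close> becomes application of \<open>\<phi>\<close>
  to the code, since the value of \<open>\<phi> f\<close> at \<open>gen c\<close> is
  \<open>\<phi> (f (gen c))\<close>. Hence the action on arrows is mere restriction of
  \<open>\<phi>\<close>.\<close>

definition nerve_functor ::
  "(('u, 'm) mset, 'u \<Rightarrow> 'u, ('o, 'a, 'u set, 'u \<Rightarrow> 'u) func, 'o \<Rightarrow> 'u \<Rightarrow> 'u) func" where
  "nerve_functor = \<lparr>on_obj = nerve,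
    on_hom = (\<lambda>X Y \<phi>. \<lambda>c\<in>Obj C. restrict \<phi> (elts X c))\<rparr>"

lemma nerve_obj: "c \<in> Obj C \<Longrightarrow> on_obj (nerve X) c = elts X c"
  by (simp add: nerve_def)

text \<open>Restriction along \<open>f\<close> is precomposition with \<open>K f\<close>; its code
  is therefore the decoded map evaluated at the image of \<open>gen d\<close>.\<close>

lemma nerve_hom:
  assumes c: "c \<in> Obj C" and d: "d \<in> Obj C" and f: "f \<in> Hom C d c" and x: "x \<in> elts X c"
  shows "on_hom (nerve X) c d f x \<in> elts X d"
    "q \<in> pt d \<Longrightarrow> elt_map X d (on_hom (nerve X) c d f x) q = elt_map X c x (on_hom K d c f q)"
    "on_hom (nerve X) c d f x = elt_map X c x (on_hom K d c f (gen d))"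
proof -
  let ?h = "compose (pt d) (elt_map X c x) (on_hom K d c f)"
  have h: "?h \<in> equivariant_maps M (on_obj K d) X"
    by (rule equivariant_compose[OF K_hom[OF d c f] elt_map(1)[OF x] msetD(1)[OF K_obj[OF d]]])
  have "on_hom (nerve X) c d f x = ?h (gen d)"
    using c d f x gen_in[OF d] by (simp add: nerve_def compose_eq)
  then show "on_hom (nerve X) c d f x \<in> elts X d"
    "q \<in> pt d \<Longrightarrow> elt_map X d (on_hom (nerve X) c d f x) q = elt_map X c x (on_hom K d c f q)"
    "on_hom (nerve X) c d f x = elt_map X c x (on_hom K d c f (gen d))"
    using elts_of_map[OF d h] gen_in[OF d] by (simp_all add: compose_eq)
qed

lemma presheaf_nerve: "cat_functor (op_cat C) set_cat (nerve X)"
proof (rule K.dom.presheafI)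
  fix c d f assume *: "c \<in> Obj C" "d \<in> Obj C" "f \<in> Hom C d c"
  then have "on_hom (nerve X) c d f \<in> extensional (elts X c)"
    by (simp add: nerve_def)
  then show "on_hom (nerve X) c d f \<in> on_obj (nerve X) c \<rightarrow>\<^sub>E on_obj (nerve X) d"
    using * by (auto simp: nerve_obj nerve_hom(1) PiE_iff)
next
  fix c x assume *: "c \<in> Obj C" "x \<in> on_obj (nerve X) c"
  then show "on_hom (nerve X) c c (Idt C c) x = x"
    by (simp add: nerve_obj nerve_hom(3) K.dom.idt_in_hom K_idt gen_in elt_map)
next
  fix c d e f g x
  assume *: "c \<in> Obj C" "d \<in> Obj C" "e \<in> Obj C" "f \<in> Hom C d c" "g \<in> Hom C e d"
    "x \<in> on_obj (nerve X) c"
  then have x: "x \<in> elts X c"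
    by (simp add: nerve_obj)
  have "on_hom (nerve X) c e (Cmp C e d c f g) x = elt_map X c x (on_hom K d c f (on_hom K e d g (gen e)))"
    using * x by (simp add: nerve_hom(3) K.dom.cmp_in_hom K_cmp gen_in)
  also have "\<dots> = elt_map X d (on_hom (nerve X) c d f x) (on_hom K e d g (gen e))"
    using * x by (simp add: nerve_hom(2) K_hom_in gen_in)
  also have "\<dots> = on_hom (nerve X) d e g (on_hom (nerve X) c d f x)"
    using nerve_hom(3)[OF *(2,3,5) nerve_hom(1)[OF *(1,2,4) x]] by simp
  finally show "on_hom (nerve X) c e (Cmp C e d c f g) x = on_hom (nerve X) d e g (on_hom (nerve X) c d f x)" .
qed

lemma covering_sieveE:
  assumes S: "S \<in> reductive_topology C B" and B: "B \<in> Obj C"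
  obtains A e where "(A, e) \<in> S" "A \<in> Obj C" "e \<in> Hom C A B" "on_hom K A B e ` pt A = pt B"
proof -
  obtain A e where Ae: "(A, e) \<in> S" "strict_epi C A B e" "sieve C B S"
    using S unfolding reductive_topology_def by auto
  then have "A \<in> Obj C" "e \<in> Hom C A B"
    unfolding sieve_def by auto
  then show ?thesis
    using that Ae strict_epi_iff[OF _ B] by blast
qed

text \<open>A covering sieve contains a surjection \<open>e\<close>. The member of the family at
  \<open>e\<close> is constant on the fibres of \<open>e\<close>, so it descends to a map out of
  \<open>K B\<close>; the remaining work is to compare this map with the other members.\<close>

lemma sheaf_nerve:
  assumes X: "continuous_mset M \<tau> X"
  shows "is_sheaf C (reductive_topology C) (nerve X)"
  unfolding is_sheaf_def
proof (intro ballI allI impI)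
  fix B S x assume B: "B \<in> Obj C" and S: "S \<in> reductive_topology C B"
    and match: "matching_family C (nerve X) B S x"
  obtain A e where Ae: "(A, e) \<in> S" "A \<in> Obj C" "e \<in> Hom C A B" "on_hom K A B e ` pt A = pt B"
    using covering_sieveE[OF S B] by blast
  note A = Ae(2) and e = Ae(3) and surj = Ae(4)
  have SD: "Y \<in> Obj C" "f \<in> Hom C Y B" "x Y f \<in> elts X Y" if "(Y, f) \<in> S" for Y f
  proof -
    show "Y \<in> Obj C" "f \<in> Hom C Y B"
      using S that unfolding reductive_topology_def sieve_def by auto
    then show "x Y f \<in> elts X Y"
      using match that unfolding matching_family_def by (auto simp: nerve_obj)
  qed
  have Sx: "on_hom (nerve X) Y Z g (x Y f) = x Z (Cmp C Z Y B f g)"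
    if "(Y, f) \<in> S" "Z \<in> Obj C" "g \<in> Hom C Z Y" for Y f Z g
    using match that unfolding matching_family_def by auto
  \<comment> \<open>The value of a member at a point depends only on the image of the point in
    \<open>K B\<close>: a span through \<open>y\<close> and \<open>z\<close> gives equal composites
    into \<open>B\<close>, and matching compares the two members over its apex.\<close>
  have agree: "elt_map X Y (x Y f) y = elt_map X Z (x Z g) z"
    if Yf: "(Y, f) \<in> S" and Zg: "(Z, g) \<in> S" and y: "y \<in> pt Y" and z: "z \<in> pt Z"
      and eq: "on_hom K Y B f y = on_hom K Z B g z" for Y f y Z g z
  proof -
    obtain c k u v where c: "c \<in> Obj C" "generates M (on_obj K c) k" "u \<in> Hom C c Y" "v \<in> Hom C c Z"
      "on_hom K c Y u k = y" "on_hom K c Z v k = z"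
      using spanE[OF SD(1)[OF Yf] SD(1)[OF Zg] y z] by metis
    have k: "k \<in> pt c"
      using generatesD(1)[OF c(2)] .
    have "Cmp C c Y B f u = Cmp C c Z B g v"
      by (rule hom_eqI[OF c(1) B _ _ c(2)])
        (use B c eq k SD[OF Yf] SD[OF Zg] in \<open>simp_all add: K.dom.cmp_in_hom K_cmp\<close>)
    then have "on_hom (nerve X) Y c u (x Y f) = on_hom (nerve X) Z c v (x Z g)"
      using Sx[OF Yf c(1,3)] Sx[OF Zg c(1,4)] by simp
    then show ?thesis
      using nerve_hom(2)[OF SD(1)[OF Yf] c(1,3) SD(3)[OF Yf] k]
        nerve_hom(2)[OF SD(1)[OF Zg] c(1,4) SD(3)[OF Zg] k] c(5,6) by simp
  qed
  obtain l where l: "l \<in> equivariant_maps M (on_obj K B) X"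
    "\<And>a. a \<in> pt A \<Longrightarrow> l (on_hom K A B e a) = elt_map X A (x A e) a"
    using descendE[OF A B e surj X elt_map(1)[OF SD(3)[OF Ae(1)]] agree[OF Ae(1) Ae(1)]] by blast
  show "\<exists>!a. a \<in> on_obj (nerve X) B \<and> (\<forall>(Y, f)\<in>S. on_hom (nerve X) B Y f a = x Y f)"
  proof (intro ex1I[of _ "l (gen B)"] conjI)
    show lB: "l (gen B) \<in> on_obj (nerve X) B"
      using elts_of_map(1)[OF B l(1)] by (simp add: nerve_obj B)
    \<comment> \<open>The arrow \<open>f\<close> need not factor through \<open>e\<close>, but the
      image of \<open>gen Y\<close> lifts along \<open>e\<close> to a point \<open>a\<close>, where
      \<open>agree\<close> applies.\<close>
    have "on_hom (nerve X) B Y f (l (gen B)) = x Y f" if Yf: "(Y, f) \<in> S" for Y f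
    proof -
      have fg: "on_hom K Y B f (gen Y) \<in> pt B"
        using K_hom_in SD[OF Yf] B gen_in by blast
      then obtain a where a: "a \<in> pt A" "on_hom K A B e a = on_hom K Y B f (gen Y)"
        using surj by (metis imageE)
      have "on_hom (nerve X) B Y f (l (gen B)) = l (on_hom K Y B f (gen Y))"
        using nerve_hom(3)[OF B SD(1,2)[OF Yf]] elts_of_map[OF B l(1)] by simp
      also have "\<dots> = elt_map X A (x A e) a"
        using l(2)[OF a(1)] a(2) by simp
      also have "\<dots> = elt_map X Y (x Y f) (gen Y)"
        using agree[OF Ae(1) Yf a(1) gen_in[OF SD(1)[OF Yf]] a(2)] .
      also have "\<dots> = x Y f"
        using elt_map(2)[OF SD(3)[OF Yf]] .
      finally show ?thesis .
    qed
    then show "\<forall>(Y, f)\<in>S. on_hom (nerve X) B Y f (l (gen B)) = x Y f"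
      by blast
    fix b assume b: "b \<in> on_obj (nerve X) B \<and> (\<forall>(Y, f)\<in>S. on_hom (nerve X) B Y f b = x Y f)"
    then have b': "b \<in> elts X B" "on_hom (nerve X) B A e b = x A e"
      using Ae(1) by (auto simp: nerve_obj B)
    obtain a where a: "a \<in> pt A" "on_hom K A B e a = gen B"
      using surj gen_in[OF B] by (metis imageE)
    have "b = elt_map X B b (on_hom K A B e a)"
      using elt_map(2)[OF b'(1)] a(2) by simp
    also have "\<dots> = elt_map X A (x A e) a"
      using nerve_hom(2)[OF B A e b'(1) a(1)] b'(2) by simp
    finally show "b = l (gen B)"
      using l(2)[OF a(1)] a(2) by simp
  qed
qed

lemma nerve_in_Sh:
  assumes "continuous_mset M \<tau> X"
  shows "nerve X \<in> Obj (Sh C (reductive_topology C))"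
  using presheaf_nerve sheaf_nerve[OF assms]
  by (auto simp: Sh_Obj extensional_func_def nerve_def)

lemma elts_map:
  assumes c: "c \<in> Obj C" and \<phi>: "\<phi> \<in> equivariant_maps M X Y" and x: "x \<in> elts X c"
  shows "\<phi> x \<in> elts Y c" "q \<in> pt c \<Longrightarrow> elt_map Y c (\<phi> x) q = \<phi> (elt_map X c x q)"
proof -
  let ?h = "compose (pt c) \<phi> (elt_map X c x)"
  have h: "?h \<in> equivariant_maps M (on_obj K c) Y"
    by (rule equivariant_compose[OF elt_map(1)[OF x] \<phi> msetD(1)[OF K_obj[OF c]]])
  have "?h (gen c) = \<phi> x"
    using elt_map(2)[OF x] gen_in[OF c] by (simp add: compose_eq)
  then show "\<phi> x \<in> elts Y c" "q \<in> pt c \<Longrightarrow> elt_map Y c (\<phi> x) q = \<phi> (elt_map X c x q)"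
    using elts_of_map[OF c h] by (auto simp: compose_eq)
qed

lemma elts_subset: "c \<in> Obj C \<Longrightarrow> x \<in> elts X c \<Longrightarrow> x \<in> points X"
  using elt_map equivariantD(1) gen_in by metis

section \<open>The nerve functor and its full faithfulness\<close>

lemma Sh_nerve_hom_iff:
  "\<alpha> \<in> Hom (Sh C J) (nerve X) (nerve Y) \<longleftrightarrow> \<alpha> \<in> extensional (Obj C) \<and>
    (\<forall>c\<in>Obj C. \<alpha> c \<in> elts X c \<rightarrow>\<^sub>E elts Y c) \<and>
    (\<forall>c\<in>Obj C. \<forall>d\<in>Obj C. \<forall>f\<in>Hom C d c. \<forall>x\<in>elts X c.
      \<alpha> d (on_hom (nerve X) c d f x) = on_hom (nerve Y) c d f (\<alpha> c x))"
  by (simp add: Sh_simps K.dom.nat_trans_presheaf_iff[OF presheaf_nerve presheaf_nerve] nerve_obj)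

lemma nerve_functor: "cat_functor (Cont M \<tau>) (Sh C (reductive_topology C)) nerve_functor"
  unfolding cat_functor_def cat_functor_axioms_def
proof (intro conjI allI impI)
  show "category (Cont M \<tau>)" "category (Sh C (reductive_topology C))"
    using category_Cont K.dom.category_Sh by auto
next
  fix X :: "('u, 'm) mset" assume "X \<in> Obj (Cont M \<tau>)"
  then show "on_obj nerve_functor X \<in> Obj (Sh C (reductive_topology C))"
    by (simp add: nerve_functor_def nerve_in_Sh)
next
  fix X Y :: "('u, 'm) mset" and f assume "f \<in> Hom (Cont M \<tau>) X Y"
  then have f: "f \<in> equivariant_maps M X Y"
    by simp
  have nat: "f (on_hom (nerve X) c d g x) = on_hom (nerve Y) c d g (f x)"
    if "c \<in> Obj C" "d \<in> Obj C" "g \<in> Hom C d c" "x \<in> elts X c" for c d g x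
    using that nerve_hom(3)[OF that(1-3) elts_map(1)[OF that(1) f that(4)]]
    by (simp add: nerve_hom(3) elts_map(2)[OF _ f] K_hom_in gen_in)
  show "on_hom nerve_functor X Y f
      \<in> Hom (Sh C (reductive_topology C)) (on_obj nerve_functor X) (on_obj nerve_functor Y)"
    using nerve_hom(1) elts_map(1)[OF _ f]
    by (auto simp: nerve_functor_def Sh_nerve_hom_iff nat)
next
  fix X :: "('u, 'm) mset"
  show "on_hom nerve_functor X X (Idt (Cont M \<tau>) X) = Idt (Sh C (reductive_topology C)) (on_obj nerve_functor X)"
    by (auto simp: nerve_functor_def Sh_simps nerve_obj elts_subset intro!: restrict_ext)
next
  fix X Y Z :: "('u, 'm) mset" and f g assume "f \<in> Hom (Cont M \<tau>) X Y" "g \<in> Hom (Cont M \<tau>) Y Z"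
  then show "on_hom nerve_functor X Z (Cmp (Cont M \<tau>) X Y Z g f) =
    Cmp (Sh C (reductive_topology C)) (on_obj nerve_functor X) (on_obj nerve_functor Y)
      (on_obj nerve_functor Z) (on_hom nerve_functor Y Z g) (on_hom nerve_functor X Y f)"
    by (auto simp: nerve_functor_def Sh_simps nerve_obj elts_subset elts_map compose_def intro!: restrict_ext)
qed

lemma elt_of_point:
  assumes X: "continuous_mset M \<tau> X" and x: "x \<in> points X"
  obtains c k y where "c \<in> Obj C" "generates M (on_obj K c) k" "y \<in> elts X c" "elt_map X c y k = x"
proof -
  obtain c k i where "c \<in> Obj C" "generates M (on_obj K c) k"
    "i \<in> equivariant_maps M (on_obj K c) X" "i k = x"
    using coverE[OF X x] by metis
  then show ?thesis
    using that elts_of_map by metis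
qed

text \<open>Every point of \<open>X\<close> lies in the image of some map out of a
  \<open>K c\<close>, so an equivariant map is determined by its effect on codes. Conversely a
  natural transformation prescribes the value at each such point, and naturality along spans makes
  the prescription consistent.\<close>

lemma nerve_fully_faithful:
  "fully_faithful (Cont M \<tau>) (Sh C (reductive_topology C)) nerve_functor"
  unfolding fully_faithful_def bij_betw_def
proof (intro ballI conjI)
  fix X Y :: "('u, 'm) mset" assume "X \<in> Obj (Cont M \<tau>)" "Y \<in> Obj (Cont M \<tau>)"
  then have X: "continuous_mset M \<tau> X" and Y: "continuous_mset M \<tau> Y"
    by simp_all
  let ?N = "on_hom nerve_functor X Y"
  show "inj_on ?N (Hom (Cont M \<tau>) X Y)"
  proof (rule inj_onI)
    fix f g assume "f \<in> Hom (Cont M \<tau>) X Y" "g \<in> Hom (Cont M \<tau>) X Y" and eq: "?N f = ?N g"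
    then have f: "f \<in> equivariant_maps M X Y" and g: "g \<in> equivariant_maps M X Y"
      by simp_all
    have fg: "f y = g y" if "c \<in> Obj C" "y \<in> elts X c" for c y
      using fun_cong[OF fun_cong[OF eq], of c y] that by (simp add: nerve_functor_def)
    show "f = g"
    proof (rule equivariant_eqI[OF f g])
      fix x assume x: "x \<in> points X"
      obtain c k y where c: "c \<in> Obj C" "generates M (on_obj K c) k" "y \<in> elts X c" "elt_map X c y k = x"
        using elt_of_point[OF X x] by metis
      show "f x = g x"
        using elts_map(2)[OF c(1) f c(3) generatesD(1)[OF c(2)]]
          elts_map(2)[OF c(1) g c(3) generatesD(1)[OF c(2)]] fg[OF c(1,3)] c(4) by simp
    qed
  qed
  show "?N ` Hom (Cont M \<tau>) X Y = Hom (Sh C (reductive_topology C)) (on_obj nerve_functor X) (on_obj nerve_functor Y)"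
  proof (intro equalityI subsetI)
    show "\<alpha> \<in> Hom (Sh C (reductive_topology C)) (on_obj nerve_functor X) (on_obj nerve_functor Y)"
      if "\<alpha> \<in> ?N ` Hom (Cont M \<tau>) X Y" for \<alpha>
      using that X Y cat_functor.on_hom_in[OF nerve_functor, of X Y] by auto
    fix \<alpha> assume "\<alpha> \<in> Hom (Sh C (reductive_topology C)) (on_obj nerve_functor X) (on_obj nerve_functor Y)"
    then have \<alpha>: "\<alpha> \<in> extensional (Obj C)" "\<And>c. c \<in> Obj C \<Longrightarrow> \<alpha> c \<in> elts X c \<rightarrow>\<^sub>E elts Y c"
      "\<And>c d f x. c \<in> Obj C \<Longrightarrow> d \<in> Obj C \<Longrightarrow> f \<in> Hom C d c \<Longrightarrow> x \<in> elts X c \<Longrightarrow>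
        \<alpha> d (on_hom (nerve X) c d f x) = on_hom (nerve Y) c d f (\<alpha> c x)"
      by (simp_all add: nerve_functor_def Sh_nerve_hom_iff)
    have \<alpha>Y: "\<alpha> c x \<in> elts Y c" if "c \<in> Obj C" "x \<in> elts X c" for c x
      using \<alpha>(2) that by (blast intro: PiE_mem)
    \<comment> \<open>Two presentations of one point of \<open>X\<close> restrict to the same map
      over the apex of a span through \<open>q\<close> and \<open>r\<close>; naturality transfers
      this equality to \<open>Y\<close>.\<close>
    have agree: "elt_map Y c (\<alpha> c y) q = elt_map Y d (\<alpha> d z) r"
      if c: "c \<in> Obj C" and y: "y \<in> elts X c" and q: "q \<in> pt c"
        and d: "d \<in> Obj C" and z: "z \<in> elts X d" and r: "r \<in> pt d"
        and eq: "elt_map X c y q = elt_map X d z r" for c y q d z r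
    proof -
      obtain b k u v where b: "b \<in> Obj C" "generates M (on_obj K b) k" "u \<in> Hom C b c" "v \<in> Hom C b d"
        "on_hom K b c u k = q" "on_hom K b d v k = r"
        using spanE[OF c d q r] by metis
      have k: "k \<in> pt b"
        using generatesD(1)[OF b(2)] .
      let ?y = "on_hom (nerve X) c b u y" and ?z = "on_hom (nerve X) d b v z"
      have yz: "?y \<in> elts X b" "?z \<in> elts X b"
        using nerve_hom(1)[OF c b(1,3) y] nerve_hom(1)[OF d b(1,4) z] by simp_all
      have "elt_map X b ?y = elt_map X b ?z"
        by (rule equivariant_eq_of_generator[OF b(2) elt_map(1)[OF yz(1)] elt_map(1)[OF yz(2)]])
          (use nerve_hom(2)[OF c b(1,3) y k] nerve_hom(2)[OF d b(1,4) z k] b(5,6) eq in simp)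
      then have "?y = ?z"
        by (rule elt_eqI[OF yz])
      then have "on_hom (nerve Y) c b u (\<alpha> c y) = on_hom (nerve Y) d b v (\<alpha> d z)"
        using \<alpha>(3)[OF c b(1,3) y] \<alpha>(3)[OF d b(1,4) z] by simp
      then show ?thesis
        using nerve_hom(2)[OF c b(1,3) \<alpha>Y[OF c y] k] nerve_hom(2)[OF d b(1,4) \<alpha>Y[OF d z] k] b(5,6)
        by simp
    qed
    define \<phi> where "\<phi> x = (SOME w. \<exists>c y q. c \<in> Obj C \<and> y \<in> elts X c \<and> q \<in> pt c \<and>
        elt_map X c y q = x \<and> w = elt_map Y c (\<alpha> c y) q)" for x
    have \<phi>: "elt_map Y c (\<alpha> c y) q = \<phi> (elt_map X c y q)"
      if c: "c \<in> Obj C" and y: "y \<in> elts X c" and q: "q \<in> pt c" for c y q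
      unfolding \<phi>_def
    proof (rule sym, rule some_equality)
      show "\<exists>d z r. d \<in> Obj C \<and> z \<in> elts X d \<and> r \<in> pt d \<and>
          elt_map X d z r = elt_map X c y q \<and> elt_map Y c (\<alpha> c y) q = elt_map Y d (\<alpha> d z) r"
        using c y q by blast
      fix w assume "\<exists>d z r. d \<in> Obj C \<and> z \<in> elts X d \<and> r \<in> pt d \<and>
          elt_map X d z r = elt_map X c y q \<and> w = elt_map Y d (\<alpha> d z) r"
      then obtain d z r where d: "d \<in> Obj C" "z \<in> elts X d" "r \<in> pt d"
        "elt_map X d z r = elt_map X c y q" "w = elt_map Y d (\<alpha> d z) r"
        by blast
      then show "w = elt_map Y c (\<alpha> c y) q"
        using agree[OF d(1-3) c y q] by simp
    qed
    let ?\<phi> = "restrict \<phi> (points X)"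
    have eq: "?\<phi> \<in> equivariant_maps M X Y"
    proof (rule restrict_equivariantI)
      fix x assume x: "x \<in> points X"
      obtain c k y where c: "c \<in> Obj C" "generates M (on_obj K c) k" "y \<in> elts X c" "elt_map X c y k = x"
        using elt_of_point[OF X x] by metis
      have k: "k \<in> pt c"
        using generatesD(1)[OF c(2)] .
      note y = elt_map(1)[OF c(3)] and \<alpha>y = elt_map(1)[OF \<alpha>Y[OF c(1,3)]]
      show "\<phi> x \<in> points Y"
        using \<phi>[OF c(1,3) k] c(4) equivariantD(1)[OF \<alpha>y k] by simp
      fix m assume m: "m \<in> carrier M"
      show "act X (x, m) \<in> points X"
        using msetD(1)[OF X x m] .
      have km: "act (on_obj K c) (k, m) \<in> pt c"
        using msetD(1)[OF K_obj[OF c(1)] k m] .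
      show "\<phi> (act X (x, m)) = act Y (\<phi> x, m)"
        using \<phi>[OF c(1,3) km] \<phi>[OF c(1,3) k] c(4) equivariantD(2)[OF y k m] equivariantD(2)[OF \<alpha>y k m]
        by simp
    qed
    have "?N ?\<phi> = \<alpha>"
    proof (rule extensionalityI[of _ "Obj C"])
      fix c assume c: "c \<in> Obj C"
      have "\<phi> y = \<alpha> c y" if y: "y \<in> elts X c" for y
        using \<phi>[OF c y gen_in[OF c]] elt_map(2)[OF y] elt_map(2)[OF \<alpha>Y[OF c y]] by simp
      then show "?N ?\<phi> c = \<alpha> c"
        using c \<alpha>(2)[OF c] elts_subset[OF c]
        by (intro extensionalityI[of _ "elts X c"]) (auto simp: nerve_functor_def PiE_iff)
    qed (use \<alpha> in \<open>auto simp: nerve_functor_def\<close>)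
    then show "\<alpha> \<in> ?N ` Hom (Cont M \<tau>) X Y"
      using eq by force
  qed
qed

end

section \<open>Sheaves are nerves\<close>

text \<open>Right congruences are subsets of \<open>carrier M * carrier M\<close>. For infinite
  \<open>M\<close> the square is no larger than \<open>M\<close>; for finite \<open>M\<close> its
  power set is finite and fits into the infinite universe.\<close>

lemma lepoll_Pow_times_self:
  assumes "small_monoid TYPE('u) M"
  shows "Pow (carrier M \<times> carrier M) \<lesssim> (UNIV :: 'u set)"
proof (cases "finite (carrier M)")
  case True
  then show ?thesis
    using assms by (simp add: small_monoid_def finite_lepoll_infinite)
next
  case False
  have "\<exists>f. inj_on f (carrier M \<times> carrier M) \<and> f ` (carrier M \<times> carrier M) \<subseteq> carrier M"
    unfolding card_of_ordLeq using card_of_Times_same_infinite[OF False] by (rule ordIso_imp_ordLeq)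
  then obtain f where f: "inj_on f (carrier M \<times> carrier M)"
    "f ` (carrier M \<times> carrier M) \<subseteq> carrier M"
    by blast
  then have "Pow (carrier M \<times> carrier M) \<lesssim> Pow (carrier M)"
    unfolding lepoll_def by (intro exI[of _ "(`) f"] conjI inj_on_image_Pow) auto
  then show ?thesis
    using assms lepoll_trans unfolding small_monoid_def by blast
qed

locale sheaf_on_principal_dense = principal_dense C M \<tau> K
  for C :: "('o, 'a) cat" and M :: "'m monoid" (structure) and \<tau> :: "'m topology"
    and K :: "('o, 'a, ('u, 'm) mset, 'u \<Rightarrow> 'u) func" +
  fixes F :: "('o, 'a, 'u set, 'u \<Rightarrow> 'u) func"
  assumes F: "F \<in> Obj (Sh C (reductive_topology C))"
begin

section \<open>The sheaf condition along a single surjection\<close>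

lemma presheaf: "cat_functor (op_cat C) set_cat F" and sheaf: "is_sheaf C (reductive_topology C) F"
  using F by (simp_all add: Sh_Obj)

lemma F_in: "c \<in> Obj C \<Longrightarrow> d \<in> Obj C \<Longrightarrow> f \<in> Hom C d c \<Longrightarrow> x \<in> on_obj F c \<Longrightarrow>
    on_hom F c d f x \<in> on_obj F d"
  by (rule K.dom.presheafD(2)[OF presheaf])

lemma F_idt: "c \<in> Obj C \<Longrightarrow> x \<in> on_obj F c \<Longrightarrow> on_hom F c c (Idt C c) x = x"
  using K.dom.presheafD(3)[OF presheaf, of c c "Idt C c"] K.dom.idt_in_hom by blast

lemma F_cmp: "c \<in> Obj C \<Longrightarrow> d \<in> Obj C \<Longrightarrow> e \<in> Obj C \<Longrightarrow> f \<in> Hom C d c \<Longrightarrow> g \<in> Hom C e d \<Longrightarrow>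
    x \<in> on_obj F c \<Longrightarrow> on_hom F c e (Cmp C e d c f g) x = on_hom F d e g (on_hom F c d f x)"
  by (rule K.dom.presheafD(4)[OF presheaf])

text \<open>This is the sheaf condition for the sieve generated by \<open>e\<close>: by
  \<open>ker\<close>, the restrictions of \<open>t\<close> form a matching family on it, and an
  amalgamation is the same as a \<open>b\<close> restricting to \<open>t\<close> along
  \<open>e\<close>.\<close>

lemma ex1_descent:
  assumes A: "A \<in> Obj C" and B: "B \<in> Obj C" and e: "e \<in> Hom C A B"
    and surj: "on_hom K A B e ` pt A = pt B"
    and t: "t \<in> on_obj F A"
    and ker: "\<And>Z g h. Z \<in> Obj C \<Longrightarrow> g \<in> Hom C Z A \<Longrightarrow> h \<in> Hom C Z A \<Longrightarrow>
      Cmp C Z A B e g = Cmp C Z A B e h \<Longrightarrow> on_hom F A Z g t = on_hom F A Z h t"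
  shows "\<exists>!b. b \<in> on_obj F B \<and> on_hom F B A e b = t"
proof -
  define S where "S = {(Z, Cmp C Z A B e g) |Z g. Z \<in> Obj C \<and> g \<in> Hom C Z A}"
  \<comment> \<open>An arrow of the sieve can factor through \<open>e\<close> in several ways;
    \<open>ker\<close> makes the chosen factorization irrelevant.\<close>
  define x where "x Z f = on_hom F A Z (SOME g. g \<in> Hom C Z A \<and> Cmp C Z A B e g = f) t" for Z f
  have x: "x Z (Cmp C Z A B e g) = on_hom F A Z g t" if "Z \<in> Obj C" "g \<in> Hom C Z A" for Z g
  proof -
    let ?P = "\<lambda>h. h \<in> Hom C Z A \<and> Cmp C Z A B e h = Cmp C Z A B e g"
    have "?P (SOME h. ?P h)"
      by (rule someI[of ?P g]) (use that in simp)
    then show ?thesis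
      unfolding x_def using ker that by blast
  qed
  have eS: "(A, e) \<in> S"
    unfolding S_def using A B e K.dom.cmp_idt_right K.dom.idt_in_hom by force
  have "sieve C B S"
    unfolding sieve_def S_def using A B e
    by (auto simp: K.dom.cmp_in_hom simp flip: K.dom.cmp_assoc)
  then have S: "S \<in> reductive_topology C B"
    using eS surj strict_epi_iff[OF A B e] unfolding reductive_topology_def by auto
  have "matching_family C F B S x"
    unfolding matching_family_def
  proof (intro ballI, clarify)
    fix Y f assume "(Y, f) \<in> S"
    then obtain g where g: "Y \<in> Obj C" "g \<in> Hom C Y A" "f = Cmp C Y A B e g"
      unfolding S_def by auto
    have "on_hom F Y Z h (x Y f) = x Z (Cmp C Z Y B f h)" if Z: "Z \<in> Obj C" "h \<in> Hom C Z Y" for Z h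
    proof -
      have "Cmp C Z Y B f h = Cmp C Z A B e (Cmp C Z Y A g h)"
        using g Z A B e by (simp add: K.dom.cmp_assoc)
      then show ?thesis
        using g Z A t by (simp add: x F_cmp K.dom.cmp_in_hom)
    qed
    then show "x Y f \<in> on_obj F Y \<and>
        (\<forall>Z\<in>Obj C. \<forall>h\<in>Hom C Z Y. on_hom F Y Z h (x Y f) = x Z (Cmp C Z Y B f h))"
      using g A t by (simp add: x F_in)
  qed
  then have "\<exists>!b. b \<in> on_obj F B \<and> (\<forall>(Y, f)\<in>S. on_hom F B Y f b = x Y f)"
    using sheaf B S unfolding is_sheaf_def by blast
  moreover have "(\<forall>(Y, f)\<in>S. on_hom F B Y f b = x Y f) \<longleftrightarrow> on_hom F B A e b = t"
    if b: "b \<in> on_obj F B" for b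
  proof
    assume "\<forall>(Y, f)\<in>S. on_hom F B Y f b = x Y f"
    then have "on_hom F B A e b = x A e"
      using eS by auto
    also have "\<dots> = t"
      using x[OF A K.dom.idt_in_hom[OF A]] A B e t by (simp add: K.dom.cmp_idt_right F_idt)
    finally show "on_hom F B A e b = t" .
  next
    assume "on_hom F B A e b = t"
    then show "\<forall>(Y, f)\<in>S. on_hom F B Y f b = x Y f"
      unfolding S_def using A B e b by (auto simp: x F_cmp)
  qed
  ultimately show ?thesis
    by (simp only: cong: conj_cong)
qed

text \<open>Uniqueness in \<open>ex1_descent\<close> for the section
  \<open>on_hom F B A e a\<close>, whose compatibility is plain functoriality.\<close>

lemma restriction_inj:
  assumes A: "A \<in> Obj C" and B: "B \<in> Obj C" and e: "e \<in> Hom C A B"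
    and surj: "on_hom K A B e ` pt A = pt B"
    and ab: "a \<in> on_obj F B" "b \<in> on_obj F B" "on_hom F B A e a = on_hom F B A e b"
  shows "a = b"
proof -
  have "\<exists>!b. b \<in> on_obj F B \<and> on_hom F B A e b = on_hom F B A e a"
    by (rule ex1_descent[OF A B e surj F_in[OF B A e ab(1)]])
      (use A B e ab(1) in \<open>simp flip: F_cmp\<close>)
  then show ?thesis
    using ab by metis
qed

text \<open>
  The M-set corresponding to the sheaf is the coend of \<open>K c \<times> F c\<close> over \<open>c\<close>; since \<open>C\<close> has
  spans through any two points, two triples are identified as soon as they agree over a
  common refinement.
\<close>

definition "triples = (SIGMA c:Obj C. pt c \<times> on_obj F c)"

definition "agree = (\<lambda>(c, p, a) (d, q, b). \<exists>e\<in>Obj C. \<exists>k\<in>pt e. \<exists>u\<in>Hom C e c. \<exists>v\<in>Hom C e d.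
  on_hom K e c u k = p \<and> on_hom K e d v k = q \<and> on_hom F c e u a = on_hom F d e v b)"

lemma agreeI:
  assumes "e \<in> Obj C" "k \<in> pt e" "u \<in> Hom C e c" "v \<in> Hom C e d"
    "on_hom K e c u k = p" "on_hom K e d v k = q" "on_hom F c e u a = on_hom F d e v b"
  shows "agree (c, p, a) (d, q, b)"
  using assms unfolding agree_def by blast

lemma agreeE:
  assumes "agree (c, p, a) (d, q, b)"
  obtains e k u v where "e \<in> Obj C" "k \<in> pt e" "u \<in> Hom C e c" "v \<in> Hom C e d"
    "on_hom K e c u k = p" "on_hom K e d v k = q" "on_hom F c e u a = on_hom F d e v b"
  using assms unfolding agree_def by blast

lemma agree_restrict:
  assumes "c \<in> Obj C" "d \<in> Obj C" "f \<in> Hom C d c" "q \<in> pt d" "a \<in> on_obj F c"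
  shows "agree (d, q, on_hom F c d f a) (c, on_hom K d c f q, a)"
  using assms by (intro agreeI[of d q "Idt C d" d f]) (simp_all add: K.dom.idt_in_hom K_idt F_idt F_in)

lemma agree_refl: "t \<in> triples \<Longrightarrow> agree t t"
  unfolding triples_def by (auto intro!: agreeI K.dom.idt_in_hom K_idt)

lemma agree_sym: "agree s t \<Longrightarrow> agree t s"
  unfolding agree_def by (auto split: prod.splits) metis

text \<open>The two refinements meet in the point \<open>q\<close>, so a span through their points
  \<open>k\<close> and \<open>k'\<close> refines both; its two composites into \<open>d\<close>
  coincide because they do at the generator.\<close>

lemma agree_trans:
  assumes st: "agree s t" and tr: "agree t r"
    and mem: "s \<in> triples" "t \<in> triples" "r \<in> triples"
  shows "agree s r"
proof -
  obtain c p a d q b c' p' a' where eq: "s = (c, p, a)" "t = (d, q, b)" "r = (c', p', a')"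
    by (metis prod_cases3)
  have m: "c \<in> Obj C" "d \<in> Obj C" "c' \<in> Obj C" "a \<in> on_obj F c" "b \<in> on_obj F d" "a' \<in> on_obj F c'"
    using mem unfolding eq triples_def by auto
  obtain e k u v where e: "e \<in> Obj C" "k \<in> pt e" "u \<in> Hom C e c" "v \<in> Hom C e d"
    "on_hom K e c u k = p" "on_hom K e d v k = q" "on_hom F c e u a = on_hom F d e v b"
    using st unfolding eq by (rule agreeE)
  obtain e' k' u' v' where e': "e' \<in> Obj C" "k' \<in> pt e'" "u' \<in> Hom C e' d" "v' \<in> Hom C e' c'"
    "on_hom K e' d u' k' = q" "on_hom K e' c' v' k' = p'" "on_hom F d e' u' b = on_hom F c' e' v' a'"
    using tr unfolding eq by (rule agreeE)
  obtain z l w w' where z: "z \<in> Obj C" "generates M (on_obj K z) l" "w \<in> Hom C z e" "w' \<in> Hom C z e'"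
    "on_hom K z e w l = k" "on_hom K z e' w' l = k'"
    using spanE[OF e(1) e'(1) e(2) e'(2)] by metis
  have l: "l \<in> pt z"
    using generatesD(1)[OF z(2)] .
  have vw: "Cmp C z e d v w = Cmp C z e' d u' w'"
    by (rule hom_eqI[OF z(1) m(2) _ _ z(2)])
      (use m e e' z l in \<open>simp_all add: K.dom.cmp_in_hom K_cmp\<close>)
  have "on_hom F c z (Cmp C z e c u w) a = on_hom F d z (Cmp C z e d v w) b"
    using m e z by (simp add: F_cmp)
  also have "\<dots> = on_hom F c' z (Cmp C z e' c' v' w') a'"
    unfolding vw using m e' z by (simp add: F_cmp)
  finally show ?thesis
    unfolding eq using m e e' z l
    by (intro agreeI[of z l "Cmp C z e c u w" c "Cmp C z e' c' v' w'" c'])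
      (simp_all add: K.dom.cmp_in_hom K_cmp)
qed

lemma agree_act:
  assumes "agree (c, p, a) (d, q, b)" "c \<in> Obj C" "d \<in> Obj C" and m: "m \<in> carrier M"
  shows "agree (c, act (on_obj K c) (p, m), a) (d, act (on_obj K d) (q, m), b)"
proof -
  obtain e k u v where e: "e \<in> Obj C" "k \<in> pt e" "u \<in> Hom C e c" "v \<in> Hom C e d"
    "on_hom K e c u k = p" "on_hom K e d v k = q" "on_hom F c e u a = on_hom F d e v b"
    using assms(1) by (rule agreeE)
  show ?thesis
    using e m assms(2,3) equivariantD(2)[OF K_hom[OF e(1) assms(2) e(3)] e(2) m]
      equivariantD(2)[OF K_hom[OF e(1) assms(3) e(4)] e(2) m]
    by (intro agreeI[OF e(1) msetD(1)[OF K_obj[OF e(1)] e(2) m] e(3,4)]) simp_all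
qed

text \<open>The right congruence whose quotient of \<open>M\<close> is the orbit of
  \<open>p\<close>.\<close>

definition "congr c p = {(m, n) \<in> carrier M \<times> carrier M. act (on_obj K c) (p, m) = act (on_obj K c) (p, n)}"

definition "rep r = (SOME (c, k). c \<in> Obj C \<and> generates M (on_obj K c) k \<and> congr c k = r)"

text \<open>The congruence of \<open>p\<close> is also that of a generator, because the orbit of
  \<open>p\<close> is isomorphic to some \<open>K d\<close> with \<open>p\<close> corresponding to a
  generator.\<close>

lemma rep:
  assumes c: "c \<in> Obj C" and p: "p \<in> pt c"
  shows "fst (rep (congr c p)) \<in> Obj C"
    "generates M (on_obj K (fst (rep (congr c p)))) (snd (rep (congr c p)))"
    "congr (fst (rep (congr c p))) (snd (rep (congr c p))) = congr c p"
proof -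
  obtain d k i where d: "d \<in> Obj C" "generates M (on_obj K d) k"
    and i: "i \<in> equivariant_maps M (on_obj K d) (on_obj K c)" "inj_on i (pt d)" "i k = p"
    using coverE[OF K_obj[OF c] p] by metis
  have k: "k \<in> pt d"
    using generatesD(1)[OF d(2)] .
  have "act (on_obj K d) (k, m) = act (on_obj K d) (k, n) \<longleftrightarrow> act (on_obj K c) (p, m) = act (on_obj K c) (p, n)"
    if "m \<in> carrier M" "n \<in> carrier M" for m n
    using that k i inj_on_eq_iff[OF i(2) msetD(1)[OF K_obj[OF d(1)] k] msetD(1)[OF K_obj[OF d(1)] k]]
    by (simp add: equivariantD(2)[OF i(1) k])
  then have "congr d k = congr c p"
    unfolding congr_def by auto
  then have ex: "\<exists>x. case x of (d, k) \<Rightarrow> d \<in> Obj C \<and> generates M (on_obj K d) k \<and> congr d k = congr c p"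
    using d by (intro exI[of _ "(d, k)"]) simp
  show "fst (rep (congr c p)) \<in> Obj C"
    "generates M (on_obj K (fst (rep (congr c p)))) (snd (rep (congr c p)))"
    "congr (fst (rep (congr c p))) (snd (rep (congr c p))) = congr c p"
    using someI_ex[OF ex] unfolding rep_def[symmetric] by (auto simp: case_prod_beta)
qed

text \<open>Equal kernels give a map \<open>K d\<close> to \<open>K c\<close> sending
  \<open>k\<close> to \<open>p\<close>; it comes from an arrow of \<open>C\<close>, along which
  \<open>a\<close> is restricted.\<close>

lemma ex_agree_rep:
  assumes c: "c \<in> Obj C" and p: "p \<in> pt c" and a: "a \<in> on_obj F c"
    and d: "d \<in> Obj C" "generates M (on_obj K d) k" "congr d k = congr c p"
  shows "\<exists>b\<in>on_obj F d. agree (c, p, a) (d, k, b)"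
proof -
  have "act (on_obj K c) (p, m) = act (on_obj K c) (p, n)"
    if "m \<in> carrier M" "n \<in> carrier M" "act (on_obj K d) (k, m) = act (on_obj K d) (k, n)" for m n
    using d(3) that unfolding congr_def by blast
  then obtain h where h: "h \<in> equivariant_maps M (on_obj K d) (on_obj K c)" "h k = p"
    using equivariant_extend[OF K_obj[OF d(1)] K_obj[OF c] d(2) p] by blast
  obtain f where f: "f \<in> Hom C d c" "on_hom K d c f = h"
    using homE[OF d(1) c h(1)] by blast
  have "agree (d, k, on_hom F c d f a) (c, p, a)"
    using agree_restrict[OF c d(1) f(1) generatesD(1)[OF d(2)] a] f(2) h(2) by simp
  then show ?thesis
    using agree_sym F_in[OF c d(1) f(1) a] by blast
qed

text \<open>
  Every triple agrees with one over a representative determined by the kernel of its point, so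
  that the number of classes is bounded by the number of right congruences times \<open>|'u|\<close>.
\<close>

lemma ex_classifier: "\<exists>cls :: 'o \<times> 'u \<times> 'u \<Rightarrow> 'u. \<forall>s\<in>triples. \<forall>t\<in>triples. cls s = cls t \<longleftrightarrow> agree s t"
proof -
  define code where "code = (\<lambda>(c, p, a). (congr c p, SOME b. b \<in> on_obj F (fst (rep (congr c p))) \<and>
      agree (c, p, a) (fst (rep (congr c p)), snd (rep (congr c p)), b)))"
  have code: "(fst (rep (fst (code t))), snd (rep (fst (code t))), snd (code t)) \<in> triples \<and>
      agree t (fst (rep (fst (code t))), snd (rep (fst (code t))), snd (code t))"
    if "t \<in> triples" for t
  proof -
    obtain c p a where t: "t = (c, p, a)" "c \<in> Obj C" "p \<in> pt c" "a \<in> on_obj F c"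
      using \<open>t \<in> triples\<close> unfolding triples_def by auto
    note r = rep[OF t(2,3)]
    have "snd (code t) \<in> on_obj F (fst (rep (congr c p))) \<and>
      agree (c, p, a) (fst (rep (congr c p)), snd (rep (congr c p)), snd (code t))"
      unfolding code_def t(1) prod.case snd_conv
      by (rule someI_ex) (use ex_agree_rep[OF t(2-4) r] in blast)
    then show ?thesis
      using r(1) generatesD(1)[OF r(2)] by (simp add: t(1) triples_def code_def)
  qed
  have code_agree: "agree s t" if s: "s \<in> triples" and t: "t \<in> triples" and eq: "code s = code t" for s t
    using agree_trans[OF _ agree_sym s _ t] code[OF s] code[OF t] eq by metis
  have code_Pow: "code t \<in> Pow (carrier M \<times> carrier M) \<times> UNIV" for t
    unfolding code_def congr_def by (auto split: prod.splits)
  obtain p :: "'u \<times> 'u \<Rightarrow> 'u" where p: "inj p"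
    using inj_pairing[OF infinite_universe] by blast
  obtain g :: "('m \<times> 'm) set \<Rightarrow> 'u" where g: "inj_on g (Pow (carrier M \<times> carrier M))"
    using lepoll_Pow_times_self[OF small] unfolding lepoll_def by blast
  \<comment> \<open>Agreeing triples may have points with different kernels, so \<open>code\<close>
    is not constant on classes. One triple per class is chosen first and only that one is
    coded.\<close>
  define cls where "cls t = (let s = SOME s. s \<in> triples \<and> agree s t in p (g (fst (code s)), snd (code s)))" for t
  have "cls s = cls t \<longleftrightarrow> agree s t" if s: "s \<in> triples" and t: "t \<in> triples" for s t
  proof
    assume "agree s t"
    then have "(\<lambda>r. r \<in> triples \<and> agree r s) = (\<lambda>r. r \<in> triples \<and> agree r t)"
      using agree_trans agree_sym s t by blast
    then show "cls s = cls t"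
      unfolding cls_def by simp
  next
    assume eq: "cls s = cls t"
    define s' where "s' = (SOME r. r \<in> triples \<and> agree r s)"
    define t' where "t' = (SOME r. r \<in> triples \<and> agree r t)"
    have s': "s' \<in> triples \<and> agree s' s"
      unfolding s'_def using someI_ex[of "\<lambda>r. r \<in> triples \<and> agree r s"] s agree_refl by blast
    have t': "t' \<in> triples \<and> agree t' t"
      unfolding t'_def using someI_ex[of "\<lambda>r. r \<in> triples \<and> agree r t"] t agree_refl by blast
    have "(g (fst (code s')), snd (code s')) = (g (fst (code t')), snd (code t'))"
      using eq p unfolding cls_def Let_def s'_def[symmetric] t'_def[symmetric] by (simp add: inj_eq)
    then have "code s' = code t'"
      using inj_onD[OF g, of "fst (code s')" "fst (code t')"] code_Pow[of s'] code_Pow[of t']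
      by (simp add: prod_eq_iff mem_Times_iff)
    then have "agree s' t'"
      using code_agree s' t' by blast
    then show "agree s t"
      using agree_trans agree_sym s t s' t' by meson
  qed
  then show ?thesis
    by blast
qed

section \<open>The action realizing a sheaf\<close>

definition "cls = (SOME cls :: 'o \<times> 'u \<times> 'u \<Rightarrow> 'u. \<forall>s\<in>triples. \<forall>t\<in>triples. cls s = cls t \<longleftrightarrow> agree s t)"

lemma cls_eq_iff: "s \<in> triples \<Longrightarrow> t \<in> triples \<Longrightarrow> cls s = cls t \<longleftrightarrow> agree s t"
  using someI_ex[OF ex_classifier] unfolding cls_def by blast

definition "cls_act z m = (case SOME t. t \<in> triples \<and> cls t = z of
  (c, p, a) \<Rightarrow> cls (c, act (on_obj K c) (p, m), a))"

definition "realization = make_mset M (cls ` triples) cls_act"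

lemma triples_act: "(c, p, a) \<in> triples \<Longrightarrow> m \<in> carrier M \<Longrightarrow> (c, act (on_obj K c) (p, m), a) \<in> triples"
  unfolding triples_def using msetD(1)[OF K_obj] by auto

lemma cls_act:
  assumes t: "(c, p, a) \<in> triples" and m: "m \<in> carrier M"
  shows "cls_act (cls (c, p, a)) m = cls (c, act (on_obj K c) (p, m), a)"
proof -
  obtain d q b where s: "(SOME t. t \<in> triples \<and> cls t = cls (c, p, a)) = (d, q, b)"
    by (rule prod_cases3)
  have dqb: "(d, q, b) \<in> triples" "cls (d, q, b) = cls (c, p, a)"
    using someI[of "\<lambda>t. t \<in> triples \<and> cls t = cls (c, p, a)" "(c, p, a)"] t unfolding s by auto
  then have "agree (d, q, b) (c, p, a)"
    using cls_eq_iff t by blast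
  then have "agree (d, act (on_obj K d) (q, m), b) (c, act (on_obj K c) (p, m), a)"
    using dqb(1) t m by (intro agree_act) (auto simp: triples_def)
  then have "cls (d, act (on_obj K d) (q, m), b) = cls (c, act (on_obj K c) (p, m), a)"
    using cls_eq_iff triples_act dqb(1) t m by blast
  then show ?thesis
    unfolding cls_act_def s by simp
qed

lemma continuous_realization: "continuous_mset M \<tau> realization"
  unfolding realization_def
proof (rule continuous_make_mset)
  fix z w assume z: "z \<in> cls ` triples" and w: "w \<in> cls ` triples"
  obtain c p a where t: "z = cls (c, p, a)" "(c, p, a) \<in> triples"
    using z by auto
  have cp: "continuous_mset M \<tau> (on_obj K c)" "p \<in> pt c"
    using t(2) K_obj unfolding triples_def by auto
  \<comment> \<open>The translate of \<open>z\<close> by \<open>m\<close> depends on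
    \<open>m\<close> only through the translate of \<open>p\<close> in \<open>K c\<close>, so
    continuity is inherited from \<open>K c\<close>.\<close>
  have "{m \<in> carrier M. cls_act z m = w} =
    (\<Union>q\<in>{q \<in> pt c. cls (c, q, a) = w}. {m \<in> carrier M. act (on_obj K c) (p, m) = q})"
    using t cls_act msetD(1)[OF cp] by auto
  also have "openin \<tau> \<dots>"
    using msetD(4)[OF cp] by auto
  finally show "openin \<tau> {m \<in> carrier M. cls_act z m = w}" .
next
  fix z assume "z \<in> cls ` triples"
  then obtain c p a where t: "z = cls (c, p, a)" "(c, p, a) \<in> triples"
    by auto
  have cp: "continuous_mset M \<tau> (on_obj K c)" "p \<in> pt c"
    using t(2) K_obj unfolding triples_def by auto
  show "cls_act z \<one> = z"
    using t msetD(2)[OF cp] by (simp add: cls_act)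
  show "cls_act z m \<in> cls ` triples" if "m \<in> carrier M" for m
    using t that triples_act by (simp add: cls_act)
  show "cls_act (cls_act z m) n = cls_act z (m \<otimes> n)" if "m \<in> carrier M" "n \<in> carrier M" for m n
    using t that msetD(3)[OF cp] by (simp add: cls_act triples_act)
qed

lemma points_realization: "points realization = cls ` triples"
  by (simp add: realization_def)

lemma class_map:
  assumes c: "c \<in> Obj C" and a: "a \<in> on_obj F c"
  shows "restrict (\<lambda>p. cls (c, p, a)) (pt c) \<in> equivariant_maps M (on_obj K c) realization"
proof (rule restrict_equivariantI)
  fix p assume p: "p \<in> pt c"
  then have t: "(c, p, a) \<in> triples"
    using c a by (simp add: triples_def)
  then show "cls (c, p, a) \<in> points realization"
    by (simp add: points_realization)
  fix m assume m: "m \<in> carrier M"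
  show "act (on_obj K c) (p, m) \<in> pt c"
    using msetD(1)[OF K_obj[OF c] p m] .
  show "cls (c, act (on_obj K c) (p, m), a) = act realization (cls (c, p, a), m)"
    using t m by (simp add: realization_def cls_act)
qed

lemma cls_restrict:
  assumes "c \<in> Obj C" "d \<in> Obj C" "f \<in> Hom C d c" "q \<in> pt d" "a \<in> on_obj F c"
  shows "cls (d, q, on_hom F c d f a) = cls (c, on_hom K d c f q, a)"
  using agree_restrict[OF assms] assms
  by (subst cls_eq_iff) (auto simp: triples_def F_in K_hom_in)

text \<open>Injectivity of the comparison with the nerve. Agreement at a generator \<open>k\<close>
  yields, after refining to a generator of the apex, a single arrow into \<open>c\<close> along
  which \<open>a\<close> and \<open>b\<close> restrict equally. It hits \<open>k\<close>, so it is
  surjective and restriction along it is injective.\<close>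

lemma cls_inj:
  assumes c: "c \<in> Obj C" and k: "generates M (on_obj K c) k" and a: "a \<in> on_obj F c" and b: "b \<in> on_obj F c"
    and eq: "cls (c, k, a) = cls (c, k, b)"
  shows "a = b"
proof -
  have "(c, k, a) \<in> triples" "(c, k, b) \<in> triples"
    using c a b generatesD(1)[OF k] by (simp_all add: triples_def)
  then have "agree (c, k, a) (c, k, b)"
    using eq cls_eq_iff by blast
  then obtain e j u v where e: "e \<in> Obj C" "j \<in> pt e" "u \<in> Hom C e c" "v \<in> Hom C e c"
    "on_hom K e c u j = k" "on_hom K e c v j = k" "on_hom F c e u a = on_hom F c e v b"
    by (rule agreeE)
  obtain d l w where d: "d \<in> Obj C" "generates M (on_obj K d) l" "w \<in> Hom C d e" "on_hom K d e w l = j"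
    using spanE[OF e(1) e(1) e(2) e(2)] by metis
  have l: "l \<in> pt d"
    using generatesD(1)[OF d(2)] .
  have uw: "Cmp C d e c u w \<in> Hom C d c" "on_hom K d c (Cmp C d e c u w) l = k"
    using c d e l by (simp_all add: K.dom.cmp_in_hom K_cmp)
  have vw: "Cmp C d e c u w = Cmp C d e c v w"
    by (rule hom_eqI[OF d(1) c _ _ d(2)]) (use c d e l in \<open>simp_all add: K.dom.cmp_in_hom K_cmp\<close>)
  have surj: "on_hom K d c (Cmp C d e c u w) ` pt d = pt c"
    using surj_of_generator[OF d(1) c uw(1) l] uw(2) k by simp
  have "on_hom F c d (Cmp C d e c u w) a = on_hom F c d (Cmp C d e c v w) b"
    using c d e a b by (simp add: F_cmp)
  then show ?thesis
    using restriction_inj[OF d(1) c uw(1) surj a b] vw by simp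
qed

text \<open>Surjectivity of the comparison. The value at the generator is the class of a section
  over some other object \<open>d\<close>; it is restricted to an apex \<open>e\<close> lying
  surjectively over \<open>c\<close> and then descended along \<open>u\<close>.\<close>

lemma class_map_surj:
  assumes c: "c \<in> Obj C" and f: "f \<in> equivariant_maps M (on_obj K c) realization"
  shows "\<exists>a\<in>on_obj F c. cls (c, gen c, a) = f (gen c)"
proof -
  have "f (gen c) \<in> cls ` triples"
    using equivariantD(1)[OF f gen_in[OF c]] by (simp add: points_realization)
  then obtain d q b where d: "d \<in> Obj C" "q \<in> pt d" "b \<in> on_obj F d" "f (gen c) = cls (d, q, b)"
    unfolding triples_def by auto
  obtain e k u v where e: "e \<in> Obj C" "generates M (on_obj K e) k" "u \<in> Hom C e c" "v \<in> Hom C e d"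
    "on_hom K e c u k = gen c" "on_hom K e d v k = q"
    using spanE[OF c d(1) gen_in[OF c] d(2)] by metis
  have k: "k \<in> pt e"
    using generatesD(1)[OF e(2)] .
  define t where "t = on_hom F d e v b"
  have t: "t \<in> on_obj F e"
    unfolding t_def using F_in[OF d(1) e(1,4) d(3)] .
  have surj: "on_hom K e c u ` pt e = pt c"
    using surj_of_generator[OF e(1) c e(3) k] gen[OF c] e(5) by simp
  have eq: "restrict (\<lambda>p. cls (e, p, t)) (pt e) = compose (pt e) f (on_hom K e c u)"
  proof (rule equivariant_eq_of_generator[OF e(2)])
    show "restrict (\<lambda>p. cls (e, p, t)) (pt e) \<in> equivariant_maps M (on_obj K e) realization"
      by (rule class_map[OF e(1) t])
    show "compose (pt e) f (on_hom K e c u) \<in> equivariant_maps M (on_obj K e) realization"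
      by (rule equivariant_compose[OF K_hom[OF e(1) c e(3)] f msetD(1)[OF K_obj[OF e(1)]]])
    show "restrict (\<lambda>p. cls (e, p, t)) (pt e) k = compose (pt e) f (on_hom K e c u) k"
      unfolding t_def using k e(5,6) d(4) cls_restrict[OF d(1) e(1,4) k d(3)] by (simp add: compose_eq)
  qed
  have fu: "cls (e, p, t) = f (on_hom K e c u p)" if "p \<in> pt e" for p
    using fun_cong[OF eq, of p] that by (simp add: compose_eq)
  \<comment> \<open>Compatibility for descent: by \<open>fu\<close>, the classes of both
    restrictions at \<open>gen Z\<close> are values of \<open>f\<close> at the same point of
    \<open>K c\<close>, and \<open>cls_inj\<close> recovers the sections from their classes.\<close>
  have "on_hom F e Z g t = on_hom F e Z h t"
    if Z: "Z \<in> Obj C" and g: "g \<in> Hom C Z e" and h: "h \<in> Hom C Z e"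
      and eq: "Cmp C Z e c u g = Cmp C Z e c u h" for Z g h
  proof (rule cls_inj[OF Z gen[OF Z] F_in[OF e(1) Z g t] F_in[OF e(1) Z h t]])
    have "on_hom K e c u (on_hom K Z e g (gen Z)) = on_hom K e c u (on_hom K Z e h (gen Z))"
      using K_cmp[OF Z e(1) c g e(3) gen_in[OF Z]] K_cmp[OF Z e(1) c h e(3) gen_in[OF Z]] eq by simp
    then show "cls (Z, gen Z, on_hom F e Z g t) = cls (Z, gen Z, on_hom F e Z h t)"
      using cls_restrict[OF e(1) Z g gen_in[OF Z] t] cls_restrict[OF e(1) Z h gen_in[OF Z] t]
        fu K_hom_in[OF Z e(1) g gen_in[OF Z]] K_hom_in[OF Z e(1) h gen_in[OF Z]] by simp
  qed
  then obtain a where a: "a \<in> on_obj F c" "on_hom F c e u a = t"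
    using ex1_descent[OF e(1) c e(3) surj t] by blast
  have "cls (c, gen c, a) = f (gen c)"
    using cls_restrict[OF c e(1,3) k a(1)] e(5) a(2) fu[OF k] by simp
  then show ?thesis
    using a(1) by blast
qed

lemma iso_nerve_realization:
  "\<exists>\<beta>. iso_in (Sh C (reductive_topology C)) (nerve realization) F \<beta>"
proof -
  \<comment> \<open>A section \<open>a\<close> gives the map \<open>K c\<close> to the realization
    sending \<open>p\<close> to the class of \<open>(c, p, a)\<close>; its code is the value at
    \<open>gen c\<close>.\<close>
  define \<alpha> where "\<alpha> = (\<lambda>c\<in>Obj C. \<lambda>a\<in>on_obj F c. cls (c, gen c, a))"
  have \<alpha>E: "cls (c, gen c, a) \<in> elts realization c"
    and \<alpha>M: "elt_map realization c (cls (c, gen c, a)) = restrict (\<lambda>p. cls (c, p, a)) (pt c)"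
    if "c \<in> Obj C" "a \<in> on_obj F c" for c a
    using elts_of_map[OF that(1) class_map[OF that]] gen_in[OF that(1)] by simp_all
  have "iso_in (Sh C (reductive_topology C)) F (nerve realization) \<alpha>"
  proof (rule K.dom.iso_in_Sh[OF F nerve_in_Sh[OF continuous_realization]])
    have "nat_trans (op_cat C) set_cat F (nerve realization) \<alpha>"
      unfolding K.dom.nat_trans_presheaf_iff[OF presheaf presheaf_nerve]
      by (auto simp: \<alpha>_def nerve_obj nerve_hom(3) \<alpha>E \<alpha>M F_in K_hom_in gen_in cls_restrict)
    then show "\<alpha> \<in> Hom (Sh C (reductive_topology C)) F (nerve realization)"
      by (simp add: Sh_simps \<alpha>_def)
    fix c assume c: "c \<in> Obj C"
    show "bij_betw (\<alpha> c) (on_obj F c) (on_obj (nerve realization) c)"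
      unfolding bij_betw_def
    proof (intro conjI equalityI subsetI)
      show "inj_on (\<alpha> c) (on_obj F c)"
        using c cls_inj[OF c gen[OF c]] by (intro inj_onI) (simp add: \<alpha>_def)
      show "x \<in> on_obj (nerve realization) c" if "x \<in> \<alpha> c ` on_obj F c" for x
        using that c by (auto simp: \<alpha>_def nerve_obj \<alpha>E)
      fix x assume "x \<in> on_obj (nerve realization) c"
      then obtain f where "f \<in> equivariant_maps M (on_obj K c) realization" "x = f (gen c)"
        using c by (auto simp: nerve_obj elts_def)
      then show "x \<in> \<alpha> c ` on_obj F c"
        using class_map_surj[OF c] c by (force simp: \<alpha>_def)
    qed
  qed
  then show ?thesis
    by (metis iso_in_sym)
qed

end

section \<open>Assembling the equivalences\<close>

lemma (in principal_dense) equivalent_Cont_Sh: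
  "equivalent_categories (Cont M \<tau> :: (('u, 'm) mset, 'u \<Rightarrow> 'u) cat)
    (Sh C (reductive_topology C) :: (('o, 'a, 'u set, 'u \<Rightarrow> 'u) func, 'o \<Rightarrow> 'u \<Rightarrow> 'u) cat)"
proof -
  have "ess_surj (Cont M \<tau>) (Sh C (reductive_topology C)) nerve_functor"
    unfolding ess_surj_def
  proof
    fix F :: "('o, 'a, 'u set, 'u \<Rightarrow> 'u) func" assume "F \<in> Obj (Sh C (reductive_topology C))"
    then interpret sheaf_on_principal_dense C M \<tau> K F
      by unfold_locales
    show "\<exists>X\<in>Obj (Cont M \<tau>). \<exists>f. iso_in (Sh C (reductive_topology C)) (on_obj nerve_functor X) F f"
      using iso_nerve_realization continuous_realization
      by (intro bexI[of _ realization]) (simp_all add: nerve_functor_def)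
  qed
  then show ?thesis
    using weak_equivalence_imp_equivalent nerve_functor nerve_fully_faithful
    unfolding weak_equivalence_def by blast
qed

text \<open>\<open>C_s\<close> is full in \<open>Cont\<close> and has the same isomorphisms, so
  \<open>\<Phi>\<close> may be read as a functor into \<open>Cont\<close> without change.\<close>

lemma principal_dense_of_weak_equivalence:
  fixes \<Phi> :: "('o, 'a, ('u, 'm) mset, 'u \<Rightarrow> 'u) func"
  assumes M: "monoid_with_topology M \<tau>" and small: "small_monoid TYPE('u) M"
    and \<Phi>: "weak_equivalence C (C_s M \<tau>) \<Phi>"
  shows "principal_dense C M \<tau> \<Phi>"
proof -
  interpret topological_monoid M \<tau>
    using M by (simp add: topological_monoid_iff)
  interpret \<Phi>: cat_functor C "C_s M \<tau>" \<Phi>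
    using \<Phi> by (simp add: weak_equivalence_def)
  have C_s: "Obj (C_s M \<tau>) = {X. continuous_mset M \<tau> X \<and> principal M X}"
    "Hom (C_s M \<tau>) = Hom (Cont M \<tau>)" "Idt (C_s M \<tau>) = Idt (Cont M \<tau>)" "Cmp (C_s M \<tau>) = Cmp (Cont M \<tau>)"
    "iso_in (C_s M \<tau>) = iso_in (Cont M \<tau>)"
    using category.iso_in_full_subcat[OF category_Cont] by (auto simp: C_s_def full_subcat_def)
  interpret Cont: category "Cont M \<tau> :: (('u, 'm) mset, 'u \<Rightarrow> 'u) cat"
    by (rule category_Cont)
  show ?thesis
  proof unfold_locales
    fix X assume "X \<in> Obj C"
    then show "on_obj \<Phi> X \<in> Obj (Cont M \<tau>)" "principal M (on_obj \<Phi> X)"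
      using \<Phi>.on_obj_in[of X] by (simp_all add: C_s(1))
  next
    fix X Y f assume "X \<in> Obj C" "Y \<in> Obj C" "f \<in> Hom C X Y"
    then show "on_hom \<Phi> X Y f \<in> Hom (Cont M \<tau>) (on_obj \<Phi> X) (on_obj \<Phi> Y)"
      using \<Phi>.on_hom_in[of X Y f] by (simp only: C_s)
  next
    fix X assume "X \<in> Obj C"
    then show "on_hom \<Phi> X X (Idt C X) = Idt (Cont M \<tau>) (on_obj \<Phi> X)"
      using \<Phi>.on_hom_idt[of X] by (simp only: C_s)
  next
    fix X Y Z f g assume "X \<in> Obj C" "Y \<in> Obj C" "Z \<in> Obj C" "f \<in> Hom C X Y" "g \<in> Hom C Y Z"
    then show "on_hom \<Phi> X Z (Cmp C X Y Z g f) = Cmp (Cont M \<tau>) (on_obj \<Phi> X) (on_obj \<Phi> Y)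
        (on_obj \<Phi> Z) (on_hom \<Phi> Y Z g) (on_hom \<Phi> X Y f)"
      using \<Phi>.on_hom_cmp[of X Y Z f g] by (simp only: C_s)
  next
    show "small_monoid TYPE('u) M"
      by (fact small)
    show "fully_faithful C (Cont M \<tau>) \<Phi>"
      using \<Phi> unfolding weak_equivalence_def fully_faithful_def by (simp only: C_s) blast
    show "\<exists>c\<in>Obj C. \<exists>f. iso_in (Cont M \<tau>) (on_obj \<Phi> c) P f"
      if "continuous_mset M \<tau> P" "principal M P" for P
      using \<Phi> that unfolding weak_equivalence_def ess_surj_def by (simp only: C_s) blast
  qed
qed

lemma (in category) weak_equivalence_id: "weak_equivalence C C id_func"
  unfolding weak_equivalence_def fully_faithful_def ess_surj_def
  using cat_functor_id[OF category_axioms] iso_in_idt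
  by (auto simp: id_func_def bij_betw_def)

text \<open>Both categories are sheaves on the same site \<open>C_s M \<tau>\<close>: one through
  the identity, the other through \<open>\<Phi>\<close>.\<close>

lemma equivalent_Cont_of_equivalent_C_s:
  fixes M :: "'m monoid" and \<tau> :: "'m topology" and M' :: "'n monoid" and \<tau>' :: "'n topology"
  assumes M: "monoid_with_topology M \<tau>" "small_monoid TYPE('u) M"
    and M': "monoid_with_topology M' \<tau>'" "small_monoid TYPE('u) M'"
    and eq: "equivalent_categories (C_s M \<tau> :: (('u, 'm) mset, 'u \<Rightarrow> 'u) cat)
      (C_s M' \<tau>' :: (('u, 'n) mset, 'u \<Rightarrow> 'u) cat)"
  shows "equivalent_categories (Cont M \<tau> :: (('u, 'm) mset, 'u \<Rightarrow> 'u) cat)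
      (Cont M' \<tau>' :: (('u, 'n) mset, 'u \<Rightarrow> 'u) cat)"
proof -
  obtain \<Phi> where \<Phi>: "weak_equivalence (C_s M \<tau> :: (('u, 'm) mset, 'u \<Rightarrow> 'u) cat)
      (C_s M' \<tau>' :: (('u, 'n) mset, 'u \<Rightarrow> 'u) cat) \<Phi>"
    using eq unfolding equivalent_categories_iff by blast
  have "category (C_s M \<tau> :: (('u, 'm) mset, 'u \<Rightarrow> 'u) cat)"
    using \<Phi> by (simp add: weak_equivalence_def cat_functor_def)
  then show ?thesis
    using principal_dense.equivalent_Cont_Sh[OF principal_dense_of_weak_equivalence[OF M' \<Phi>]]
      principal_dense.equivalent_Cont_Sh[OF principal_dense_of_weak_equivalence[OF M category.weak_equivalence_id]]
      equivalent_categories_sym equivalent_categories_trans by blast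
qed

theorem corollary1p22:
  fixes M :: "'m monoid" and \<tau> :: "'m topology"
  assumes "monoid_with_topology M \<tau>"
    and "small_monoid TYPE('u) M"
  shows "equivalent_categories
      (Cont M \<tau> :: (('u, 'm) mset, 'u \<Rightarrow> 'u) cat)
      (Sh (C_s M \<tau> :: (('u, 'm) mset, 'u \<Rightarrow> 'u) cat) (reductive_topology (C_s M \<tau>))
        :: ((('u, 'm) mset, 'u \<Rightarrow> 'u, 'u set, 'u \<Rightarrow> 'u) func, ('u, 'm) mset \<Rightarrow> 'u \<Rightarrow> 'u) cat)
    \<and> (\<forall>(M' :: 'n monoid) \<tau>'.
        monoid_with_topology M' \<tau>' \<longrightarrow> small_monoid TYPE('u) M' \<longrightarrow>
        (equivalent_categories
            (Cont M \<tau> :: (('u, 'm) mset, 'u \<Rightarrow> 'u) cat)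
            (Cont M' \<tau>' :: (('u, 'n) mset, 'u \<Rightarrow> 'u) cat)
          \<longleftrightarrow> equivalent_categories
            (C_s M \<tau> :: (('u, 'm) mset, 'u \<Rightarrow> 'u) cat)
            (C_s M' \<tau>' :: (('u, 'n) mset, 'u \<Rightarrow> 'u) cat)))"
proof (intro conjI allI impI iffI)
  interpret topological_monoid M \<tau>
    using assms(1) by (simp add: topological_monoid_iff)
  have "category (C_s M \<tau> :: (('u, 'm) mset, 'u \<Rightarrow> 'u) cat)"
    unfolding C_s_def by (rule category.full_subcat[OF category_Cont])
  then show "equivalent_categories (Cont M \<tau> :: (('u, 'm) mset, 'u \<Rightarrow> 'u) cat)
      (Sh (C_s M \<tau> :: (('u, 'm) mset, 'u \<Rightarrow> 'u) cat) (reductive_topology (C_s M \<tau>))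
        :: ((('u, 'm) mset, 'u \<Rightarrow> 'u, 'u set, 'u \<Rightarrow> 'u) func, ('u, 'm) mset \<Rightarrow> 'u \<Rightarrow> 'u) cat)"
    using principal_dense.equivalent_Cont_Sh[OF principal_dense_of_weak_equivalence[OF assms
        category.weak_equivalence_id]] by blast
  fix M' :: "'n monoid" and \<tau>'
  assume M': "monoid_with_topology M' \<tau>'" "small_monoid TYPE('u) M'"
  interpret M': topological_monoid M' \<tau>'
    using M' by (simp add: topological_monoid_iff)
  show "equivalent_categories (C_s M \<tau> :: (('u, 'm) mset, 'u \<Rightarrow> 'u) cat)
      (C_s M' \<tau>' :: (('u, 'n) mset, 'u \<Rightarrow> 'u) cat)"
    if "equivalent_categories (Cont M \<tau> :: (('u, 'm) mset, 'u \<Rightarrow> 'u) cat)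
      (Cont M' \<tau>' :: (('u, 'n) mset, 'u \<Rightarrow> 'u) cat)"
    \<comment> \<open>Both subcategories are cut out by a property invariant under equivalence; the
      smallness hypotheses supply the infinite universe needed to identify it with
      principality.\<close>
    unfolding C_s_def
    by (rule equivalent_full_subcat[OF that])
      (use assms(2) M'(2) in \<open>simp_all add: principal_iff_largest_proper_subobject
        M'.principal_iff_largest_proper_subobject small_monoid_def\<close>)
  show "equivalent_categories (Cont M \<tau> :: (('u, 'm) mset, 'u \<Rightarrow> 'u) cat)
      (Cont M' \<tau>' :: (('u, 'n) mset, 'u \<Rightarrow> 'u) cat)"
    if "equivalent_categories (C_s M \<tau> :: (('u, 'm) mset, 'u \<Rightarrow> 'u) cat)
      (C_s M' \<tau>' :: (('u, 'n) mset, 'u \<Rightarrow> 'u) cat)"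
    using equivalent_Cont_of_equivalent_C_s[OF assms M' that] .
qed

end
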